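(* Let $n\ge 2$ and $k\ge n+1$. Let $\beta:S^k\to S^n\subset\mathbb{R}^{n+1}$ be a Lipschitz map satisfying condition $( * )$. Then $\beta$ extends to a Lipschitz map $\gamma:D^{k+1}\to\mathbb{R}^{n+1}$ whose derivative has rank at most $n$ almost everywhere.
   Context: Condition $( * )$ on $\beta$: for every $m\ge1$, letting $Y=S^n\vee\cdots\vee S^n$ be the $m$-fold wedge of $n$-spheres and $i_j:S^n\to Y$ the inclusion of the $j$th wedge summand, one has $\bigl(\sum_{j=1}^m i_j\bigr)\circ\beta=\sum_{j=1}^m (i_j\circ\beta)$ in $\pi_k(Y)$ (equivalently, all Hopf–Hilton invariants of $\beta$ vanish); this holds e.g. when $\beta$ is a suspension of a map $S^{k-1}\to S^{n-1}$. $D^{k+1}$ is the closed unit ball in $\mathbb{R}^{k+1}$ with boundary $S^k$. *)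

theory Defs
  imports "HOL-Analysis.Analysis"
begin

text \<open>Model: R^(d+1) is represented by the type real \<times> 'd, where DIM('d) = d.
  The sphere S^d is sphere 0 1 in real \<times> 'd, with base point (-1, 0).\<close>

definition sph_base :: "real \<times> 'd::euclidean_space" where
  "sph_base = (-1, 0)"

text \<open>Fixed quotient map from the cube [0,1]^d onto S^d collapsing the boundary of
  the cube to the base point and homeomorphic on the interior.\<close>
definition cube_to_sphere :: "'d::euclidean_space \<Rightarrow> real \<times> 'd" where
  "cube_to_sphere x =
     (let u = x - (1/2) *\<^sub>R One; t = 2 * infnorm u
      in (cos (pi * t), sin (pi * t) *\<^sub>R (u /\<^sub>R norm u)))"

definition first_dir :: "'d::euclidean_space" where
  "first_dir = (SOME e. e \<in> Basis)"

text \<open>Concatenation of m cube maps along the first coordinate (the sum in pi_d).\<close>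
definition cube_sum :: "nat \<Rightarrow> (nat \<Rightarrow> 'd::euclidean_space \<Rightarrow> 'y) \<Rightarrow> 'd \<Rightarrow> 'y" where
  "cube_sum m \<phi>s x =
     (let t = x \<bullet> first_dir; j = min (m - 1) (nat \<lfloor>real m * t\<rfloor>)
      in \<phi>s j (x + (real m * t - real j - t) *\<^sub>R first_dir))"

text \<open>F : S^d \<rightarrow> Y represents (up to homotopy) the sum of the classes of fs 0, ..., fs (m-1)
  in pi_d(Y, y0).  Classes are taken as free homotopy classes; for simply connected Y
  these coincide with pi_d(Y, y0).\<close>
definition is_sphere_sum ::
  "'y::real_normed_vector set \<Rightarrow> 'y \<Rightarrow> nat \<Rightarrow> (nat \<Rightarrow> real \<times> 'd::euclidean_space \<Rightarrow> 'y)
     \<Rightarrow> (real \<times> 'd \<Rightarrow> 'y) \<Rightarrow> bool" where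
  "is_sphere_sum Y y0 m fs F \<longleftrightarrow>
     (\<exists>gs G. (\<forall>j<m. homotopic_with_canon (\<lambda>_. True) (sphere 0 1) Y (fs j) (gs j)
                  \<and> gs j sph_base = y0)
        \<and> continuous_on (sphere 0 1) G \<and> G ` sphere 0 1 \<subseteq> Y
        \<and> (\<forall>x\<in>cbox 0 One. G (cube_to_sphere x) = cube_sum m (\<lambda>j. gs j \<circ> cube_to_sphere) x)
        \<and> homotopic_with_canon (\<lambda>_. True) (sphere 0 1) Y F G)"

text \<open>The j-th inclusion S^n \<rightarrow> Y_m: onto the sphere of radius j+1 centred at (j+1, 0);
  these spheres are pairwise internally tangent at the wedge point 0.\<close>
definition wedge_incl :: "nat \<Rightarrow> real \<times> 'n::euclidean_space \<Rightarrow> real \<times> 'n" where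
  "wedge_incl j x = real (Suc j) *\<^sub>R (x - sph_base)"

definition wedge_spheres :: "nat \<Rightarrow> (real \<times> 'n::euclidean_space) set" where
  "wedge_spheres m = (\<Union>j<m. wedge_incl j ` sphere 0 1)"

definition cond_star :: "(real \<times> 'k::euclidean_space \<Rightarrow> real \<times> 'n::euclidean_space) \<Rightarrow> bool" where
  "cond_star \<beta> \<longleftrightarrow>
     (\<forall>m\<ge>1. \<forall>A. is_sphere_sum (wedge_spheres m) 0 m wedge_incl A \<longrightarrow>
        is_sphere_sum (wedge_spheres m) 0 m (\<lambda>j. wedge_incl j \<circ> \<beta>) (A \<circ> \<beta>))"

end

theory Submission
  imports Defs "HOL-Analysis.Analysis"
begin

text \<open>
  Replace the target sphere by the boundary of a cube, cut into \<open>(2p)\<^sup>n\<^sup>+\<^sup>1\<close> cells of half-size \<open>1/2\<close>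
  (after rescaling). The boundary of the cube is, inside the union of the cell boundaries, the
  sum of the boundaries of the cells, so condition \<open>(*)\<close> homotopes \<open>\<beta>\<close> within this \<open>n\<close>-dimensional set
  to a sum of copies of \<open>\<beta>\<close>, one for each cell. As \<open>k + 1 > n + 1\<close>, for large \<open>p\<close> the unit ball of dimension
  \<open>k + 1\<close> contains as many disjoint balls of radius \<open>1/(2p)\<close> as there are cells. The homotopy
  therefore yields a Lipschitz map from the complement of these balls to the cell boundaries that
  is \<open>\<beta>\<close> on the outer sphere and a copy of \<open>\<beta>\<close>, scaled by the radius, on each inner one. Filling in the
  balls by scaled copies of the same map, over and over, does not increase the Lipschitz constant
  and converges to the extension. Off a self-similar null set the extension locally takes values
  in a set with empty interior; by Rademacher's theorem it is differentiable almost everywhere, and there a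
  derivative of full rank would make the local image fat.

  For maps into open sets only the free homotopy classes of the restrictions to the boundary
  spheres matter, by Borsuk's homotopy extension theorem.
\<close>

section \<open>Rademacher's theorem\<close>

text \<open>The cube is used because it is tiled by copies of itself: a cell boundary is the large
  boundary scaled by 1/(2p), and the holes in the domain have this same radius, so a rescaled copy
  is no steeper than the original. The dimension gap serves twice: the (2p)^(n+1) holes fit
  disjointly into the unit ball, and their total volume is a proper fraction of it, which makes the
  self-similar exceptional set null.

  The condition on beta speaks of sums in a wedge, while the construction needs a map between
  complements of finite sets, with given classes on a small sphere around each puncture and on a
  large sphere. The wedge is a go-between: the punctured domain is mapped to it, and it is placed
  around the punctures of the target.

  Homotopies are merely continuous, so the topology takes place in the open complement of the cell
  centres. Lipschitz regularity is restored once, by an approximation that keeps the boundary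
  values, followed by a push onto the cell boundaries.

  The extension is a limit without an explicit derivative, hence the appeal to almost everywhere
  differentiability. In its proof, additivity of directional derivatives comes from
  porosity.\<close>

lemma fine_disjoint_cballs:
  fixes S U :: "'a::euclidean_space set"
  assumes "S \<subseteq> U" "open U"
    and fine: "\<And>x d. x \<in> S \<Longrightarrow> 0 < d \<Longrightarrow> \<exists>a r. 0 < r \<and> r < d \<and> x \<in> cball a r \<and> P a r"
  obtains C where "countable C" "disjoint_family_on (\<lambda>(a, r). cball a r) C"
    "\<And>a r. (a, r) \<in> C \<Longrightarrow> 0 < r \<and> P a r \<and> cball a r \<subseteq> U"
    "negligible (S - (\<Union>(a, r)\<in>C. cball a r))"
proof -
  define K where "K = {(a, r). 0 < r \<and> P a r \<and> cball a r \<subseteq> U}"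
  have fineK: "\<exists>i. i \<in> K \<and> x \<in> cball (fst i) (snd i) \<and> snd i < d" if "x \<in> S" "0 < d" for x d
  proof -
    obtain e where e: "e > 0" "ball x e \<subseteq> U"
      using assms(1,2) \<open>x \<in> S\<close> openE by blast
    \<comment> \<open>The ball contains x but need not be centred there; a radius below e/2 keeps it
      inside the ball of radius e about x.\<close>
    obtain a r where ar: "0 < r" "r < min d (e/2)" "x \<in> cball a r" "P a r"
      using fine[OF \<open>x \<in> S\<close>, of "min d (e/2)"] e \<open>0 < d\<close> by auto
    have "cball a r \<subseteq> ball x e"
    proof
      fix y assume "y \<in> cball a r"
      then have "dist x y \<le> r + r"
        using ar(3) by (metis add_mono dist_commute dist_triangle_le mem_cball)
      then show "y \<in> ball x e" using ar(2) by simp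
    qed
    then have "(a, r) \<in> K" using ar e(2) by (auto simp: K_def)
    then show ?thesis using ar by force
  qed
  have posK: "\<And>i. i \<in> K \<Longrightarrow> 0 < snd i" by (auto simp: K_def)
  obtain C where C: "countable C" "C \<subseteq> K"
     "pairwise (\<lambda>i j. disjnt (cball (fst i) (snd i)) (cball (fst j) (snd j))) C"
     "negligible (S - (\<Union>i\<in>C. cball (fst i) (snd i)))"
    by (rule Vitali_covering_theorem_cballs[of K snd S fst, OF posK fineK])
  show thesis
  proof
    show "disjoint_family_on (\<lambda>(a, r). cball a r) C"
      using C(3) by (auto simp: disjoint_family_on_def pairwise_def disjnt_def case_prod_unfold)
    show "negligible (S - (\<Union>(a, r)\<in>C. cball a r))"
      using C(4) by (simp add: case_prod_unfold)
  qed (use C in \<open>auto simp: K_def\<close>)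
qed

text \<open>Sums up a bound known on each ball of a Vitali family. Two measures are allowed because
  Lebesgue measure is compared with its restriction to a set and with a Stieltjes measure.\<close>

lemma emeasure_UN_le_cmult:
  assumes "countable C" "disjoint_family_on X C"
    and "\<And>i. i \<in> C \<Longrightarrow> X i \<in> sets M" "\<And>i. i \<in> C \<Longrightarrow> X i \<in> sets N"
    and le: "\<And>i. i \<in> C \<Longrightarrow> emeasure M (X i) \<le> c * emeasure N (X i)"
  shows "emeasure M (\<Union>(X ` C)) \<le> c * emeasure N (\<Union>(X ` C))"
proof -
  have "emeasure M (\<Union>(X ` C)) = (\<integral>\<^sup>+i. emeasure M (X i) \<partial>count_space C)"
    using assms by (intro emeasure_UN_countable) auto
  also have "\<dots> \<le> (\<integral>\<^sup>+i. c * emeasure N (X i) \<partial>count_space C)"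
    by (intro nn_integral_mono) (use le in auto)
  also have "\<dots> = c * (\<integral>\<^sup>+i. emeasure N (X i) \<partial>count_space C)"
    by (intro nn_integral_cmult) auto
  also have "(\<integral>\<^sup>+i. emeasure N (X i) \<partial>count_space C) = emeasure N (\<Union>(X ` C))"
    using assms by (intro emeasure_UN_countable[symmetric]) auto
  finally show ?thesis .
qed

lemma emeasure_le_of_negligible_diff:
  fixes S T :: "'a::euclidean_space set"
  assumes "S \<in> sets borel" "T \<in> sets borel" "negligible (S - T)"
  shows "emeasure lborel S \<le> emeasure lborel T"
proof -
  have "emeasure lborel (S - T) = 0"
    using assms null_sets_completion_iff[of "S - T" lborel]
    by (auto simp: negligible_iff_null_sets null_sets_def)
  then have "emeasure lborel S \<le> emeasure lborel (S \<inter> T) + 0"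
    using emeasure_subadditive[of "S \<inter> T" lborel "S - T"] assms by (simp add: Int_Diff_Un)
  also have "\<dots> \<le> emeasure lborel T" using assms by (auto intro!: emeasure_mono)
  finally show ?thesis .
qed

lemma emeasure_outer_open:
  fixes S :: "'a::euclidean_space set"
  assumes "S \<in> sets borel" "e > 0"
  obtains U where "open U" "S \<subseteq> U" "emeasure lborel U \<le> emeasure lborel S + ennreal e"
proof -
  have "S \<in> sets lebesgue" using assms by simp
  from sets_lebesgue_outer_open[OF this \<open>e > 0\<close>] obtain U where U: "open U" "S \<subseteq> U" 
    "emeasure lebesgue (U - S) < ennreal e" by metis
  have "U - S \<in> sets lborel" using U(1) assms by auto
  then have "emeasure lborel (U - S) < ennreal e" using U(3) by (simp add: emeasure_completion)
  moreover have "emeasure lborel U \<le> emeasure lborel S + emeasure lborel (U - S)"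
    using emeasure_subadditive[of S lborel "U - S"] U assms by (simp add: Un_absorb1)
  ultimately show thesis using that[OF U(1,2)]
    by (meson add_left_mono dual_order.trans less_imp_le)
qed

text \<open>A weak form of Lebesgue's density theorem, for balls that merely contain the point.
  Almost all of a bounded piece of measure m is covered by disjoint sparse balls inside an open set
  of measure at most m + e, so m <= c (m + e) for every e > 0, and c < 1 forces m = 0.\<close>

lemma negligible_low_density:
  fixes S :: "'a::euclidean_space set"
  assumes S: "S \<in> sets borel" and "c < 1"
    and fine: "\<And>x d. x \<in> S \<Longrightarrow> 0 < d \<Longrightarrow> \<exists>a r. 0 < r \<and> r < d \<and> x \<in> cball a r \<and>
                 emeasure lborel (S \<inter> cball a r) \<le> ennreal c * emeasure lborel (cball a r)"
  shows "negligible S"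
proof -
  have "negligible (S \<inter> ball 0 R)" for R
  proof -
    define T where "T = S \<inter> ball 0 R"
    have Tb: "T \<in> sets borel" using S by (auto simp: T_def)
    have fin: "emeasure lborel T < \<infinity>"
      by (rule le_less_trans[OF emeasure_mono[of _ "ball 0 R"]]) (use emeasure_lborel_ball_finite[of 0 R] in \<open>auto simp: T_def\<close>)
    define m where "m = measure lborel T"
    have em: "emeasure lborel T = ennreal m"
      using fin by (simp add: m_def emeasure_eq_ennreal_measure)
    have m0: "m \<ge> 0" by (simp add: m_def)
    \<comment> \<open>\<open>ennreal\<close> sends a negative c to 0, hence the maximum.\<close>
    have key: "m \<le> max c 0 * (m + e)" if "e > 0" for e
    proof -
      obtain U where U: "open U" "T \<subseteq> U" "emeasure lborel U \<le> ennreal m + ennreal e"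
        using emeasure_outer_open[OF Tb \<open>e > 0\<close>] em by metis
      have Um: "emeasure lborel U \<le> ennreal (m + e)" using U(3) m0 \<open>e > 0\<close> by simp
      obtain C where C: "countable C" "disjoint_family_on (\<lambda>(a, r). cball a r) C"
        "\<And>a r. (a, r) \<in> C \<Longrightarrow> 0 < r \<and> 
            emeasure lborel (S \<inter> cball a r) \<le> ennreal c * emeasure lborel (cball a r) \<and> cball a r \<subseteq> U"
        "negligible (T - (\<Union>(a, r)\<in>C. cball a r))"
        by (rule fine_disjoint_cballs[OF U(2,1), of "\<lambda>a r. emeasure lborel (S \<inter> cball a r) \<le> ennreal c * emeasure lborel (cball a r)"])
          (use fine in \<open>auto simp: T_def\<close>)
      let ?V = "\<Union>(a, r)\<in>C. cball a r"
      have Vb: "?V \<in> sets borel" using C(1) by (intro sets.countable_UN') auto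
      have neg: "negligible (T - T \<inter> ?V)" using C(4) by (simp add: Diff_Int)
      have "emeasure lborel T \<le> emeasure lborel (T \<inter> ?V)"
        by (rule emeasure_le_of_negligible_diff) (use neg Tb Vb in auto)
      \<comment> \<open>Restriction to T is written as a density, so that it is a measure to which
        the summation over balls applies.\<close>
      also have "\<dots> = emeasure (density lborel (indicator T)) ?V"
        using Tb Vb by (simp add: emeasure_density indicator_inter_arith[symmetric])
      also have "\<dots> \<le> ennreal c * emeasure lborel ?V"
      proof (rule emeasure_UN_le_cmult[OF C(1,2)])
        fix i assume i: "i \<in> C"
        obtain a r where ar: "i = (a, r)" by (cases i)
        have "emeasure (density lborel (indicator T)) (cball a r) = emeasure lborel (T \<inter> cball a r)"
          using Tb by (simp add: emeasure_density indicator_inter_arith[symmetric])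
        also have "\<dots> \<le> emeasure lborel (S \<inter> cball a r)" using S by (intro emeasure_mono) (auto simp: T_def)
        also have "\<dots> \<le> ennreal c * emeasure lborel (cball a r)" using C(3) i ar by auto
        finally show "emeasure (density lborel (indicator T)) (case i of (a, r) \<Rightarrow> cball a r) 
            \<le> ennreal c * emeasure lborel (case i of (a, r) \<Rightarrow> cball a r)" using ar by simp
      qed auto
      also have "\<dots> \<le> ennreal c * emeasure lborel U"
        using C(3) U(1) by (intro mult_left_mono emeasure_mono) auto
      also have "\<dots> \<le> ennreal c * ennreal (m + e)" by (intro mult_left_mono Um) auto
      also have "\<dots> = ennreal (max c 0 * (m + e))" using m0 \<open>e > 0\<close>
        by (simp add: ennreal_mult'' max_def ennreal_neg)
      finally show ?thesis using m0 \<open>e > 0\<close> unfolding em by (simp add: ennreal_le_iff)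
    qed
    have "m \<le> max c 0 * m"
    proof (rule field_le_epsilon)
      fix e :: real assume "e > 0"
      have "max c 0 * e \<le> 1 * e" using \<open>c < 1\<close> \<open>e > 0\<close> by (intro mult_right_mono) auto
      then show "m \<le> max c 0 * m + e" using key[OF \<open>e > 0\<close>] by (simp add: distrib_left)
    qed
    then have "m = 0" using m0 \<open>c < 1\<close> 
      by (smt (verit) mult_le_cancel_right1)
    then have "emeasure lborel T = 0" using em by simp
    then show ?thesis unfolding T_def[symmetric] using Tb
      by (simp add: negligible_iff_null_sets null_sets_completionI null_setsI)
  qed
  then have "negligible (\<Union>n. S \<inter> ball 0 (real n))" by (intro negligible_countable_Union) auto
  moreover have "(\<Union>n. S \<inter> ball 0 (real n)) = S"
    using reals_Archimedean2 by auto
  ultimately show ?thesis by simp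
qed

section \<open>Directional derivatives of Lipschitz functions exist almost everywhere\<close>

definition slope :: "('a::real_normed_vector \<Rightarrow> real) \<Rightarrow> 'a \<Rightarrow> 'a \<Rightarrow> real \<Rightarrow> real" where
  "slope f v x t = (f (x + t *\<^sub>R v) - f x) / t"

text \<open>The lower derivate along v is at most p and the upper one at least q. For bounded
  slopes, the derivative along v exists at x as soon as x avoids these sets for all rational p <
  q.\<close>

definition oscillating :: "('a::real_normed_vector \<Rightarrow> real) \<Rightarrow> 'a \<Rightarrow> real \<Rightarrow> real \<Rightarrow> 'a set" where
  "oscillating f v p q =
     {x. (\<forall>d>0. \<exists>t. t \<noteq> 0 \<and> \<bar>t\<bar> < d \<and> slope f v x t < p) \<and>
         (\<forall>d>0. \<exists>t. t \<noteq> 0 \<and> \<bar>t\<bar> < d \<and> slope f v x t > q)}"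

text \<open>For a fixed nonzero t the slope is continuous in x, so restricting d to the values
  1/(n+1) exhibits the set as a countable intersection of open sets.\<close>

lemma frequent_slope_borel:
  fixes f :: "'a::euclidean_space \<Rightarrow> real"
  assumes f: "continuous_on UNIV f" and T: "open T"
  shows "{x. \<forall>d>0. \<exists>t. t \<noteq> 0 \<and> \<bar>t\<bar> < d \<and> slope f v x t \<in> T} \<in> sets borel"
proof -
  have eq: "{x. \<forall>d>0. \<exists>t. t \<noteq> 0 \<and> \<bar>t\<bar> < d \<and> slope f v x t \<in> T} =
     (\<Inter>n. \<Union>t\<in>{t. t \<noteq> 0 \<and> \<bar>t\<bar> < 1 / real (Suc n)}. (\<lambda>x. slope f v x t) -` T)" (is "?A = ?B")
  proof
    show "?A \<subseteq> ?B"
    proof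
      fix x assume x: "x \<in> ?A"
      have "\<exists>t. t \<noteq> 0 \<and> \<bar>t\<bar> < 1 / real (Suc n) \<and> slope f v x t \<in> T" for n
        using x by simp
      then show "x \<in> ?B" by fastforce
    qed
    show "?B \<subseteq> ?A"
    proof (safe)
      fix x and d :: real assume x: "x \<in> ?B" and "0 < d"
      obtain n where n: "1 / real (Suc n) < d" using \<open>0 < d\<close> by (metis nat_approx_posE)
      obtain t where "t \<noteq> 0" "\<bar>t\<bar> < 1 / real (Suc n)" "slope f v x t \<in> T"
        using x by auto
      then show "\<exists>t. t \<noteq> 0 \<and> \<bar>t\<bar> < d \<and> slope f v x t \<in> T" using n by (intro exI[of _ t]) auto
    qed
  qed
  have "open ((\<lambda>x. slope f v x t) -` T)" if "t \<noteq> 0" for t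
  proof (rule open_vimage[OF T])
    have "continuous_on UNIV (\<lambda>x. f (x + t *\<^sub>R v))"
      by (rule continuous_on_compose2[OF f]) (auto intro!: continuous_intros)
    then show "continuous_on UNIV (\<lambda>x. slope f v x t)"
      unfolding slope_def by (intro continuous_on_divide continuous_on_diff f continuous_on_const) (use that in auto)
  qed
  then have "open (\<Union>t\<in>{t. t \<noteq> 0 \<and> \<bar>t\<bar> < 1 / real (Suc n)}. (\<lambda>x. slope f v x t) -` T)" for n
    by (intro open_UN ballI) auto
  then show ?thesis unfolding eq by (intro sets.countable_INT) auto
qed

lemma oscillating_borel:
  fixes f :: "'a::euclidean_space \<Rightarrow> real"
  assumes f: "continuous_on UNIV f"
  shows "oscillating f v p q \<in> sets borel"
proof -
  have "oscillating f v p q = {x. \<forall>d>0. \<exists>t. t \<noteq> 0 \<and> \<bar>t\<bar> < d \<and> slope f v x t \<in> {..<p}} \<inter> 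
     {x. \<forall>d>0. \<exists>t. t \<noteq> 0 \<and> \<bar>t\<bar> < d \<and> slope f v x t \<in> {q<..}}"
    by (auto simp: oscillating_def)
  then show ?thesis
    using sets.Int[OF frequent_slope_borel[OF f, of "{..<p}" v] frequent_slope_borel[OF f, of "{q<..}" v]]
    by (simp only: open_lessThan open_greaterThan)
qed

text \<open>The interval between x and x + t is the ball of radius |t|/2 about x + t/2. This turns
  slopes, for either sign of t, into increments over the balls that the covering theorem
  selects.\<close>

lemma slope_interval:
  fixes g :: "real \<Rightarrow> real"
  assumes "t \<noteq> 0" "\<bar>t\<bar> < d"
  shows "\<exists>a r. 0 < r \<and> r < d \<and> x \<in> cball a r \<and> g (a + r) - g (a - r) = slope g 1 x t * (2 * r)"
proof (intro exI conjI)
  show "0 < \<bar>t\<bar>/2" "\<bar>t\<bar>/2 < d" using assms by auto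
  show "x \<in> cball (x + t/2) (\<bar>t\<bar>/2)" by (simp add: dist_real_def)
  show "g (x + t/2 + \<bar>t\<bar>/2) - g (x + t/2 - \<bar>t\<bar>/2) = slope g 1 x t * (2 * (\<bar>t\<bar>/2))"
  proof (cases "t > 0")
    case True
    then have "x + t/2 + \<bar>t\<bar>/2 = x + t" "x + t/2 - \<bar>t\<bar>/2 = x" by auto
    then show ?thesis using True by (simp add: slope_def add.commute)
  next
    case False
    then have "x + t/2 + \<bar>t\<bar>/2 = x" "x + t/2 - \<bar>t\<bar>/2 = x + t" by auto
    then show ?thesis using False assms by (simp add: slope_def add.commute)
  qed
qed

text \<open>Lebesgue's argument, with the Stieltjes measure mu of g. A bounded piece of measure m is
  covered by disjoint intervals of mu-mass at most p times their length, inside an open set of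
  measure at most m + e; within these it is covered again by disjoint intervals of mu-mass at least
  q times their length. Hence q m <= p (m + e) for all e > 0, and m = 0.\<close>

lemma negligible_oscillating_mono:
  fixes g :: "real \<Rightarrow> real"
  assumes mono: "\<And>x y. x \<le> y \<Longrightarrow> g x \<le> g y" and cont: "continuous_on UNIV g"
    and pq: "0 \<le> p" "p < q"
  shows "negligible (oscillating g 1 p q)"
proof -
  let ?M = "interval_measure g"
  have Mc: "emeasure ?M (cball a r) = ennreal (g (a + r) - g (a - r))" if "r > 0" for a r
    using emeasure_interval_measure_Icc[of "a - r" "a + r" g] mono cont that
    by (simp add: cball_eq_atLeastAtMost)
  have Lc: "emeasure lborel (cball a r) = ennreal (2 * r)" if "r > 0" for a r :: real
    using that by (simp add: cball_eq_atLeastAtMost)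
  have "negligible (oscillating g 1 p q \<inter> ball 0 R)" for R
  proof -
    define S where "S = oscillating g 1 p q \<inter> ball 0 R"
    have Sb: "S \<in> sets borel" using oscillating_borel[OF cont] by (auto simp: S_def)
    have fin: "emeasure lborel S < \<infinity>"
      by (rule le_less_trans[OF emeasure_mono[of _ "ball 0 R"]]) 
         (use emeasure_lborel_ball_finite[of 0 R] in \<open>auto simp: S_def\<close>)
    define m where "m = measure lborel S"
    have em: "emeasure lborel S = ennreal m"
      using fin by (simp add: m_def emeasure_eq_ennreal_measure)
    have m0: "m \<ge> 0" by (simp add: m_def)
    have key: "q * m \<le> p * (m + e)" if "e > 0" for e
    proof -
      obtain U where U: "open U" "S \<subseteq> U" "emeasure lborel U \<le> ennreal m + ennreal e"
        using emeasure_outer_open[OF Sb \<open>e > 0\<close>] em by metis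
      have fine1: "\<exists>a r. 0 < r \<and> r < d \<and> x \<in> cball a r \<and> g (a + r) - g (a - r) \<le> p * (2 * r)"
        if "x \<in> S" "0 < d" for x d
      proof -
        have "\<exists>t. t \<noteq> 0 \<and> \<bar>t\<bar> < d \<and> slope g 1 x t < p"
          using that by (simp add: S_def oscillating_def)
        then obtain t where t: "t \<noteq> 0" "\<bar>t\<bar> < d" "slope g 1 x t < p" by blast
        obtain a r where ar: "0 < r" "r < d" "x \<in> cball a r" "g (a + r) - g (a - r) = slope g 1 x t * (2 * r)"
          using slope_interval[OF t(1,2), of x g] by blast
        have "slope g 1 x t * (2 * r) \<le> p * (2 * r)"
          using t(3) ar(1) by (intro mult_right_mono) auto
        then show ?thesis using ar by (intro exI[of _ a] exI[of _ r]) simp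
      qed
      obtain C where C: "countable C" "disjoint_family_on (\<lambda>(a, r). cball a r) C"
        "\<And>a r. (a, r) \<in> C \<Longrightarrow> 0 < r \<and> g (a + r) - g (a - r) \<le> p * (2 * r) \<and> cball a r \<subseteq> U"
        "negligible (S - (\<Union>(a, r)\<in>C. cball a r))"
        by (rule fine_disjoint_cballs[OF U(2,1) fine1]) auto
      define V where "V = (\<Union>(a, r)\<in>C. cball a r)"
      \<comment> \<open>The second covering must stay in an open set, so the intervals are opened;
        only countably many endpoints are lost.\<close>
      define V' where "V' = (\<Union>(a, r)\<in>C. ball a r)"
      have Vb: "V \<in> sets borel" using C(1) unfolding V_def by (intro sets.countable_UN') auto
      have "open V'" unfolding V'_def by auto
      have "V - V' \<subseteq> (\<Union>(a, r)\<in>C. sphere a r)"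
        unfolding V_def V'_def using cball_diff_sphere by blast
      moreover have "negligible (\<Union>(a, r)\<in>C. sphere a r)"
        using C(1) by (intro negligible_countable_Union) (auto simp: negligible_sphere)
      ultimately have "negligible (V - V')" using negligible_subset by blast
      then have "negligible ((S - V) \<union> (V - V'))" using C(4) by (simp add: V_def)
      then have SV': "negligible (S - V')" by (rule negligible_subset) auto
      have fine2: "\<exists>a r. 0 < r \<and> r < d \<and> x \<in> cball a r \<and> g (a + r) - g (a - r) \<ge> q * (2 * r)"
        if "x \<in> S \<inter> V'" "0 < d" for x d
      proof -
        have "\<exists>t. t \<noteq> 0 \<and> \<bar>t\<bar> < d \<and> slope g 1 x t > q"
          using that by (simp add: S_def oscillating_def)
        then obtain t where t: "t \<noteq> 0" "\<bar>t\<bar> < d" "slope g 1 x t > q" by blast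
        obtain a r where ar: "0 < r" "r < d" "x \<in> cball a r" "g (a + r) - g (a - r) = slope g 1 x t * (2 * r)"
          using slope_interval[OF t(1,2), of x g] by blast
        have "slope g 1 x t * (2 * r) \<ge> q * (2 * r)"
          using t(3) ar(1) by (intro mult_right_mono) auto
        then show ?thesis using ar by (intro exI[of _ a] exI[of _ r]) simp
      qed
      obtain D where D: "countable D" "disjoint_family_on (\<lambda>(a, r). cball a r) D"
        "\<And>a r. (a, r) \<in> D \<Longrightarrow> 0 < r \<and> g (a + r) - g (a - r) \<ge> q * (2 * r) \<and> cball a r \<subseteq> V'"
        "negligible (S \<inter> V' - (\<Union>(a, r)\<in>D. cball a r))"
        by (rule fine_disjoint_cballs[of "S \<inter> V'" V', OF _ \<open>open V'\<close> fine2]) auto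
      define W where "W = (\<Union>(a, r)\<in>D. cball a r)"
      have Wb: "W \<in> sets borel" using D(1) unfolding W_def by (intro sets.countable_UN') auto
      have "W \<subseteq> V'" using D(3) unfolding W_def by blast
      have "V' \<subseteq> V" unfolding V_def V'_def by (intro UN_mono) (auto split: prod.split)
      have "V \<subseteq> U" using C(3) unfolding V_def by blast
      have "negligible ((S - V') \<union> (S \<inter> V' - W))" using SV' D(4) by (simp add: W_def)
      then have SW: "negligible (S - W)" by (rule negligible_subset) auto
      have "ennreal q * emeasure lborel S \<le> ennreal q * emeasure lborel W"
        using emeasure_le_of_negligible_diff[OF Sb Wb SW] by (intro mult_left_mono) auto
      also have "\<dots> = emeasure (scale_measure (ennreal q) lborel) W" by simp
      also have "\<dots> \<le> 1 * emeasure ?M W"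
        unfolding W_def
      proof (rule emeasure_UN_le_cmult[OF D(1,2)])
        fix i assume "i \<in> D"
        then show "emeasure (scale_measure (ennreal q) lborel) (case i of (a, r) \<Rightarrow> cball a r) 
           \<le> 1 * emeasure ?M (case i of (a, r) \<Rightarrow> cball a r)"
          using D(3) pq by (cases i) (auto simp: Mc Lc ennreal_mult'[symmetric] intro!: ennreal_leI)
      qed auto
      also have "\<dots> \<le> emeasure ?M V"
        unfolding mult_1 using \<open>W \<subseteq> V'\<close> \<open>V' \<subseteq> V\<close> Vb by (intro emeasure_mono) auto
      also have "\<dots> \<le> ennreal p * emeasure lborel V"
        unfolding V_def
      proof (rule emeasure_UN_le_cmult[OF C(1,2)])
        fix i assume "i \<in> C"
        then show "emeasure ?M (case i of (a, r) \<Rightarrow> cball a r) 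
           \<le> ennreal p * emeasure lborel (case i of (a, r) \<Rightarrow> cball a r)"
          using C(3) pq by (cases i) (auto simp: Mc Lc ennreal_mult'[symmetric] intro!: ennreal_leI)
      qed auto
      also have "\<dots> \<le> ennreal p * emeasure lborel U"
        using \<open>V \<subseteq> U\<close> U(1) by (intro mult_left_mono emeasure_mono) auto
      also have "\<dots> \<le> ennreal p * ennreal (m + e)" using U(3) m0 \<open>e > 0\<close> by (intro mult_left_mono) auto
      finally have "ennreal (q * m) \<le> ennreal (p * (m + e))"
        using pq m0 \<open>e > 0\<close> unfolding em by (simp add: ennreal_mult)
      then show ?thesis using pq m0 \<open>e > 0\<close> by (subst (asm) ennreal_le_iff) auto
    qed
    have "q * m \<le> p * m"
    proof (rule field_le_epsilon)
      fix e :: real assume "e > 0"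
      \<comment> \<open>Dividing by p + 1 rather than by p also covers p = 0.\<close>
      have "p * (e / (p + 1)) \<le> e" using pq \<open>e > 0\<close> by (simp add: field_simps)
      then show "q * m \<le> p * m + e" using key[of "e / (p + 1)"] pq \<open>e > 0\<close> 
        by (simp add: distrib_left)
    qed
    then have "m = 0" using m0 pq by (simp add: mult_le_cancel_right)
    then have "emeasure lborel S = 0" using em by simp
    then show ?thesis unfolding S_def[symmetric] using Sb
      by (simp add: negligible_iff_null_sets null_sets_completionI null_setsI)
  qed
  then have "negligible (\<Union>n. oscillating g 1 p q \<inter> ball 0 (real n))" 
    by (intro negligible_countable_Union) auto
  moreover have "(\<Union>n. oscillating g 1 p q \<inter> ball 0 (real n)) = oscillating g 1 p q"
    using reals_Archimedean2 by auto
  ultimately show ?thesis by simp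
qed

lemma slope_abs_le:
  fixes f :: "'a::real_normed_vector \<Rightarrow> real"
  assumes "L-lipschitz_on UNIV f"
  shows "\<bar>slope f v x t\<bar> \<le> L * norm v"
proof (cases "t = 0")
  case True
  then show ?thesis using lipschitz_on_nonneg[OF assms] by (simp add: slope_def)
next
  case False
  have "\<bar>f (x + t *\<^sub>R v) - f x\<bar> \<le> L * (norm v * \<bar>t\<bar>)"
    using lipschitz_onD[OF assms, of "x + t *\<^sub>R v" x] by (simp add: dist_norm mult.commute)
  then show ?thesis using False by (simp add: slope_def abs_divide field_simps)
qed

text \<open>Adding L x makes the function increasing and shifts every slope by L, which reduces the
  claim to the monotone case with p + L >= 0. If p + L < 0 the set is empty, since slopes are at
  least -L.\<close>

lemma negligible_oscillating_lipschitz_real: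
  fixes f :: "real \<Rightarrow> real"
  assumes L: "L-lipschitz_on UNIV f" and "p < q"
  shows "negligible (oscillating f 1 p q)"
proof (cases "p + L \<ge> 0")
  case True
  define g where "g x = f x + L * x" for x
  have "g x \<le> g y" if "x \<le> y" for x y
    using lipschitz_onD[OF L, of x y] that by (auto simp: g_def dist_real_def algebra_simps)
  moreover have "continuous_on UNIV g"
    unfolding g_def by (intro continuous_intros lipschitz_on_continuous_on[OF L])
  ultimately have "negligible (oscillating g 1 (p + L) (q + L))"
    by (rule negligible_oscillating_mono) (use True \<open>p < q\<close> in auto)
  moreover have "slope g 1 x t = slope f 1 x t + L" if "t \<noteq> 0" for x t
    using that by (simp add: slope_def g_def field_simps)
  then have "oscillating g 1 (p + L) (q + L) = oscillating f 1 p q"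
    unfolding oscillating_def
    by (intro Collect_cong arg_cong2[where f="(\<and>)"] all_cong ex_cong conj_cong refl) simp_all
  ultimately show ?thesis by simp
next
  case False
  have "oscillating f 1 p q = {}"
  proof -
    have "\<not> slope f 1 x t < p" for x t using slope_abs_le[OF L, of 1 x t] False by auto
    then show ?thesis by (auto simp: oscillating_def intro!: exI[of _ "1::real"])
  qed
  then show ?thesis by simp
qed

text \<open>Fubini without a change of coordinates: by translation invariance the measure of E is
  the average over t in [0,1] of the measures of the translates of E by -t v. After exchanging the
  integrals there remains, for each x, the length of a subset of {t. x + t v in E}, which is null by
  the one-dimensional case.\<close>

lemma negligible_oscillating_lipschitz:
  fixes f :: "'a::euclidean_space \<Rightarrow> real"
  assumes L: "L-lipschitz_on UNIV f" and "p < q"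
  shows "negligible (oscillating f v p q)"
proof -
  define E where "E = oscillating f v p q"
  have cont: "continuous_on UNIV f" by (rule lipschitz_on_continuous_on[OF L])
  have [measurable]: "E \<in> sets borel" unfolding E_def by (rule oscillating_borel[OF cont])
  have slice: "negligible {t. x + t *\<^sub>R v \<in> E}" for x
  proof -
    have "(L * norm v)-lipschitz_on UNIV (\<lambda>t. f (x + t *\<^sub>R v))"
    proof (rule lipschitz_onI)
      show "dist (f (x + s *\<^sub>R v)) (f (x + t *\<^sub>R v)) \<le> L * norm v * dist s t" for s t
        using lipschitz_onD[OF L, of "x + s *\<^sub>R v" "x + t *\<^sub>R v"]
        by (simp add: dist_norm flip: scaleR_diff_left) (simp add: ac_simps)
    qed (use lipschitz_on_nonneg[OF L] in simp)
    then have "negligible (oscillating (\<lambda>t. f (x + t *\<^sub>R v)) 1 p q)"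
      by (rule negligible_oscillating_lipschitz_real) fact
    moreover have "slope (\<lambda>t. f (x + t *\<^sub>R v)) 1 s t = slope f v (x + s *\<^sub>R v) t" for s t
      by (simp add: slope_def algebra_simps)
    ultimately show ?thesis by (simp add: E_def oscillating_def)
  qed
  have "emeasure lborel E = (\<integral>\<^sup>+t. indicator {0..1} t * emeasure lborel E \<partial>(lborel::real measure))"
    by (simp add: nn_integral_multc)
  also have "\<dots> = (\<integral>\<^sup>+t. (\<integral>\<^sup>+x. indicator {0..1} t * indicator E (x + t *\<^sub>R v) \<partial>lborel) \<partial>lborel)"
  proof (rule nn_integral_cong)
    fix t :: real
    have "emeasure lborel E = emeasure (distr lborel borel ((+) (t *\<^sub>R v))) E"
      by (simp add: lborel_distr_plus)
    also have "\<dots> = (\<integral>\<^sup>+x. indicator E x \<partial>distr lborel borel ((+) (t *\<^sub>R v)))" by simp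
    also have "\<dots> = (\<integral>\<^sup>+x. indicator E (t *\<^sub>R v + x) \<partial>lborel)"
      by (intro nn_integral_distr) auto
    finally show "indicator {0..1} t * emeasure lborel E 
        = (\<integral>\<^sup>+x. indicator {0..1} t * indicator E (x + t *\<^sub>R v) \<partial>lborel)"
      by (simp add: nn_integral_cmult add.commute)
  qed
  also have "\<dots> = (\<integral>\<^sup>+x. (\<integral>\<^sup>+t. indicator {0..1} t * indicator E (x + t *\<^sub>R v) \<partial>lborel) \<partial>lborel)"
    by (intro lborel_pair.Fubini') measurable
  also have "\<dots> = (\<integral>\<^sup>+x. 0 \<partial>(lborel::'a measure))"
  proof (rule nn_integral_cong)
    fix x
    have "(\<integral>\<^sup>+t. indicator {0..1} t * indicator E (x + t *\<^sub>R v) \<partial>lborel)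
       \<le> (\<integral>\<^sup>+t. indicator {t. x + t *\<^sub>R v \<in> E} t \<partial>lborel)"
      by (intro nn_integral_mono) (auto simp: indicator_def)
    also have "\<dots> = emeasure lborel {t. x + t *\<^sub>R v \<in> E}"
      by (intro nn_integral_indicator) measurable
    also have "\<dots> = 0"
    proof -
      have "{t. x + t *\<^sub>R v \<in> E} \<in> sets lborel" by measurable
      then show ?thesis using slice[of x] null_sets_completion_iff[of "{t. x + t *\<^sub>R v \<in> E}" lborel]
        by (auto simp: negligible_iff_null_sets null_sets_def)
    qed
    finally show "(\<integral>\<^sup>+t. indicator {0..1} t * indicator E (x + t *\<^sub>R v) \<partial>lborel) = 0" by simp
  qed
  finally have "emeasure lborel E = 0" by simp
  then show ?thesis unfolding E_def[symmetric]
    by (simp add: negligible_iff_null_sets null_sets_completionI null_setsI)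
qed

text \<open>The limit is the lower limit of the slopes, obtained as the supremum of their eventual
  lower bounds. If the slopes did not eventually stay below some b above it, rationals p < q in
  between would make x oscillate.\<close>

lemma not_oscillating_slope_tendsto:
  fixes f :: "'a::euclidean_space \<Rightarrow> real"
  assumes L: "L-lipschitz_on UNIV f"
    and x: "\<And>p q. p \<in> \<rat> \<Longrightarrow> q \<in> \<rat> \<Longrightarrow> p < q \<Longrightarrow> x \<notin> oscillating f v p q"
  shows "\<exists>D. (slope f v x \<longlongrightarrow> D) (at 0)"
proof -
  define A where "A = {p. \<forall>\<^sub>F t in at 0. p \<le> slope f v x t}"
  have bound: "\<bar>slope f v x t\<bar> \<le> L * norm v" for t by (rule slope_abs_le[OF L])
  have "- (L * norm v) \<in> A" using bound by (auto simp: A_def abs_le_iff minus_le_iff)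
  then have "A \<noteq> {}" by auto
  have bdd: "p \<le> L * norm v" if "p \<in> A" for p
  proof -
    have "\<forall>\<^sub>F t in at (0::real). p \<le> L * norm v" 
      using that unfolding A_def mem_Collect_eq
      by eventually_elim (use bound in \<open>meson abs_le_D1 order_trans\<close>)
    then show ?thesis by (simp add: eventually_const_iff)
  qed
  have bddA: "bdd_above A" using bdd by (auto simp: bdd_above_def)
  have "(slope f v x \<longlongrightarrow> Sup A) (at 0)"
  proof (rule order_tendstoI)
    fix a assume "a < Sup A"
    then obtain p where p: "p \<in> A" "a < p" using less_cSupE[OF _ \<open>A \<noteq> {}\<close>] by metis
    then show "\<forall>\<^sub>F t in at 0. a < slope f v x t"
      unfolding A_def mem_Collect_eq by (auto elim: eventually_mono)
  next
    fix b assume b: "Sup A < b"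
    show "\<forall>\<^sub>F t in at 0. slope f v x t < b"
    proof (rule ccontr)
      assume not: "\<not> ?thesis"
      obtain q where q: "q \<in> \<rat>" "Sup A < q" "q < b" using Rats_dense_in_real[OF b] by blast
      obtain p where p: "p \<in> \<rat>" "Sup A < p" "p < q" using Rats_dense_in_real[OF q(2)] by blast
      have "p \<notin> A" using cSup_upper[OF _ bddA, of p] p(2) by auto
      then have "\<not> (\<forall>\<^sub>F t in at 0. p \<le> slope f v x t)" by (simp add: A_def)
      then have lo: "\<exists>t. t \<noteq> 0 \<and> \<bar>t\<bar> < d \<and> slope f v x t < p" if "d > 0" for d
        using that unfolding eventually_at by (auto simp: dist_real_def not_le)
      have hi: "\<exists>t. t \<noteq> 0 \<and> \<bar>t\<bar> < d \<and> slope f v x t > q" if "d > 0" for d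
      proof -
        have "\<exists>t. t \<noteq> 0 \<and> \<bar>t\<bar> < d \<and> \<not> slope f v x t < b"
          using not that unfolding eventually_at by (simp add: dist_real_def)
        then obtain t where "t \<noteq> 0" "\<bar>t\<bar> < d" "\<not> slope f v x t < b" by blast
        then show ?thesis using q(3) by (intro exI[of _ t]) auto
      qed
      show False using x[OF p(1) q(1) p(3)] lo hi by (auto simp: oscillating_def)
    qed
  qed
  then show ?thesis by blast
qed

section \<open>Additivity of the directional derivatives and total differentiability\<close>

text \<open>The set is porous. The increment of f from x along t (u + v) is the increment along t u
  from x plus the increment along t v from x + t u. If a point w of the set were very close to x + t
  u, the second one would be close to t z, against the defect 3 e. So a ball about x + t u, of
  radius proportional to t, misses the set for every small t, and the low density criterion
  applies.\<close>

lemma negligible_porous_directions: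
  fixes f :: "'a::euclidean_space \<Rightarrow> real"
  assumes L: "L-lipschitz_on UNIV f" and "e > 0" "\<delta> > 0"
  shows "negligible {x. \<forall>t. 0 < t \<and> t < \<delta> \<longrightarrow> \<bar>slope f u x t - y\<bar> \<le> e \<and> \<bar>slope f v x t - z\<bar> \<le> e
            \<and> \<bar>slope f (u + v) x t - (y + z)\<bar> \<ge> 3 * e}" (is "negligible ?B")
proof -
  have cf: "continuous_on UNIV f" by (rule lipschitz_on_continuous_on[OF L])
  have cs: "continuous_on UNIV (\<lambda>x. slope f w x t)" if "t > 0" for w t
  proof -
    have "continuous_on UNIV (\<lambda>x. f (x + t *\<^sub>R w))"
      by (rule continuous_on_compose2[OF cf]) (auto intro!: continuous_intros)
    then show "continuous_on UNIV (\<lambda>x. slope f w x t)"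
      unfolding slope_def by (intro continuous_on_divide continuous_on_diff cf continuous_on_const) (use that in auto)
  qed
  have "?B = (\<Inter>t\<in>{0<..<\<delta>}. {x. \<bar>slope f u x t - y\<bar> \<le> e} \<inter> {x. \<bar>slope f v x t - z\<bar> \<le> e}
            \<inter> {x. 3 * e \<le> \<bar>slope f (u + v) x t - (y + z)\<bar>})" by auto
  moreover have "closed \<dots>"
    by (intro closed_INT ballI closed_Int closed_Collect_le continuous_intros cs) auto
  ultimately have "closed ?B" by simp
  then have Bb: "?B \<in> sets borel" by auto
  have L0: "L \<ge> 0" using lipschitz_on_nonneg[OF L] .
  \<comment> \<open>Replacing x + t u by w costs L t \<open>\<eta>\<close> in each of two values of
    f; together this must stay below the e t that remains of 3 e t - e t - e t.\<close>
  define \<eta> where "\<eta> = e / (2 * L + 2)"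
  have \<eta>: "\<eta> > 0" "2 * L * \<eta> < e" using L0 \<open>e > 0\<close> by (auto simp: \<eta>_def field_simps)
  \<comment> \<open>One minus the proportion of volume which the missed ball, of radius t
    \<open>\<eta>\<close>, has in the ball of radius t (|u| + \<open>\<eta>\<close>) about
    x.\<close>
  define c where "c = 1 - (\<eta> / (norm u + \<eta>)) ^ DIM('a)"
  have nu: "norm u + \<eta> > 0" using \<eta> by (simp add: add_nonneg_pos)
  have c1: "c < 1" using nu \<eta> by (simp add: c_def)
  have avoid: "w \<notin> ?B" if x: "x \<in> ?B" and t: "0 < t" "t < \<delta>" and w: "dist w (x + t *\<^sub>R u) < t * \<eta>" for x w t
  proof
    assume wB: "w \<in> ?B"
    have su: "\<bar>f (x + t *\<^sub>R u) - f x - t * y\<bar> \<le> e * t"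
      using x t by (auto simp: slope_def abs_le_iff field_simps)
    have sv: "\<bar>f (w + t *\<^sub>R v) - f w - t * z\<bar> \<le> e * t"
      using wB t by (auto simp: slope_def abs_le_iff field_simps)
    have "3 * e \<le> \<bar>(f (x + t *\<^sub>R (u + v)) - f x - t * (y + z)) / t\<bar>"
      using x t by (auto simp: slope_def diff_divide_distrib)
    then have suv: "3 * e * t \<le> \<bar>f (x + t *\<^sub>R (u + v)) - f x - t * (y + z)\<bar>"
      using t by (simp add: abs_divide field_simps)
    have d1: "\<bar>f w - f (x + t *\<^sub>R u)\<bar> \<le> L * (t * \<eta>)"
      using lipschitz_onD[OF L, of w "x + t *\<^sub>R u"] w L0
      by (smt (verit) UNIV_I dist_real_def mult_left_mono)
    have "dist (w + t *\<^sub>R v) (x + t *\<^sub>R (u + v)) = dist w (x + t *\<^sub>R u)"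
      by (simp add: dist_norm algebra_simps)
    then have d2: "\<bar>f (w + t *\<^sub>R v) - f (x + t *\<^sub>R (u + v))\<bar> \<le> L * (t * \<eta>)"
      using lipschitz_onD[OF L, of "w + t *\<^sub>R v" "x + t *\<^sub>R (u + v)"] w L0
      by (smt (verit) UNIV_I dist_real_def mult_left_mono)
    have "3 * e * t \<le> e * t + e * t + 2 * (L * (t * \<eta>))"
      using su sv suv d1 d2 by (simp add: distrib_left)
    then have "e * t \<le> (2 * L * \<eta>) * t" by (simp add: mult_ac)
    then show False using \<eta>(2) t(1) by simp
  qed
  show ?thesis
  proof (rule negligible_low_density[OF Bb c1])
    fix x d assume x: "x \<in> ?B" and d: "0 < (d::real)"
    define t where "t = min (\<delta>/2) (d / (2 * (norm u + \<eta>)))"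
    have t: "0 < t" "t < \<delta>" using \<open>\<delta> > 0\<close> d nu by (auto simp: t_def)
    define r where "r = t * (norm u + \<eta>)"
    have "t * (norm u + \<eta>) \<le> d / (2 * (norm u + \<eta>)) * (norm u + \<eta>)"
      using nu by (intro mult_right_mono) (auto simp: t_def)
    also have "\<dots> = d / 2" using nu by (simp add: divide_simps)
    also have "\<dots> < d" using d by simp
    finally have "r < d" by (simp add: r_def)
    have "r > 0" using t nu by (simp add: r_def)
    let ?b = "ball (x + t *\<^sub>R u) (t * \<eta>)"
    have bc: "?b \<subseteq> cball x r"
    proof
      fix w assume "w \<in> ?b"
      then have "dist x w \<le> norm (t *\<^sub>R u) + t * \<eta>"
        using dist_triangle[of x w "x + t *\<^sub>R u"] by (simp add: dist_norm)
      then show "w \<in> cball x r" using t by (simp add: r_def distrib_left)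
    qed
    have "w \<notin> ?b" if "w \<in> ?B" for w
    proof
      assume "w \<in> ?b"
      then have "dist w (x + t *\<^sub>R u) < t * \<eta>" by (simp add: dist_commute)
      from avoid[OF x t this] that show False by contradiction
    qed
    then have "?B \<inter> cball x r \<subseteq> cball x r - ?b" by blast
    then have "emeasure lborel (?B \<inter> cball x r) \<le> emeasure lborel (cball x r - ?b)"
      by (rule emeasure_mono) auto
    also have "\<dots> = emeasure lborel (cball x r) - emeasure lborel ?b"
      using bc emeasure_lborel_ball_finite[of "x + t *\<^sub>R u" "t * \<eta>"] by (intro emeasure_Diff) auto
    also have "\<dots> = ennreal (unit_ball_vol (real DIM('a)) * r ^ DIM('a) - unit_ball_vol (real DIM('a)) * (t * \<eta>) ^ DIM('a))"
      using \<open>r > 0\<close> t \<eta> by (simp add: emeasure_cball emeasure_ball ennreal_minus)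
    also have "unit_ball_vol (real DIM('a)) * r ^ DIM('a) - unit_ball_vol (real DIM('a)) * (t * \<eta>) ^ DIM('a)
      = c * (unit_ball_vol (real DIM('a)) * r ^ DIM('a))"
    proof -
      define a where "a = norm u + \<eta>"
      have "a > 0" using nu by (simp add: a_def)
      moreover have "c = 1 - (\<eta> / a) ^ DIM('a)" by (simp add: c_def a_def)
      ultimately have "c * a ^ DIM('a) = a ^ DIM('a) - \<eta> ^ DIM('a)"
        by (simp add: power_divide left_diff_distrib)
      moreover have "r ^ DIM('a) = t ^ DIM('a) * a ^ DIM('a)" by (simp add: r_def a_def power_mult_distrib)
      moreover have "X * R - X * (T * E) = c * (X * R)" if "c * A = A - E" "R = T * A" for X R T E A :: real
        using that by algebra
      ultimately show ?thesis unfolding power_mult_distrib by blast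
    qed
    also have "ennreal \<dots> = ennreal c * emeasure lborel (cball x r)"
      using \<open>r > 0\<close> by (subst emeasure_cball, simp) (simp add: ennreal_mult'')
    finally show "\<exists>a r. 0 < r \<and> r < d \<and> x \<in> cball a r \<and>
                 emeasure lborel (?B \<inter> cball a r) \<le> ennreal c * emeasure lborel (cball a r)"
      using \<open>r < d\<close> \<open>r > 0\<close> by (intro exI[of _ x] exI[of _ r]) auto
  qed
qed

text \<open>A countable dense set of directions, closed under sums and rational multiples: null sets
  may be united over it, and additivity can be tested on it.\<close>

definition rational_vectors :: "'a::euclidean_space set" where
  "rational_vectors = {x. \<forall>b\<in>Basis. x \<bullet> b \<in> \<rat>}"

lemma countable_rational_vectors: "countable (rational_vectors :: 'a::euclidean_space set)"
proof -
  have "(rational_vectors :: 'a set) \<subseteq> (\<lambda>f. \<Sum>b\<in>Basis. f b *\<^sub>R b) ` (Basis \<rightarrow>\<^sub>E \<rat>)"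
  proof
    fix x :: 'a assume "x \<in> rational_vectors"
    then have "restrict (\<lambda>b. x \<bullet> b) Basis \<in> Basis \<rightarrow>\<^sub>E \<rat>" by (auto simp: rational_vectors_def)
    moreover have "x = (\<Sum>b\<in>Basis. restrict (\<lambda>b. x \<bullet> b) Basis b *\<^sub>R b)"
      by (simp add: euclidean_representation)
    ultimately show "x \<in> (\<lambda>f. \<Sum>b\<in>Basis. f b *\<^sub>R b) ` (Basis \<rightarrow>\<^sub>E \<rat>)" by blast
  qed
  then show ?thesis
    by (rule countable_subset) (intro countable_image countable_PiE finite_Basis countable_rat)
qed

lemma closure_rational_vectors: "closure (rational_vectors :: 'a::euclidean_space set) = UNIV"
proof -
  have "(\<Union>f \<in> Basis \<rightarrow> \<rat>. {\<Sum>i :: 'a \<in> Basis. f i *\<^sub>R i}) \<subseteq> rational_vectors"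
    by (auto simp: rational_vectors_def Pi_iff)
  then show ?thesis using closure_mono closure_rational_coordinates by blast
qed

lemma slope_scaleR:
  assumes "(slope f v x \<longlongrightarrow> D) (at 0)"
  shows "(slope f (r *\<^sub>R v) x \<longlongrightarrow> r * D) (at 0)"
proof (cases "r = 0")
  case True
  then show ?thesis by (simp add: slope_def[abs_def])
next
  case False
  have "filterlim (\<lambda>t. r * t) (at 0) (at 0)"
    using False by (auto simp: filterlim_at eventually_at_filter intro!: tendsto_eq_intros)
  from filterlim_compose[OF assms this] have "((\<lambda>t. slope f v x (r * t)) \<longlongrightarrow> D) (at 0)" .
  then have "((\<lambda>t. r * slope f v x (r * t)) \<longlongrightarrow> r * D) (at 0)" by (intro tendsto_intros)
  moreover have "r * slope f v x (r * t) = slope f (r *\<^sub>R v) x t" for t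
    using False by (simp add: slope_def mult.commute)
  ultimately show ?thesis by simp
qed

text \<open>Additivity and rational homogeneity give a linear map A that agrees with the limits on
  rational vectors. Finitely many rational vectors come close to every point of the unit sphere,
  which makes the convergence uniform on them; the Lipschitz bounds of f and A carry the estimate to
  all directions.\<close>

lemma differentiable_of_rational_slopes:
  fixes f :: "'a::euclidean_space \<Rightarrow> real"
  assumes L: "L-lipschitz_on UNIV f"
    and T: "\<And>v. v \<in> rational_vectors \<Longrightarrow> (slope f v x \<longlongrightarrow> T v) (at 0)"
    and add: "\<And>u v. u \<in> rational_vectors \<Longrightarrow> v \<in> rational_vectors \<Longrightarrow> T (u + v) = T u + T v"
  shows "f differentiable (at x)"
proof -
  have L0: "L \<ge> 0" using lipschitz_on_nonneg[OF L] .
  have Tscale: "T (r *\<^sub>R v) = r * T v" if "v \<in> rational_vectors" "r \<in> \<rat>" for r v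
  proof -
    have "r *\<^sub>R v \<in> rational_vectors" using that by (auto simp: rational_vectors_def)
    then show ?thesis using tendsto_unique[OF _ T slope_scaleR[OF T]] that by simp
  qed
  have Tsum: "T (\<Sum>b\<in>F. (u \<bullet> b) *\<^sub>R b) = (\<Sum>b\<in>F. (u \<bullet> b) * T b)"
    if "F \<subseteq> Basis" "u \<in> rational_vectors" for F u
    using finite_subset[OF that(1) finite_Basis] that(1)
  proof (induction F)
    case empty
    show ?case using Tscale[of 0 0] by (simp add: rational_vectors_def)
  next
    case (insert b F)
    have br: "b \<in> rational_vectors" using insert by (auto simp: rational_vectors_def inner_Basis)
    have ub: "u \<bullet> b \<in> \<rat>" using insert that(2) by (auto simp: rational_vectors_def)
    have "(u \<bullet> b) *\<^sub>R b \<in> rational_vectors" using br ub by (auto simp: rational_vectors_def)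
    moreover have "(\<Sum>b\<in>F. (u \<bullet> b) *\<^sub>R b) \<in> rational_vectors"
      using insert that(2) by (auto simp: rational_vectors_def inner_sum_left inner_Basis intro!: Rats_sum)
    ultimately show ?case using insert Tscale[OF br ub] by (simp add: add)
  qed
  define A where "A h = (\<Sum>b\<in>Basis. (h \<bullet> b) * T b)" for h
  have TA: "T u = A u" if "u \<in> rational_vectors" for u
    using Tsum[OF order_refl that] by (simp add: A_def euclidean_representation)
  have blA: "bounded_linear A" unfolding A_def
    by (intro bounded_linear_sum bounded_linear_mult_const bounded_linear_inner_left)
  then interpret A: bounded_linear A .
  obtain K where K: "K \<ge> 0" "\<And>h. norm (A h) \<le> norm h * K" using A.nonneg_bounded by blast
  have "(f has_derivative A) (at x)"
    unfolding has_derivative_at_alt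
  proof (intro conjI allI impI blA)
    fix e :: real assume "e > 0"
    \<comment> \<open>The three errors are e' for a direction of the finite net, L e' for f and K e'
      for A.\<close>
    define e' where "e' = e / (1 + L + K)"
    have e': "e' > 0" "e' * (1 + L + K) = e" using \<open>e > 0\<close> L0 K by (auto simp: e'_def)
    have "sphere (0::'a) 1 \<subseteq> (\<Union>u\<in>rational_vectors. ball u e')"
    proof
      fix w :: 'a
      have "w \<in> closure rational_vectors" by (simp add: closure_rational_vectors)
      then obtain u where "u \<in> rational_vectors" "dist u w < e'"
        using e' closure_approachable by blast
      then show "w \<in> (\<Union>u\<in>rational_vectors. ball u e')" by auto
    qed
    note cover = this
    have op: "open (ball u e')" for u :: 'a by simp
    obtain C where C: "C \<subseteq> rational_vectors" "finite C" "sphere (0::'a) 1 \<subseteq> (\<Union>u\<in>C. ball u e')"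
      by (rule compactE_image[OF compact_sphere op cover])
    have "\<forall>\<^sub>F t in at 0. \<forall>u\<in>C. dist (slope f u x t) (A u) < e'"
      using C(1) e' TA T by (intro eventually_ball_finite C(2) ballI tendstoD) (auto simp: subset_iff)
    then obtain d where d: "d > 0" "\<And>t u. t \<noteq> 0 \<Longrightarrow> \<bar>t\<bar> < d \<Longrightarrow> u \<in> C \<Longrightarrow> dist (slope f u x t) (A u) < e'"
      unfolding eventually_at by (auto simp: dist_real_def)
    have "norm (f y - f x - A (y - x)) \<le> e * norm (y - x)" if y: "norm (y - x) < d" for y
    proof (cases "y = x")
      case True
      then show ?thesis by (simp add: A.zero)
    next
      case False
      define t where "t = norm (y - x)"
      define w where "w = (y - x) /\<^sub>R t"
      have t: "t > 0" "t < d" using False y by (auto simp: t_def)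
      have w: "y = x + t *\<^sub>R w" "norm w = 1" using t False by (auto simp: w_def t_def)
      obtain u where u: "u \<in> C" "dist u w < e'" using C(3) w(2) by (auto simp: subset_iff)
      have nuw: "norm (w - u) \<le> e'" using u(2) by (simp add: dist_norm norm_minus_commute)
      have "\<bar>f (x + t *\<^sub>R w) - f (x + t *\<^sub>R u)\<bar> \<le> L * (t * norm (w - u))"
        using lipschitz_onD[OF L, of "x + t *\<^sub>R w" "x + t *\<^sub>R u"] t
        by (simp add: dist_norm flip: scaleR_diff_right)
      also have "\<dots> \<le> L * (t * e')" using L0 t nuw by (intro mult_left_mono) auto
      finally have 1: "\<bar>f (x + t *\<^sub>R w) - f (x + t *\<^sub>R u)\<bar> \<le> L * (t * e')" .
      have "\<bar>A (t *\<^sub>R w) - A (t *\<^sub>R u)\<bar> \<le> norm (t *\<^sub>R w - t *\<^sub>R u) * K" 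
        using K(2)[of "t *\<^sub>R w - t *\<^sub>R u"] by (simp add: A.diff)
      also have "\<dots> = t * norm (w - u) * K" using t by (simp flip: scaleR_diff_right)
      also have "\<dots> \<le> t * e' * K" using K(1) t nuw by (intro mult_right_mono mult_left_mono) auto
      finally have 2: "\<bar>A (t *\<^sub>R w) - A (t *\<^sub>R u)\<bar> \<le> t * e' * K" .
      have "\<bar>slope f u x t - A u\<bar> \<le> e'" using d(2)[OF _ _ u(1), of t] t by (simp add: dist_real_def)
      then have "\<bar>t * (slope f u x t - A u)\<bar> \<le> t * e'" using t by (simp add: abs_mult)
      moreover have "t * (slope f u x t - A u) = f (x + t *\<^sub>R u) - f x - A (t *\<^sub>R u)"
      proof -
        have "t * slope f u x t = f (x + t *\<^sub>R u) - f x" using t by (simp add: slope_def)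
        then show ?thesis by (simp add: A.scaleR right_diff_distrib)
      qed
      ultimately have 3: "\<bar>f (x + t *\<^sub>R u) - f x - A (t *\<^sub>R u)\<bar> \<le> t * e'" by simp
      have "\<bar>f (x + t *\<^sub>R w) - f x - A (t *\<^sub>R w)\<bar> \<le> L * (t * e') + t * e' * K + t * e'"
        using 1 2 3 by linarith
      also have "\<dots> = (e' * (1 + L + K)) * t" by (simp add: algebra_simps)
      finally show ?thesis unfolding w(1) e'(2) using t w(2) by simp
    qed
    then show "\<exists>d>0. \<forall>y. norm (y - x) < d \<longrightarrow> norm (f y - f x - A (y - x)) \<le> e * norm (y - x)"
      using d(1) by blast
  qed
  then show ?thesis by (auto simp: differentiable_def)
qed

lemma Rademacher_real:
  fixes f :: "'a::euclidean_space \<Rightarrow> real"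
  assumes L: "L-lipschitz_on UNIV f"
  shows "negligible {x. \<not> f differentiable (at x)}"
proof -
  define B where "B u v y z e n = {x. \<forall>t. 0 < t \<and> t < 1 / real (Suc n) \<longrightarrow> \<bar>slope f u x t - y\<bar> \<le> e \<and> \<bar>slope f v x t - z\<bar> \<le> e
            \<and> \<bar>slope f (u + v) x t - (y + z)\<bar> \<ge> 3 * e}" for u v y z e n
  define N where "N = (\<Union>v\<in>rational_vectors. \<Union>(p, q)\<in>{(p, q). p \<in> \<rat> \<and> q \<in> \<rat> \<and> p < q}. oscillating f v p q)
     \<union> (\<Union>(u, v)\<in>rational_vectors \<times> rational_vectors. \<Union>(y, z)\<in>\<rat> \<times> \<rat>. \<Union>(e, n)\<in>{(e, n). e \<in> \<rat> \<and> e > 0}. B u v y z e n)"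
  have c1: "countable {(p, q). p \<in> \<rat> \<and> q \<in> \<rat> \<and> p < (q::real)}"
    by (rule countable_subset[of _ "\<rat> \<times> \<rat>"]) (auto simp: countable_rat)
  have c2: "countable {(e, n::nat). e \<in> \<rat> \<and> e > (0::real)}"
    by (rule countable_subset[of _ "\<rat> \<times> UNIV"]) (auto simp: countable_rat)
  have c3: "countable (rational_vectors \<times> rational_vectors :: ('a \<times> 'a) set)" "countable (\<rat> \<times> \<rat> :: (real \<times> real) set)"
    by (simp_all add: countable_rational_vectors countable_rat)
  have neg: "negligible N" unfolding N_def
  proof (intro negligible_Un)
    show "negligible (\<Union>v\<in>rational_vectors. \<Union>(p, q)\<in>{(p, q). p \<in> \<rat> \<and> q \<in> \<rat> \<and> p < q}. oscillating f v p q)"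
      by (intro negligible_countable_Union countable_image countable_rational_vectors c1; clarify)+
         (auto intro: negligible_oscillating_lipschitz[OF L])
    have "negligible (\<Union>(y, z)\<in>\<rat> \<times> \<rat>. \<Union>(e, n)\<in>{(e, n). e \<in> \<rat> \<and> e > 0}. B u v y z e n)" for u v
    proof -
      have "negligible (\<Union>(e, n)\<in>{(e, n). e \<in> \<rat> \<and> e > 0}. B u v y z e n)" for y z
        by (intro negligible_countable_Union countable_image c2)
           (auto simp: B_def intro!: negligible_porous_directions[OF L])
      then show ?thesis
        by (intro negligible_countable_Union countable_image c3) auto
    qed
    then show "negligible (\<Union>(u, v)\<in>rational_vectors \<times> rational_vectors. \<Union>(y, z)\<in>\<rat> \<times> \<rat>. \<Union>(e, n)\<in>{(e, n). e \<in> \<rat> \<and> e > 0}. B u v y z e n)"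
      by (intro negligible_countable_Union countable_image c3) auto
  qed
  have "f differentiable (at x)" if x: "x \<notin> N" for x
  proof -
    have "\<exists>D. (slope f v x \<longlongrightarrow> D) (at 0)" if "v \<in> rational_vectors" for v
      by (rule not_oscillating_slope_tendsto[OF L]) (use x that in \<open>auto simp: N_def\<close>)
    then obtain T where T: "\<And>v. v \<in> rational_vectors \<Longrightarrow> (slope f v x \<longlongrightarrow> T v) (at 0)" by metis
    have "T (u + v) = T u + T v" if uv: "u \<in> rational_vectors" "v \<in> rational_vectors" for u v
    proof (rule ccontr)
      assume "T (u + v) \<noteq> T u + T v"
      \<comment> \<open>An error of e in the slope along u + v and of e/2 in each of y and z still
        leaves a defect of 3 e from a gap above 5 e.\<close>
      then have "0 < \<bar>T (u + v) - (T u + T v)\<bar> / 5" by simp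
      then obtain e where e: "e \<in> \<rat>" "0 < e" "e < \<bar>T (u + v) - (T u + T v)\<bar> / 5" 
        using Rats_dense_in_real by blast
      obtain y where y: "y \<in> \<rat>" "T u - e/2 < y" "y < T u + e/2" 
        using Rats_dense_in_real[of "T u - e/2" "T u + e/2"] e by auto
      obtain z where z: "z \<in> \<rat>" "T v - e/2 < z" "z < T v + e/2" 
        using Rats_dense_in_real[of "T v - e/2" "T v + e/2"] e by auto
      have uv': "u + v \<in> rational_vectors" using uv by (auto simp: rational_vectors_def inner_add_left)
      have "\<forall>\<^sub>F t in at 0. dist (slope f u x t) (T u) < e/2 \<and> dist (slope f v x t) (T v) < e/2 
             \<and> dist (slope f (u + v) x t) (T (u + v)) < e"
        using T[OF uv(1)] T[OF uv(2)] T[OF uv'] e(2) by (intro eventually_conj tendstoD) auto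
      then obtain d where d: "d > 0" "\<And>t. t \<noteq> 0 \<Longrightarrow> \<bar>t\<bar> < d \<Longrightarrow> 
           dist (slope f u x t) (T u) < e/2 \<and> dist (slope f v x t) (T v) < e/2 
             \<and> dist (slope f (u + v) x t) (T (u + v)) < e"
        unfolding eventually_at by (auto simp: dist_real_def)
      obtain n where n: "1 / real (Suc n) < d" using d(1) by (metis nat_approx_posE)
      have "x \<in> B u v y z e n"
        unfolding B_def
      proof (safe)
        fix t :: real assume "0 < t" "t < 1 / real (Suc n)"
        then have "dist (slope f u x t) (T u) < e/2" "dist (slope f v x t) (T v) < e/2" 
           "dist (slope f (u + v) x t) (T (u + v)) < e" using d(2)[of t] n by auto
        moreover have "5 * e < \<bar>T (u + v) - (T u + T v)\<bar>" using e(3) by simp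
        ultimately show "\<bar>slope f u x t - y\<bar> \<le> e" "\<bar>slope f v x t - z\<bar> \<le> e" 
            "3 * e \<le> \<bar>slope f (u + v) x t - (y + z)\<bar>"
          using y z e(2) unfolding dist_real_def by argo+
      qed
      then have "x \<in> N" unfolding N_def using uv y(1) z(1) e(1,2) by auto
      with x show False ..
    qed
    with T show ?thesis by (rule differentiable_of_rational_slopes[OF L])
  qed
  then show ?thesis by (intro negligible_subset[OF neg]) auto
qed

theorem Rademacher:
  fixes f :: "'a::euclidean_space \<Rightarrow> 'b::euclidean_space"
  assumes L: "L-lipschitz_on UNIV f"
  shows "negligible {x. \<not> f differentiable (at x)}"
proof -
  have "negligible {x. \<not> (\<lambda>x. f x \<bullet> b) differentiable (at x)}" if "b \<in> Basis" for b
  proof (rule Rademacher_real)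
    show "L-lipschitz_on UNIV (\<lambda>x. f x \<bullet> b)"
    proof (rule lipschitz_onI)
      show "dist (f x \<bullet> b) (f y \<bullet> b) \<le> L * dist x y" for x y
        using Basis_le_norm[OF that, of "f x - f y"] lipschitz_onD[OF L, of x y]
        by (simp add: dist_norm inner_diff_left)
    qed (rule lipschitz_on_nonneg[OF L])
  qed
  then have "negligible (\<Union>b\<in>Basis. {x. \<not> (\<lambda>x. f x \<bullet> b) differentiable (at x)})"
    by (intro negligible_Union) auto
  moreover have "{x. \<not> f differentiable (at x)} = (\<Union>b\<in>Basis. {x. \<not> (\<lambda>x. f x \<bullet> b) differentiable (at x)})"
    by (subst differentiable_componentwise_within) auto
  ultimately show ?thesis by simp
qed

section \<open>Maps of spheres and the cube model of the sphere\<close>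

abbreviation sphere_homotopic :: "'b::topological_space set \<Rightarrow> ('a::real_normed_vector \<Rightarrow> 'b) \<Rightarrow> ('a \<Rightarrow> 'b) \<Rightarrow> bool" where
  "sphere_homotopic \<equiv> homotopic_with_canon (\<lambda>_. True) (sphere 0 1)"

lemma sphere_homotopic_cong:
  assumes "sphere_homotopic Z f g" "\<And>x. norm x = 1 \<Longrightarrow> f' x = f x" "\<And>x. norm x = 1 \<Longrightarrow> g' x = g x"
  shows "sphere_homotopic Z f' g'"
  by (rule homotopic_with_eq[OF assms(1)]) (use assms in auto)

lemma sphere_homotopic_refl:
  assumes "continuous_on (sphere 0 1) f" "\<And>x. norm x = 1 \<Longrightarrow> f x \<in> Z"
  shows "sphere_homotopic Z f f"
  using assms by (auto simp: homotopic_with_refl)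

lemma sphere_homotopic_left:
  assumes "sphere_homotopic Z f g" "continuous_on Z h" "h ` Z \<subseteq> Z'"
  shows "sphere_homotopic Z' (\<lambda>x. h (f x)) (\<lambda>x. h (g x))"
  using homotopic_with_compose_continuous_left[of "\<lambda>_. True" h "sphere 0 1" Z f g Z'] assms
  by (auto simp: o_def)

lemma sphere_homotopic_right:
  fixes f g :: "'a::real_normed_vector \<Rightarrow> 'b::topological_space" and h :: "'c::real_normed_vector \<Rightarrow> 'a"
  assumes "sphere_homotopic Z f g" "continuous_on (sphere 0 1) h" "h ` sphere 0 1 \<subseteq> sphere 0 1"
  shows "sphere_homotopic Z (\<lambda>x. f (h x)) (\<lambda>x. g (h x))"
  using homotopic_with_compose_continuous_right[of "\<lambda>_. True" h "sphere 0 1" Z f g "sphere 0 1"] assms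
  by (auto simp: o_def)

lemma sphere_homotopic_linear:
  fixes f g :: "'a::real_normed_vector \<Rightarrow> 'b::real_normed_vector"
  assumes "continuous_on (sphere 0 1) f" "continuous_on (sphere 0 1) g"
    and "\<And>x s. norm x = 1 \<Longrightarrow> 0 \<le> s \<Longrightarrow> s \<le> 1 \<Longrightarrow> (1 - s) *\<^sub>R f x + s *\<^sub>R g x \<in> Z"
  shows "sphere_homotopic Z f g"
  using assms by (intro homotopic_with_linear) (auto simp: closed_segment_def)

lemma nonantipodal_segment:
  fixes a b :: "'a::real_normed_vector"
  assumes "(1 - s) *\<^sub>R a + s *\<^sub>R b = 0" "0 \<le> s" "s \<le> 1" "a \<noteq> 0" "b \<noteq> 0"
  shows "\<exists>c>0. a = - (c *\<^sub>R b)"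
proof -
  have "s \<noteq> 1" "s \<noteq> 0" using assms by auto
  have "(1 - s) *\<^sub>R a = - (s *\<^sub>R b)" using assms(1) by (simp add: eq_neg_iff_add_eq_0)
  then have "(1 / (1 - s)) *\<^sub>R ((1 - s) *\<^sub>R a) = (1 / (1 - s)) *\<^sub>R (- (s *\<^sub>R b))" by simp
  then have "a = - ((s / (1 - s)) *\<^sub>R b)" using \<open>s \<noteq> 1\<close> by simp
  then show ?thesis using assms \<open>s \<noteq> 1\<close> \<open>s \<noteq> 0\<close> by (intro exI[of _ "s / (1 - s)"]) auto
qed

text \<open>The segment from f x to g x misses the origin, so the straight homotopy can be
  normalised. The homotopies to the identity of the sphere below rest on this.\<close>

lemma homotopic_spheremaps_nonantipodal:
  fixes f g :: "'a::euclidean_space \<Rightarrow> 'b::euclidean_space"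
  assumes f: "continuous_on (sphere 0 1) f" "f ` sphere 0 1 \<subseteq> sphere 0 1"
    and g: "continuous_on (sphere 0 1) g" "g ` sphere 0 1 \<subseteq> sphere 0 1"
    and ne: "\<And>x. norm x = 1 \<Longrightarrow> f x \<noteq> - g x"
  shows "sphere_homotopic (sphere 0 1) f g"
proof -
  have nf: "norm (f x) = 1" "norm (g x) = 1" if "norm x = 1" for x
    using f(2) g(2) that by (auto simp: image_subset_iff)
  have "sphere_homotopic (- {0}) f g"
  proof (rule sphere_homotopic_linear[OF f(1) g(1)])
    fix x :: 'a and s :: real assume x: "norm x = 1" and s: "0 \<le> s" "s \<le> 1"
    have "(1 - s) *\<^sub>R f x + s *\<^sub>R g x \<noteq> 0"
    proof
      assume "(1 - s) *\<^sub>R f x + s *\<^sub>R g x = 0"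
      moreover have "f x \<noteq> 0" "g x \<noteq> 0" using nf[OF x] by auto
      ultimately obtain c where c: "c > 0" "f x = - (c *\<^sub>R g x)"
        using nonantipodal_segment[of s "f x" "g x"] s by auto
      then have "c = 1" using nf[OF x] by simp
      then show False using c ne[OF x] by simp
    qed
    then show "(1 - s) *\<^sub>R f x + s *\<^sub>R g x \<in> - {0}" by simp
  qed
  moreover have "continuous_on (- {0}) (\<lambda>y::'b. y /\<^sub>R norm y)" by (intro continuous_intros) auto
  moreover have "(\<lambda>y::'b. y /\<^sub>R norm y) ` (- {0}) \<subseteq> sphere 0 1"
  proof (rule image_subsetI, unfold Compl_iff singleton_iff)
    fix y :: 'b assume "y \<noteq> 0"
    then have "norm (y /\<^sub>R norm y) = 1" by simp
    then show "y /\<^sub>R norm y \<in> sphere 0 1" by simp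
  qed
  ultimately have "sphere_homotopic (sphere 0 1) (\<lambda>x. f x /\<^sub>R norm (f x)) (\<lambda>x. g x /\<^sub>R norm (g x))"
    by (rule sphere_homotopic_left)
  then show ?thesis by (rule sphere_homotopic_cong) (use nf in auto)
qed

section \<open>The quotient map that collapses the boundary of the cube\<close>

lemma infnorm_le_iff: "infnorm (x::'a::euclidean_space) \<le> c \<longleftrightarrow> (\<forall>b\<in>Basis. \<bar>x \<bullet> b\<bar> \<le> c)"
  by (simp add: infnorm_Max)

lemma infnorm_attained:
  obtains b where "b \<in> Basis" "infnorm (x::'a::euclidean_space) = \<bar>x \<bullet> b\<bar>"
proof -
  have "infnorm x \<in> (\<lambda>b. \<bar>x \<bullet> b\<bar>) ` Basis" unfolding infnorm_Max by (rule Max_in) auto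
  then show thesis using that by auto
qed

text \<open>Extends \<^const>\<open>cube_to_sphere\<close>, recentred at the origin, to the whole space by the base point.\<close>
definition cap :: "'d::euclidean_space \<Rightarrow> real \<times> 'd" where
  "cap u = (let t = min 1 (2 * infnorm u) in (cos (pi * t), sin (pi * t) *\<^sub>R (u /\<^sub>R norm u)))"

lemma mem_unit_cube_iff: "x \<in> cbox 0 One \<longleftrightarrow> infnorm (x - (1/2) *\<^sub>R One) \<le> 1/2"
proof -
  have "0 \<le> x \<bullet> b \<and> x \<bullet> b \<le> 1 \<longleftrightarrow> \<bar>(x - (1/2) *\<^sub>R One) \<bullet> b\<bar> \<le> 1/2" if "b \<in> Basis" for b
  proof -
    have "(x - (1/2) *\<^sub>R One) \<bullet> b = x \<bullet> b - 1/2" using that by (simp add: inner_diff_left)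
    then show ?thesis unfolding abs_le_iff by linarith
  qed
  then show ?thesis unfolding infnorm_le_iff mem_box by simp
qed

lemma cube_to_sphere_eq_cap:
  assumes "x \<in> cbox 0 One"
  shows "cube_to_sphere x = cap (x - (1/2) *\<^sub>R One)"
proof -
  have "min 1 (2 * infnorm (x - (1/2) *\<^sub>R One)) = 2 * infnorm (x - (1/2) *\<^sub>R One)"
    using assms unfolding mem_unit_cube_iff by linarith
  then show ?thesis by (simp only: cube_to_sphere_def cap_def Let_def)
qed

lemma cap_eq_base: "1/2 \<le> infnorm u \<Longrightarrow> cap u = sph_base"
  by (simp add: cap_def sph_base_def)

lemma cap_0 [simp]: "cap 0 = (1, 0)"
  by (simp add: cap_def infnorm_0)

lemma norm_cap [simp]: "norm (cap u) = 1"
proof (cases "u = 0")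
  case False
  then have "norm (u /\<^sub>R norm u) = 1" by simp
  then show ?thesis unfolding cap_def Let_def norm_Pair norm_scaleR[of _ "u /\<^sub>R norm u"] by simp
qed simp

text \<open>The one delicate point is the origin, where the direction u/|u| jumps; there it is
  multiplied by a sine that tends to 0.\<close>

lemma continuous_on_cap: "continuous_on A cap"
proof -
  define T where "T u = min 1 (2 * infnorm u)" for u :: 'a
  have T: "continuous_on UNIV T" unfolding T_def by (intro continuous_intros)
  have iT: "isCont T u" for u using T by (simp add: continuous_on_eq_continuous_at)
  define F where "F u = sin (pi * T u) *\<^sub>R (u /\<^sub>R norm u)" for u :: 'a
  have "isCont F u" for u
  proof (cases "u = 0")
    case True
    have "((\<lambda>u. sin (pi * T u)) \<longlongrightarrow> sin (pi * T 0)) (at 0)"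
      using iT[of 0] unfolding isCont_def by (intro tendsto_intros)
    then have lim: "((\<lambda>u. norm (sin (pi * T u))) \<longlongrightarrow> 0) (at 0)"
      using tendsto_norm by (fastforce simp: T_def infnorm_0)
    have le: "norm (F u) \<le> norm (sin (pi * T u))" for u
    proof (cases "u = 0")
      case False
      then have "norm (u /\<^sub>R norm u) = 1" by simp
      then show ?thesis unfolding F_def norm_scaleR[of _ "u /\<^sub>R norm u"] by simp
    qed (simp add: F_def)
    have "(F \<longlongrightarrow> 0) (at 0)"
      by (rule Lim_null_comparison[OF always_eventually lim]) (use le in blast)
    moreover have "F 0 = 0" by (simp add: F_def)
    ultimately show ?thesis using True by (simp add: isCont_def)
  next
    case False
    then show ?thesis unfolding F_def[abs_def] by (intro continuous_intros iT) auto
  qed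
  note F = this
  have "isCont cap u" for u :: 'a
  proof -
    have "cap = (\<lambda>u. (cos (pi * T u), F u))" by (simp add: fun_eq_iff cap_def Let_def T_def F_def)
    moreover have "isCont (\<lambda>u. (cos (pi * T u), F u)) u" by (intro continuous_intros iT F)
    ultimately show ?thesis by simp
  qed
  then show ?thesis by (simp add: continuous_at_imp_continuous_on)
qed

text \<open>The cosine is injective on [0, pi], so the first component recovers the sup norm as long
  as it is below 1/2. Then, unless the point is 0, the sine is positive and the second component
  recovers the direction.\<close>

lemma cap_eqD:
  assumes "cap u = cap v"
  shows "u = v \<or> (1/2 \<le> infnorm u \<and> 1/2 \<le> infnorm v)"
proof -
  define s where "s = min 1 (2 * infnorm u)"
  define t where "t = min 1 (2 * infnorm v)"
  have st: "0 \<le> s" "s \<le> 1" "0 \<le> t" "t \<le> 1" by (auto simp: s_def t_def infnorm_pos_le)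
  have e: "cos (pi * s) = cos (pi * t)" "sin (pi * s) *\<^sub>R (u /\<^sub>R norm u) = sin (pi * t) *\<^sub>R (v /\<^sub>R norm v)"
    using assms unfolding cap_def Let_def s_def[symmetric] t_def[symmetric] prod.inject by blast+
  have "pi * s = pi * t"
  proof (rule cos_inj_pi[OF _ _ _ _ e(1)])
    show "pi * s \<le> pi" "pi * t \<le> pi" using st by (auto intro: mult_left_le)
  qed (use st in auto)
  then have "s = t" by simp
  show ?thesis
  proof (cases "s = 1")
    case True
    then show ?thesis using \<open>s = t\<close> by (auto simp: s_def t_def min_def split: if_splits)
  next
    case False
    then have eq: "infnorm u = infnorm v" using \<open>s = t\<close> by (auto simp: s_def t_def min_def split: if_splits)
    show ?thesis
    proof (cases "u = 0")
      case True
      then show ?thesis using eq by (simp add: infnorm_0 infnorm_eq_0)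
    next
      case False
      then have "v \<noteq> 0" using eq by (metis infnorm_eq_0)
      have "s > 0" using False st by (auto simp: s_def infnorm_pos_lt)
      then have pos: "sin (pi * s) > 0" using st \<open>s \<noteq> 1\<close> by (intro sin_gt_zero) auto
      then have "u /\<^sub>R norm u = v /\<^sub>R norm v" using e(2) pos
        unfolding \<open>s = t\<close>[symmetric] scaleR_cancel_left by linarith
      then have "norm u *\<^sub>R (u /\<^sub>R norm u) = norm u *\<^sub>R (v /\<^sub>R norm v)" by (rule arg_cong)
      then have u: "u = (norm u / norm v) *\<^sub>R v" using False by (simp add: divide_inverse)
      then have "infnorm u = norm u / norm v * infnorm v" by (metis abs_divide abs_norm_cancel infnorm_mul)
      then have "norm u / norm v * infnorm v = 1 * infnorm v" using eq by linarith
      moreover have "infnorm v \<noteq> 0" using \<open>v \<noteq> 0\<close> by (simp add: infnorm_eq_0)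
      ultimately have "norm u / norm v = 1" unfolding mult_cancel_right by blast
      with u have "u = 1 *\<^sub>R v" by metis
      then show ?thesis by simp
    qed
  qed
qed

lemma cap_surj:
  fixes y :: "real \<times> 'd::euclidean_space"
  assumes "norm y = 1"
  obtains u where "infnorm u \<le> 1/2" "cap u = y"
proof -
  obtain a w where y: "y = (a, w)" by (cases y)
  have aw: "a\<^sup>2 + (norm w)\<^sup>2 = 1" using assms by (simp add: y norm_Pair)
  have "a\<^sup>2 \<le> 1" using aw by (metis le_add_same_cancel1 zero_le_power2)
  then have a: "-1 \<le> a" "a \<le> 1" by (auto simp: abs_square_le_1 abs_le_iff)
  show thesis
  proof (cases "w = 0")
    case True
    then have "a = 1 \<or> a = -1" using aw by (simp add: power2_eq_1_iff)
    then show thesis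
    proof
      assume "a = 1" then show thesis using that[of 0] True y by (simp add: infnorm_0)
    next
      assume "a = -1"
      obtain b :: 'd where b: "b \<in> Basis" using nonempty_Basis by blast
      have "infnorm b = 1" 
        using b by (intro antisym) (auto simp: infnorm_le_iff inner_Basis intro!: order_trans[OF _ Basis_le_infnorm[OF b]])
      then have i: "infnorm ((1/2) *\<^sub>R b) = 1/2" by (simp add: infnorm_mul)
      have "cap ((1/2) *\<^sub>R b) = sph_base" by (rule cap_eq_base) (simp only: i)
      then show thesis using that[of "(1/2) *\<^sub>R b"] i True y \<open>a = -1\<close> by (simp add: sph_base_def)
    qed
  next
    case False
    define t where "t = arccos a / pi"
    have t: "0 \<le> t" "t \<le> 1" "pi * t = arccos a"
      using arccos_bounded[OF a] by (auto simp: t_def divide_simps)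
    have t0: "t \<noteq> 0"
    proof
      assume "t = 0"
      then have "arccos a = 0" using t by simp
      then have "a = 1" using cos_arccos[OF a] by simp
      then show False using aw False by simp
    qed
    define u where "u = (t / (2 * infnorm w)) *\<^sub>R w"
    have iw: "infnorm w > 0" using False by (simp add: infnorm_pos_lt)
    have iu: "2 * infnorm u = t" using iw t by (simp add: u_def infnorm_mul)
    have "u /\<^sub>R norm u = w /\<^sub>R norm w" 
    proof -
      define k where "k = t / (2 * infnorm w)"
      have k: "k > 0" using iw t t0 by (simp add: k_def)
      have u: "u = k *\<^sub>R w" "norm u = k * norm w" using k by (simp_all add: u_def k_def[symmetric])
      have "u /\<^sub>R norm u = (inverse (k * norm w) * k) *\<^sub>R w" unfolding u(2) unfolding u(1) by (rule scaleR_scaleR)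
      also have "inverse (k * norm w) * k = inverse (norm w)" using k by simp
      finally show ?thesis .
    qed
    note dir = this
    have "(norm w)\<^sup>2 = 1 - a\<^sup>2" using aw by simp
    then have "norm w = sqrt (1 - a\<^sup>2)" by (metis norm_ge_zero real_sqrt_abs abs_of_nonneg)
    also have "\<dots> = sin (arccos a)" using a by (intro sin_arccos_abs[symmetric]) simp
    finally have nw: "norm w = sin (arccos a)" .
    have "sin (arccos a) *\<^sub>R (w /\<^sub>R norm w) = w" using False unfolding nw[symmetric] by simp
    moreover have "min 1 t = t" using t(2) by simp
    ultimately have "cap u = y"
      unfolding cap_def iu y Let_def dir by (simp only: t(3) cos_arccos[OF a])
    then show thesis using that[of u] iu t(2) by simp
  qed
qed

text \<open>The collapse maps a compact cube onto a Hausdorff space, hence is a quotient map, and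
  its only nontrivial fibre is the boundary of the cube. In this way maps given on the cube become
  maps of the sphere, with no formula on the sphere itself.\<close>

lemma factor_through_cap:
  fixes f :: "'d::euclidean_space \<Rightarrow> 'y::topological_space"
  assumes f: "continuous_on {u. infnorm u \<le> 1/2} f"
    and z: "\<And>u. infnorm u = 1/2 \<Longrightarrow> f u = z"
  shows "\<exists>G. continuous_on (sphere 0 1) G \<and> (\<forall>u. infnorm u \<le> 1/2 \<longrightarrow> G (cap u) = f u)"
proof -
  define Q :: "'d set" where "Q = {u. infnorm u \<le> 1/2}"
  define G where "G y = f (SOME u. u \<in> Q \<and> cap u = y)" for y
  have G: "G (cap u) = f u" if "u \<in> Q" for u
  proof -
    have s: "(SOME v. v \<in> Q \<and> cap v = cap u) \<in> Q \<and> cap (SOME v. v \<in> Q \<and> cap v = cap u) = cap u"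
      by (rule someI[of _ u]) (use that in auto)
    show ?thesis using cap_eqD[of "SOME v. v \<in> Q \<and> cap v = cap u" u] s that z
      unfolding G_def by (auto simp: Q_def)
  qed
  have Qeq: "Q = cbox (- (1/2) *\<^sub>R One) ((1/2) *\<^sub>R One)"
  proof -
    have "\<bar>x \<bullet> b\<bar> \<le> 1/2 \<longleftrightarrow> (- (1/2) *\<^sub>R One) \<bullet> b \<le> x \<bullet> b \<and> x \<bullet> b \<le> ((1/2) *\<^sub>R One) \<bullet> b" 
      if "b \<in> Basis" for x b :: 'd
      using that by (auto simp: abs_le_iff)
    then show ?thesis unfolding Q_def infnorm_le_iff cbox_def by blast
  qed
  have "compact Q" by (simp add: Qeq)
  have im: "cap ` Q = sphere 0 1"
  proof
    show "sphere 0 1 \<subseteq> cap ` Q"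
    proof
      fix y :: "real \<times> 'd" assume "y \<in> sphere 0 1"
      then obtain u where "infnorm u \<le> 1/2" "cap u = y" using cap_surj[of y] by auto
      then show "y \<in> cap ` Q" by (auto simp: Q_def)
    qed
  qed auto
  have "continuous_on (sphere 0 1) G"
    unfolding continuous_openin_preimage_eq
  proof (intro allI impI)
    fix T :: "'y set" assume "open T"
    have "openin (top_of_set Q) (Q \<inter> f -` T)"
      using f \<open>open T\<close> unfolding continuous_openin_preimage_eq Q_def by blast
    moreover have "Q \<inter> f -` T = Q \<inter> cap -` (sphere 0 1 \<inter> G -` T)"
    proof (intro equalityI subsetI)
      fix x assume "x \<in> Q \<inter> cap -` (sphere 0 1 \<inter> G -` T)"
      then show "x \<in> Q \<inter> f -` T" using G[of x] by (auto simp del: split_paired_All)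
    qed (use G in auto)
    ultimately show "openin (top_of_set (sphere 0 1)) (sphere 0 1 \<inter> G -` T)"
      using Abstract_Topology_2.continuous_imp_quotient_map[OF continuous_on_cap im \<open>compact Q\<close>, of "sphere 0 1 \<inter> G -` T"]
      by simp
  qed
  then show ?thesis using G by (auto simp: Q_def)
qed

section \<open>Gluing sphere maps along slabs\<close>

lemma first_dir_Basis: "(first_dir :: 'd::euclidean_space) \<in> Basis"
  unfolding first_dir_def by (rule someI_ex) (use nonempty_Basis in blast)

lemma first_dir_inner [simp]: "(first_dir :: 'd::euclidean_space) \<bullet> first_dir = 1"
  by (rule inner_same_Basis[OF first_dir_Basis])

lemma norm_first_dir [simp]: "norm (first_dir :: 'd::euclidean_space) = 1"
  by (rule norm_Basis[OF first_dir_Basis])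

definition stretch :: "nat \<Rightarrow> 'd::euclidean_space \<Rightarrow> 'd" where
  "stretch N v = v + ((real N - 1) * (v \<bullet> first_dir)) *\<^sub>R first_dir"

text \<open>The middle of the j-th of N equal slabs of [-1/2, 1/2].\<close>

definition slab_pos :: "nat \<Rightarrow> nat \<Rightarrow> real" where
  "slab_pos N j = (2 * real j + 1) / (2 * real N) - 1 / 2"

text \<open>At height h = \<open>fst y\<close> in (0, 1] the j-th slab of the cube, shrunk by the
  factor h about its middle, is collapsed to the sphere, and all else goes to the base point; above
  height 1 the slab grows no more. The points not sent to the base point thus form a cone with apex
  \<open>(0, slab_pos N j *\<^sub>R first_dir)\<close>, continued by a cylinder. The apex is the
  only discontinuity. A large sphere meets all the cones, a small sphere about an apex only its
  own.\<close>

definition slab_map :: "nat \<Rightarrow> nat \<Rightarrow> real \<times> 'd::euclidean_space \<Rightarrow> real \<times> 'd" where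
  "slab_map N j y = (if fst y > 0 then cap (inverse (min (fst y) 1) *\<^sub>R stretch N (snd y - slab_pos N j *\<^sub>R first_dir)) 
     else sph_base)"

lemma stretch_first_dir [simp]: "stretch N v \<bullet> first_dir = real N * (v \<bullet> first_dir)"
  by (simp add: stretch_def inner_add_left algebra_simps)

lemma stretch_other: "b \<in> Basis \<Longrightarrow> b \<noteq> first_dir \<Longrightarrow> stretch N v \<bullet> b = v \<bullet> b"
  by (simp add: stretch_def inner_add_left inner_not_same_Basis first_dir_Basis)

lemma stretch_0 [simp]: "stretch N 0 = 0"
  by (simp add: stretch_def)

lemma stretch_scaleR: "stretch N (c *\<^sub>R v) = c *\<^sub>R stretch N v"
  by (simp add: stretch_def algebra_simps)

lemma stretch_inner_pos:
  assumes "N \<ge> 1" "v \<noteq> 0"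
  shows "stretch N v \<bullet> v > 0"
proof -
  have "stretch N v \<bullet> v = v \<bullet> v + (real N - 1) * (v \<bullet> first_dir)\<^sup>2"
    by (simp add: stretch_def inner_add_left inner_commute[of first_dir v] power2_eq_square)
  moreover have "(real N - 1) * (v \<bullet> first_dir)\<^sup>2 \<ge> 0" using assms by simp
  moreover have "v \<bullet> v > 0" using assms by simp
  ultimately show ?thesis by linarith
qed

lemma continuous_on_stretch [continuous_intros]:
  "continuous_on A f \<Longrightarrow> continuous_on A (\<lambda>x. stretch N (f x))"
  unfolding stretch_def by (intro continuous_intros)

lemma N_slab_pos: "N \<ge> 1 \<Longrightarrow> real N * slab_pos N j = real j + 1/2 - real N / 2"
  by (simp add: slab_pos_def field_simps)

lemma norm_slab_map [simp]: "norm (slab_map N j y) = 1"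
  by (simp add: slab_map_def sph_base_def)

lemma slab_map_base:
  assumes "fst y \<le> 2 * infnorm (stretch N (snd y - slab_pos N j *\<^sub>R first_dir)) 
     \<or> 1 \<le> 2 * infnorm (stretch N (snd y - slab_pos N j *\<^sub>R first_dir))"
  shows "slab_map N j y = sph_base"
proof (cases "fst y > 0")
  case True
  define a where "a = min (fst y) 1"
  define w where "w = stretch N (snd y - slab_pos N j *\<^sub>R first_dir)"
  have a: "a > 0" "a \<le> 2 * infnorm w" using True assms unfolding a_def w_def by linarith+
  have "infnorm (inverse a *\<^sub>R w) = infnorm w / a" 
    using a by (simp add: infnorm_mul divide_inverse mult.commute)
  moreover have "infnorm w / a \<ge> 1/2" using a by (simp add: pos_le_divide_eq)
  ultimately have "cap (inverse a *\<^sub>R w) = sph_base" by (intro cap_eq_base) linarith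
  then show ?thesis by (simp add: slab_map_def a_def w_def)
qed (simp add: slab_map_def)

text \<open>On the half-space of positive height the formula is continuous; on the open set outside
  the closed cone the map is constant. The two open sets leave out nothing but the apex.\<close>

lemma continuous_on_slab_map:
  assumes "N \<ge> 1" "(0, slab_pos N j *\<^sub>R first_dir) \<notin> A"
  shows "continuous_on A (slab_map N j :: real \<times> 'd::euclidean_space \<Rightarrow> _)"
proof -
  define U where "U = {y :: real \<times> 'd. 0 < fst y}"
  define V where "V = {y :: real \<times> 'd. fst y < 2 * infnorm (stretch N (snd y - slab_pos N j *\<^sub>R first_dir))}"
  have oU: "open U" unfolding U_def by (intro open_Collect_less continuous_intros)
  have oV: "open V" unfolding V_def by (intro open_Collect_less continuous_intros)
  have "continuous_on U (\<lambda>y. cap (inverse (min (fst y) 1) *\<^sub>R stretch N (snd y - slab_pos N j *\<^sub>R first_dir)))"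
  proof (rule continuous_on_compose2[OF continuous_on_cap[of UNIV]])
    show "continuous_on U (\<lambda>y. inverse (min (fst y) 1) *\<^sub>R stretch N (snd y - slab_pos N j *\<^sub>R first_dir))"
      by (intro continuous_intros) (auto simp: U_def)
  qed auto
  then have cU: "continuous_on U (slab_map N j)"
    by (rule continuous_on_eq) (simp add: U_def slab_map_def)
  have cV: "continuous_on V (slab_map N j)"
    by (rule continuous_on_eq[of _ "\<lambda>_. sph_base"]) (auto simp: V_def intro!: slab_map_base[symmetric])
  have "continuous_on (U \<union> V) (slab_map N j)"
    by (rule continuous_on_open_Un[OF oU oV cU cV])
  moreover have "A \<subseteq> U \<union> V"
  proof
    fix y assume "y \<in> A"
    show "y \<in> U \<union> V"
    proof (rule ccontr)
      assume "y \<notin> U \<union> V"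
      then have *: "fst y \<le> 0" "2 * infnorm (stretch N (snd y - slab_pos N j *\<^sub>R first_dir)) \<le> fst y"
        by (auto simp: U_def V_def)
      have "infnorm (stretch N (snd y - slab_pos N j *\<^sub>R first_dir)) \<ge> 0" by (rule infnorm_pos_le)
      with * have "fst y = 0" "infnorm (stretch N (snd y - slab_pos N j *\<^sub>R first_dir)) = 0" by linarith+
      then have "stretch N (snd y - slab_pos N j *\<^sub>R first_dir) = 0" using infnorm_eq_0 by blast
      then have "snd y - slab_pos N j *\<^sub>R first_dir = 0"
        using stretch_inner_pos[OF assms(1), of "snd y - slab_pos N j *\<^sub>R first_dir"] by force
      then have "y = (0, slab_pos N j *\<^sub>R first_dir)" using \<open>fst y = 0\<close> by (simp add: prod_eq_iff)
      then show False using assms(2) \<open>y \<in> A\<close> by simp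
    qed
  qed
  ultimately show ?thesis by (rule continuous_on_subset)
qed

lemma slab_map_nonbase:
  assumes "N \<ge> 1" "slab_map N j y \<noteq> sph_base"
  shows "\<bar>real N * (snd y \<bullet> first_dir) - (real j + 1/2 - real N / 2)\<bar> < 1/2"
proof -
  have "2 * infnorm (stretch N (snd y - slab_pos N j *\<^sub>R first_dir)) < 1"
    using slab_map_base assms(2) by (metis not_le)
  moreover have "\<bar>stretch N (snd y - slab_pos N j *\<^sub>R first_dir) \<bullet> first_dir\<bar> \<le> infnorm (stretch N (snd y - slab_pos N j *\<^sub>R first_dir))"
    by (rule Basis_le_infnorm[OF first_dir_Basis])
  moreover have "stretch N (snd y - slab_pos N j *\<^sub>R first_dir) \<bullet> first_dir = real N * (snd y \<bullet> first_dir) - real N * slab_pos N j"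
    by (simp add: inner_diff_left right_diff_distrib)
  ultimately show ?thesis using N_slab_pos[OF assms(1), of j] by linarith
qed

lemma slab_map_nonbase_unique:
  assumes "N \<ge> 1" "slab_map N i y \<noteq> sph_base" "slab_map N j y \<noteq> sph_base"
  shows "i = j"
proof -
  have "\<bar>real i - real j\<bar> < 1"
    using slab_map_nonbase[OF assms(1,2)] slab_map_nonbase[OF assms(1,3)] by linarith
  then show ?thesis by linarith
qed

text \<open>Outside the open cube one is outside every slab: directions other than the first are not
  stretched, and in the first direction each slab lies between -1/2 and 1/2.\<close>

lemma infnorm_stretch_slab:
  fixes v :: "'d::euclidean_space"
  assumes "N \<ge> 1" "j < N" "1 \<le> 2 * infnorm v"
  shows "1 \<le> 2 * infnorm (stretch N (v - slab_pos N j *\<^sub>R first_dir))"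
proof -
  obtain b where b: "b \<in> Basis" "infnorm v = \<bar>v \<bullet> b\<bar>" by (rule infnorm_attained)
  let ?w = "stretch N (v - slab_pos N j *\<^sub>R first_dir)"
  have le: "\<bar>?w \<bullet> b\<bar> \<le> infnorm ?w" by (rule Basis_le_infnorm[OF b(1)])
  show ?thesis
  proof (cases "b = first_dir")
    case False
    then have "?w \<bullet> b = v \<bullet> b"
      using b(1) by (simp add: stretch_other inner_diff_left inner_not_same_Basis first_dir_Basis)
    then show ?thesis using le b(2) assms(3) by linarith
  next
    case True
    have w: "?w \<bullet> b = real N * (v \<bullet> b) - (real j + 1/2 - real N / 2)"
      using N_slab_pos[OF assms(1), of j] True by (simp add: inner_diff_left right_diff_distrib)
    have "v \<bullet> b \<ge> 1/2 \<or> v \<bullet> b \<le> -1/2" using b(2) assms(3) by linarith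
    then have "real N * (v \<bullet> b) \<ge> real N * (1/2) \<or> real N * (v \<bullet> b) \<le> real N * (-1/2)"
      by (metis mult_left_mono of_nat_0_le_iff)
    moreover have "real j + 1 \<le> real N" using assms(2) by linarith
    ultimately have "\<bar>?w \<bullet> b\<bar> \<ge> 1/2" unfolding w by linarith
    then show ?thesis using le by linarith
  qed
qed

text \<open>The second component of \<open>cap u\<close> is a nonnegative multiple of u, hence not
  -w if u and w form an acute angle. For h <= 0 or w = 0 the first components already
  differ.\<close>

lemma cap_not_antipodal:
  fixes w u :: "'d::euclidean_space"
  assumes n: "norm (h, w) = 1" and uw: "u \<bullet> w > 0 \<or> w = 0 \<and> u = 0"
  shows "(if h > 0 then cap u else sph_base) \<noteq> - (h, w)"
proof
  assume eq: "(if h > 0 then cap u else sph_base) = - (h, w)"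
  show False
  proof (cases "h > 0")
    case False
    then have "- h = -1" using eq by (simp add: sph_base_def)
    then show False using False by simp
  next
    case True
    then have eq: "cap u = - (h, w)" using eq by simp
    show False
    proof (cases "w = 0")
      case True
      then have "u = 0" using uw by auto
      then show False using eq \<open>h > 0\<close> by simp
    next
      case False
      define s where "s = sin (pi * min 1 (2 * infnorm u))"
      have "s \<ge> 0" unfolding s_def
        by (intro sin_ge_zero) (auto simp: infnorm_pos_le intro: mult_left_le)
      have "snd (cap u) = - w" using eq by simp
      then have "s *\<^sub>R (u /\<^sub>R norm u) = - w" by (simp only: cap_def Let_def snd_conv s_def)
      then have "(s *\<^sub>R (u /\<^sub>R norm u)) \<bullet> w = - (w \<bullet> w)" by simp
      moreover have "(s *\<^sub>R (u /\<^sub>R norm u)) \<bullet> w = s * (inverse (norm u) * (u \<bullet> w))"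
        by (simp only: inner_scaleR_left)
      moreover have "s * (inverse (norm u) * (u \<bullet> w)) \<ge> 0" 
        using \<open>s \<ge> 0\<close> uw False by (intro mult_nonneg_nonneg) auto
      moreover have "w \<bullet> w > 0" using False by simp
      ultimately show False by linarith
    qed
  qed
qed

section \<open>Maps from the complement of the cone apexes\<close>

text \<open>At most one slab map differs from the base point at y, so the choice is unique where it
  matters. The default index 0 is harmless for maps \<open>gs\<close> with a common value at the
  base point.\<close>

definition slab_glue :: "nat \<Rightarrow> (nat \<Rightarrow> real \<times> 'd::euclidean_space \<Rightarrow> 'y) \<Rightarrow> real \<times> 'd \<Rightarrow> 'y" where
  "slab_glue N gs y = (let j = (if \<exists>j<N. slab_map N j y \<noteq> sph_base 
      then SOME j. j < N \<and> slab_map N j y \<noteq> sph_base else 0) in gs j (slab_map N j y))"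

text \<open>Serves two families: the inclusions of the spheres into the wedge, and the maps that the
  condition on beta provides.\<close>

locale based_sphere_maps =
  fixes N :: nat and gs :: "nat \<Rightarrow> real \<times> 'd::euclidean_space \<Rightarrow> 'y::real_normed_vector" and Z :: "'y set" and z0 :: 'y
  assumes N1: "N \<ge> 1"
    and gcont: "\<And>j. j < N \<Longrightarrow> continuous_on (sphere 0 1) (gs j)"
    and gZ: "\<And>j y. j < N \<Longrightarrow> norm y = 1 \<Longrightarrow> gs j y \<in> Z"
    and gbase: "\<And>j. j < N \<Longrightarrow> gs j sph_base = z0"
begin

lemma slab_glue_eq:
  assumes j: "j < N" and base: "\<And>i. i < N \<Longrightarrow> i \<noteq> j \<Longrightarrow> slab_map N i y = sph_base"
  shows "slab_glue N gs y = gs j (slab_map N j y)"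
proof (cases "slab_map N j y = sph_base")
  case True
  then have *: "\<not> (\<exists>j<N. slab_map N j y \<noteq> sph_base)" using base by blast
  then have "slab_map N 0 y = sph_base" using N1 by auto
  then show ?thesis using * True gbase[OF j] gbase[of 0] N1 
    unfolding slab_glue_def if_not_P[OF *] Let_def by simp
next
  case False
  then have ex: "\<exists>j<N. slab_map N j y \<noteq> sph_base" using j by blast
  have "(SOME j. j < N \<and> slab_map N j y \<noteq> sph_base) = j"
    by (rule some_equality) (use False j base in auto)
  then show ?thesis unfolding slab_glue_def if_P[OF ex] Let_def by simp
qed

lemma slab_glue_base:
  assumes "\<And>i. i < N \<Longrightarrow> slab_map N i y = sph_base"
  shows "slab_glue N gs y = z0"
  using slab_glue_eq[of 0 y] assms gbase[of 0] N1 by simp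

lemma slab_glue_ex:
  obtains j where "j < N" "\<And>i. i < N \<Longrightarrow> i \<noteq> j \<Longrightarrow> slab_map N i y = sph_base"
proof (cases "\<exists>j<N. slab_map N j y \<noteq> sph_base")
  case True
  then show ?thesis using that slab_map_nonbase_unique[OF N1] by metis
next
  case False
  then show ?thesis using that[of 0] N1 by auto
qed

lemma slab_glue_in: "slab_glue N gs y \<in> Z"
  by (metis slab_glue_ex slab_glue_eq gZ norm_slab_map)

lemma continuous_on_slab_glue:
  "continuous_on (- (\<lambda>j. (0, slab_pos N j *\<^sub>R first_dir)) ` {..<N}) (slab_glue N gs)" (is "continuous_on ?M _")
proof -
  have cs: "continuous_on ?M (slab_map N j)" if "j < N" for j
    using that by (intro continuous_on_slab_map N1) auto
  \<comment> \<open>Where all slab maps but the j-th rest at the base point, written as the zero set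
    of a continuous function to make closedness evident.\<close>
  define T where "T j = {y \<in> ?M. (\<Sum>i\<in>{..<N} - {j}. norm (slab_map N i y - sph_base)) = 0}" for j
  have T: "y \<in> T j \<longleftrightarrow> y \<in> ?M \<and> (\<forall>i<N. i \<noteq> j \<longrightarrow> slab_map N i y = sph_base)" for y j
    by (auto simp: T_def sum_nonneg_eq_0_iff)
  have "continuous_map (top_of_set ?M) euclidean (slab_glue N gs)"
  proof (rule pasting_lemma_closed[of "{..<N}" _ T _ "\<lambda>j y. gs j (slab_map N j y)"])
    show "closedin (top_of_set ?M) (T j)" if "j \<in> {..<N}" for j
      unfolding T_def by (intro continuous_closedin_preimage_constant continuous_intros cs) auto
    show "continuous_map (subtopology (top_of_set ?M) (T j)) euclidean (\<lambda>y. gs j (slab_map N j y))" 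
      if "j \<in> {..<N}" for j
    proof -
      have "continuous_on ?M (\<lambda>y. gs j (slab_map N j y))"
        by (rule continuous_on_compose2[OF gcont cs]) (use that in auto)
      then have "continuous_on (?M \<inter> T j) (\<lambda>y. gs j (slab_map N j y))"
        by (rule continuous_on_subset) auto
      then show ?thesis by (simp add: subtopology_subtopology)
    qed
    show "gs i (slab_map N i y) = gs j (slab_map N j y)" 
      if "i \<in> {..<N}" "j \<in> {..<N}" "y \<in> topspace (top_of_set ?M) \<inter> T i \<inter> T j" for i j y
      using that slab_glue_eq[of i y] slab_glue_eq[of j y] T by auto
    show "\<exists>j. j \<in> {..<N} \<and> y \<in> T j \<and> slab_glue N gs y = gs j (slab_map N j y)" 
      if "y \<in> topspace (top_of_set ?M)" for y
    proof -
      obtain j where j: "j < N" "\<And>i. i < N \<Longrightarrow> i \<noteq> j \<Longrightarrow> slab_map N i y = sph_base"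
        by (rule slab_glue_ex) blast
      then show ?thesis using slab_glue_eq[OF j] that T by (intro exI[of _ j]) auto
    qed
  qed simp
  then show ?thesis by simp
qed

text \<open>At height 1 the cones have reached full size and the N slabs fill the cube side by side,
  as in \<open>cube_sum\<close>.\<close>

lemma slab_glue_top:
  assumes x: "x \<in> cbox 0 One"
  shows "slab_glue N gs (1, x - (1/2) *\<^sub>R One) = cube_sum N (\<lambda>j. gs j \<circ> cube_to_sphere) x"
proof -
  define t where "t = x \<bullet> first_dir"
  \<comment> \<open>As in \<open>cube_sum\<close>, the minimum puts the far face t = 1 into the last
    slab.\<close>
  define j where "j = min (N - 1) (nat \<lfloor>real N * t\<rfloor>)"
  define v where "v = x - (1/2) *\<^sub>R One"
  define x' where "x' = x + (real N * t - real j - t) *\<^sub>R first_dir"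
  have t: "0 \<le> t" "t \<le> 1" using x first_dir_Basis by (auto simp: t_def mem_box)
  have jN: "j < N" using N1 by (simp add: j_def)
  have Nt: "0 \<le> real N * t" "real N * t \<le> real N" using t by (auto intro: mult_left_le)
  have jt: "real j \<le> real N * t" "real N * t \<le> real j + 1"
    using Nt N1 unfolding j_def by linarith+
  have "One \<bullet> b = 1" if "b \<in> Basis" for b :: 'd using that by simp
  then have One_fd: "One \<bullet> (first_dir::'d) = 1" using first_dir_Basis by blast
  have vt: "v \<bullet> first_dir = t - 1/2" by (simp add: v_def t_def inner_diff_left One_fd)
  have "x' - (1/2) *\<^sub>R One = v + (real N * t - real j - t) *\<^sub>R first_dir"
    by (simp add: x'_def v_def)
  also have "real N * t - real j - t = (real N - 1) * (v \<bullet> first_dir - slab_pos N j) - slab_pos N j"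
    using N_slab_pos[OF N1, of j] unfolding vt by (simp add: algebra_simps diff_divide_distrib)
  also have "v + \<dots> *\<^sub>R first_dir = stretch N (v - slab_pos N j *\<^sub>R first_dir)"
    by (simp add: stretch_def inner_diff_left algebra_simps)
  finally have xs: "x' - (1/2) *\<^sub>R One = stretch N (v - slab_pos N j *\<^sub>R first_dir)" .
  have "x' \<in> cbox 0 One"
    unfolding mem_box
  proof
    fix b :: 'd assume b: "b \<in> Basis"
    show "0 \<bullet> b \<le> x' \<bullet> b \<and> x' \<bullet> b \<le> One \<bullet> b"
    proof (cases "b = first_dir")
      case True
      then have "x' \<bullet> b = real N * t - real j" by (simp add: x'_def inner_add_left t_def)
      then show ?thesis using jt b by simp
    next
      case False
      then have "x' \<bullet> b = x \<bullet> b" using b by (simp add: x'_def inner_add_left inner_not_same_Basis first_dir_Basis)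
      then show ?thesis using x b by (simp add: mem_box)
    qed
  qed
  then have c: "cube_to_sphere x' = slab_map N j (1, v)"
    by (simp add: cube_to_sphere_eq_cap xs slab_map_def)
  have "slab_glue N gs (1, v) = gs j (slab_map N j (1, v))"
  proof (rule slab_glue_eq[OF jN], rule ccontr)
    fix i assume i: "i < N" "i \<noteq> j" "slab_map N i (1, v) \<noteq> sph_base"
    have "\<bar>real N * (t - 1/2) - (real i + 1/2 - real N / 2)\<bar> < 1/2"
      using slab_map_nonbase[OF N1 i(3)] by (simp add: vt)
    moreover have "real N * (t - 1/2) = real N * t - real N / 2" by (simp add: right_diff_distrib)
    ultimately have "real i < real N * t" "real N * t < real i + 1" by linarith+
    then have "nat \<lfloor>real N * t\<rfloor> = i" by linarith
    then show False using i by (simp add: j_def)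
  qed
  also have "\<dots> = cube_sum N (\<lambda>j. gs j \<circ> cube_to_sphere) x"
    unfolding cube_sum_def Let_def t_def[symmetric] j_def[symmetric] x'_def[symmetric] by (simp only: o_apply c)
  finally show ?thesis by (simp add: v_def)
qed

text \<open>The bound on \<open>\<epsilon>\<close> keeps the sphere within the j-th slab, so only
  the j-th slab map counts. On a point (h, w) with h > 0 it is the collapse of a positive multiple
  of \<open>stretch N w\<close>, which forms an acute angle with w; hence it is never antipodal to
  the identity.\<close>

lemma slab_glue_near:
  assumes j: "j < N" and \<epsilon>: "0 < \<epsilon>" "\<epsilon> * real N \<le> 1/2"
  shows "sphere_homotopic Z (\<lambda>x. slab_glue N gs ((0, slab_pos N j *\<^sub>R first_dir) + \<epsilon> *\<^sub>R x)) (gs j)"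
proof -
  let ?p = "(0, slab_pos N j *\<^sub>R first_dir) :: real \<times> 'd"
  have eq: "slab_glue N gs (?p + \<epsilon> *\<^sub>R x) = gs j (slab_map N j (?p + \<epsilon> *\<^sub>R x))" if "norm x = 1" for x
  proof (rule slab_glue_eq[OF j], rule ccontr)
    fix i assume i: "i < N" "i \<noteq> j" "slab_map N i (?p + \<epsilon> *\<^sub>R x) \<noteq> sph_base"
    have "\<bar>snd x \<bullet> first_dir\<bar> \<le> norm (snd x)" using Basis_le_norm[OF first_dir_Basis] .
    also have "\<dots> \<le> 1" using that norm_snd_le[of "snd x" "fst x"] by simp
    finally have "\<bar>\<epsilon> * real N * (snd x \<bullet> first_dir)\<bar> \<le> 1/2 * 1"
      unfolding abs_mult using \<epsilon> by (intro mult_mono) auto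
    moreover have "\<bar>real N * slab_pos N j + \<epsilon> * real N * (snd x \<bullet> first_dir) - (real i + 1/2 - real N / 2)\<bar> < 1/2"
      using slab_map_nonbase[OF N1 i(3)] by (simp add: inner_add_left algebra_simps)
    moreover have "\<bar>real i - real j\<bar> \<ge> 1" using i(2) by linarith
    ultimately show False using N_slab_pos[OF N1, of j] by linarith
  qed
  have cm: "continuous_on (sphere 0 1) (\<lambda>x. slab_map N j (?p + \<epsilon> *\<^sub>R x))"
    by (rule continuous_on_compose2[OF continuous_on_slab_map[of N j "- {?p}"]])
       (use N1 \<epsilon> in \<open>auto intro!: continuous_intros\<close>)
  have "sphere_homotopic (sphere 0 1) (\<lambda>x. slab_map N j (?p + \<epsilon> *\<^sub>R x)) (\<lambda>x. x)"
  proof (rule homotopic_spheremaps_nonantipodal[OF cm])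
    show "slab_map N j (?p + \<epsilon> *\<^sub>R x) \<noteq> - x" if "norm x = 1" for x
    proof -
      obtain h w where x: "x = (h, w)" by (cases x)
      have "slab_map N j (?p + \<epsilon> *\<^sub>R x) = (if h > 0 then cap ((inverse (min (\<epsilon> * h) 1) * \<epsilon>) *\<^sub>R stretch N w) else sph_base)"
        using \<epsilon> by (simp add: slab_map_def x stretch_scaleR zero_less_mult_iff)
      also have "\<dots> = (if h > 0 then cap (if h > 0 then (inverse (min (\<epsilon> * h) 1) * \<epsilon>) *\<^sub>R stretch N w else w) else sph_base)"
        by simp
      also have "\<dots> \<noteq> - (h, w)"
      proof (rule cap_not_antipodal)
        show "norm (h, w) = 1" using that x by simp
        show "0 < (if h > 0 then (inverse (min (\<epsilon> * h) 1) * \<epsilon>) *\<^sub>R stretch N w else w) \<bullet> w 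
            \<or> w = 0 \<and> (if h > 0 then (inverse (min (\<epsilon> * h) 1) * \<epsilon>) *\<^sub>R stretch N w else w) = 0"
          using stretch_inner_pos[OF N1, of w] \<epsilon> by (cases "w = 0") auto
      qed
      finally show ?thesis by (simp add: x)
    qed
  qed (auto simp: image_subset_iff)
  then have "sphere_homotopic Z (\<lambda>x. gs j (slab_map N j (?p + \<epsilon> *\<^sub>R x))) (\<lambda>x. gs j x)"
    by (rule sphere_homotopic_left[OF _ gcont[OF j]]) (use gZ[OF j] in auto)
  then show ?thesis by (rule sphere_homotopic_cong) (use eq in auto)
qed

text \<open>On a large sphere the glued map is G after the collapse \<open>\<psi>\<close> for a
  single slab, and \<open>\<psi>\<close> is never antipodal to the identity. The bound on R ensures
  that a point of the sphere whose horizontal part lies inside the cube has height above 1 or below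
  -1, where the glued map depends on the horizontal part alone or is constant.\<close>

lemma slab_glue_far:
  assumes R: "R > 1 + sqrt (real DIM('d))"
    and G: "continuous_on (sphere 0 1) G" "G ` sphere 0 1 \<subseteq> Z"
    and Gsum: "\<And>x. x \<in> cbox 0 One \<Longrightarrow> G (cube_to_sphere x) = cube_sum N (\<lambda>j. gs j \<circ> cube_to_sphere) x"
  shows "sphere_homotopic Z (\<lambda>x. slab_glue N gs (R *\<^sub>R x)) G"
proof -
  have R0: "R > 0" using R by (smt (verit) real_sqrt_ge_zero of_nat_0_le_iff)
  define \<psi> :: "real \<times> 'd \<Rightarrow> real \<times> 'd" where "\<psi> = slab_map 1 0"
  have sp: "slab_pos 1 0 = 0" by (simp add: slab_pos_def)
  have s1: "stretch 1 w = w" for w :: 'd by (simp add: stretch_def)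
  have \<psi>: "\<psi> y = (if fst y > 0 then cap (inverse (min (fst y) 1) *\<^sub>R snd y) else sph_base)" for y
    by (simp add: \<psi>_def slab_map_def sp s1 del: One_nat_def)
  have \<psi>b: "\<psi> y = sph_base" if "1 \<le> 2 * infnorm (snd y)" for y
    unfolding \<psi>_def by (rule slab_map_base) (use that in \<open>simp add: sp s1 del: One_nat_def\<close>)
  have Gcap: "G (cap v) = slab_glue N gs (1, v)" if "infnorm v \<le> 1/2" for v
  proof -
    have m: "v + (1/2) *\<^sub>R One \<in> cbox 0 One" unfolding mem_unit_cube_iff using that by simp
    have "G (cap v) = G (cube_to_sphere (v + (1/2) *\<^sub>R One))" by (simp add: cube_to_sphere_eq_cap[OF m])
    also have "\<dots> = slab_glue N gs (1, v + (1/2) *\<^sub>R One - (1/2) *\<^sub>R One)"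
      unfolding slab_glue_top[OF m] by (rule Gsum[OF m])
    finally show ?thesis by simp
  qed
  have high: "slab_glue N gs y = z0" if "1 \<le> 2 * infnorm (snd y)" for y
    by (rule slab_glue_base, rule slab_map_base) (use infnorm_stretch_slab[OF N1 _ that] in blast)
  have Gb: "G sph_base = z0"
  proof -
    obtain u where u: "infnorm u \<le> 1/2" "cap u = (sph_base :: real \<times> 'd)"
      using cap_surj[of "sph_base :: real \<times> 'd"] by (auto simp: sph_base_def)
    have "1 \<le> 2 * infnorm u"
    proof (rule ccontr)
      assume n: "\<not> ?thesis"
      have i: "infnorm (first_dir::'d) \<ge> 1" using Basis_le_infnorm[OF first_dir_Basis, of first_dir] by simp
      then have "cap (first_dir::'d) = sph_base" by (intro cap_eq_base) linarith
      then have "cap u = cap first_dir" using u(2) by simp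
      from cap_eqD[OF this] show False using n i by auto
    qed
    then show ?thesis using Gcap[OF u(1)] high[of "(1, u)"] u(2) by simp
  qed
  have eq: "slab_glue N gs (R *\<^sub>R x) = G (\<psi> (R *\<^sub>R x))" if "norm x = 1" for x
  proof (cases "1 \<le> 2 * infnorm (snd (R *\<^sub>R x))")
    case True
    then show ?thesis using high \<psi>b Gb by metis
  next
    case False
    obtain h v where y: "R *\<^sub>R x = (h, v)" by fastforce
    have v: "infnorm v < 1/2" using False y by (simp add: not_le)
    have "R = norm (h, v)" using that R0 y by (metis abs_of_pos mult.right_neutral norm_scaleR)
    also have "\<dots> \<le> \<bar>h\<bar> + norm v" using norm_Pair_le[of h v] by simp
    also have "norm v \<le> sqrt (real DIM('d)) * infnorm v" by (rule norm_le_infnorm)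
    also have "\<dots> \<le> sqrt (real DIM('d)) * 1" using v by (intro mult_left_mono) auto
    finally have "\<bar>h\<bar> > 1" using R by linarith
    show ?thesis
    proof (cases "h > 0")
      case True
      then have "h > 1" using \<open>\<bar>h\<bar> > 1\<close> by linarith
      then have "slab_map N j (h, v) = slab_map N j (1, v)" for j by (simp add: slab_map_def)
      then have "slab_glue N gs (h, v) = slab_glue N gs (1, v)" by (simp only: slab_glue_def)
      also have "\<dots> = G (cap v)" using Gcap[of v] v by simp
      also have "cap v = \<psi> (h, v)" using \<open>h > 1\<close> by (simp add: \<psi>)
      finally show ?thesis by (simp add: y)
    next
      case False
      then have "slab_glue N gs (h, v) = z0" by (intro slab_glue_base) (simp add: slab_map_def)
      moreover have "\<psi> (h, v) = sph_base" using False by (simp add: \<psi>)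
      ultimately show ?thesis by (simp add: y Gb)
    qed
  qed
  have cm: "continuous_on (sphere 0 1) (\<lambda>x. \<psi> (R *\<^sub>R x))"
    unfolding \<psi>_def
  proof (rule continuous_on_compose2[OF continuous_on_slab_map])
    show "(0, slab_pos 1 0 *\<^sub>R first_dir) \<notin> - {0 :: real \<times> 'd}"
      unfolding sp by (simp add: zero_prod_def)
    have "norm (R *\<^sub>R x) = R" if "x \<in> sphere 0 1" for x :: "real \<times> 'd"
      using that R0 by (simp del: scaleR_Pair)
    then show "(\<lambda>x. R *\<^sub>R x) ` sphere 0 1 \<subseteq> - {0 :: real \<times> 'd}"
      using R0 by (metis ComplI image_subsetI norm_zero order_less_irrefl singletonD)
  qed (auto intro!: continuous_intros)
  have "sphere_homotopic (sphere 0 1) (\<lambda>x. \<psi> (R *\<^sub>R x)) (\<lambda>x. x)"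
  proof (rule homotopic_spheremaps_nonantipodal[OF cm])
    show "\<psi> (R *\<^sub>R x) \<noteq> - x" if "norm x = 1" for x
    proof -
      obtain h w where x: "x = (h, w)" by (cases x)
      have "\<psi> (R *\<^sub>R x) = (if h > 0 then cap (if h > 0 then (inverse (min (R * h) 1) * R) *\<^sub>R w else w) else sph_base)"
        using R0 by (simp add: \<psi> x zero_less_mult_iff)
      also have "\<dots> \<noteq> - (h, w)"
      proof (rule cap_not_antipodal)
        show "norm (h, w) = 1" using that x by simp
        show "0 < (if h > 0 then (inverse (min (R * h) 1) * R) *\<^sub>R w else w) \<bullet> w 
            \<or> w = 0 \<and> (if h > 0 then (inverse (min (R * h) 1) * R) *\<^sub>R w else w) = 0"
          using R0 by (cases "w = 0") auto
      qed
      finally show ?thesis by (simp add: x)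
    qed
  qed (auto simp: \<psi>_def image_subset_iff)
  then have "sphere_homotopic Z (\<lambda>x. G (\<psi> (R *\<^sub>R x))) (\<lambda>x. G x)"
    by (rule sphere_homotopic_left[OF _ G])
  then show ?thesis by (rule sphere_homotopic_cong) (use eq in auto)
qed

end

section \<open>The wedge of spheres and the punctured space\<close>

definition shrink :: "nat \<Rightarrow> 'd::euclidean_space \<Rightarrow> 'd" where
  "shrink N v = v + ((1 / real N - 1) * (v \<bullet> first_dir)) *\<^sub>R first_dir"

text \<open>The ray from the origin to the middle of slab j at height 1 is punctured half
  way.\<close>

definition wedge_point :: "nat \<Rightarrow> nat \<Rightarrow> real \<times> 'd::euclidean_space" where
  "wedge_point N j = (1/2, (slab_pos N j / 2) *\<^sub>R first_dir)"

lemma shrink_stretch: "N \<ge> 1 \<Longrightarrow> shrink N (stretch N v) = v"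
proof -
  assume "N \<ge> 1"
  have "shrink N (stretch N v) = v + ((real N - 1) * (v \<bullet> first_dir) + (1 / real N - 1) * (real N * (v \<bullet> first_dir))) *\<^sub>R first_dir"
    unfolding shrink_def stretch_first_dir by (simp add: stretch_def scaleR_left_distrib)
  also have "(real N - 1) * (v \<bullet> first_dir) + (1 / real N - 1) * (real N * (v \<bullet> first_dir)) = 0"
    using \<open>N \<ge> 1\<close> by (simp add: field_simps)
  finally show ?thesis by simp
qed

lemma stretch_shrink: "N \<ge> 1 \<Longrightarrow> stretch N (shrink N v) = v"
proof -
  assume "N \<ge> 1"
  have "shrink N v \<bullet> first_dir = (v \<bullet> first_dir) / real N"
    by (simp add: shrink_def inner_add_left algebra_simps)
  then have "stretch N (shrink N v) = v + ((1 / real N - 1) * (v \<bullet> first_dir) + (real N - 1) * ((v \<bullet> first_dir) / real N)) *\<^sub>R first_dir"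
    unfolding stretch_def by (simp add: shrink_def scaleR_left_distrib)
  also have "(1 / real N - 1) * (v \<bullet> first_dir) + (real N - 1) * ((v \<bullet> first_dir) / real N) = 0"
    using \<open>N \<ge> 1\<close> by (simp add: field_simps)
  finally show ?thesis by simp
qed

lemma shrink_first_dir: "shrink N v \<bullet> first_dir = (v \<bullet> first_dir) / real N"
  by (simp add: shrink_def inner_add_left algebra_simps)

lemma shrink_inner_pos:
  assumes "N \<ge> 1" "v \<noteq> 0"
  shows "shrink N v \<bullet> v > 0"
proof -
  have "shrink N v \<noteq> 0" using assms stretch_shrink[of N v] by auto
  from stretch_inner_pos[OF assms(1) this] show ?thesis
    by (simp add: stretch_shrink[OF assms(1)] inner_commute)
qed

lemma abs_slab_pos_le:
  assumes "j < N"
  shows "\<bar>slab_pos N j\<bar> \<le> 1/2 - 1 / (2 * real N)"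
proof -
  have N: "real N > 0" using assms by simp
  have "real j + 1 \<le> real N" using assms by linarith
  then have "\<bar>2 * real j + 1 - real N\<bar> \<le> real N - 1" by linarith
  then have "\<bar>2 * real j + 1 - real N\<bar> / (2 * real N) \<le> (real N - 1) / (2 * real N)"
    using N by (intro divide_right_mono) auto
  moreover have "slab_pos N j = (2 * real j + 1 - real N) / (2 * real N)" 
    using N by (simp add: slab_pos_def field_simps)
  moreover have "(real N - 1) / (2 * real N) = 1/2 - 1 / (2 * real N)" using N by (simp add: field_simps)
  ultimately show ?thesis using N by (simp add: abs_divide)
qed

lemma slab_pos_diff: "N \<ge> 1 \<Longrightarrow> slab_pos N i - slab_pos N j = (real i - real j) / real N"
  by (simp add: slab_pos_def field_simps)

lemma infnorm_first_dir [simp]: "infnorm (first_dir :: 'd::euclidean_space) = 1"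
proof (rule antisym)
  show "infnorm (first_dir :: 'd) \<le> 1" using infnorm_le_norm[of "first_dir :: 'd"] by simp
  show "1 \<le> infnorm (first_dir :: 'd)" using Basis_le_infnorm[OF first_dir_Basis, of first_dir] by simp
qed

text \<open>A point of slab j at height 1, moved along its ray towards the origin: the middle stays
  where it is, the boundary of the slab goes to 0. For u in the cube this is a closed teardrop with
  tip 0 around \<open>wedge_point N j\<close>, the image of the j-th sphere of the wedge.\<close>

definition wedge_sheet :: "nat \<Rightarrow> nat \<Rightarrow> 'd::euclidean_space \<Rightarrow> real \<times> 'd" where
  "wedge_sheet N j u = (1 - 2 * infnorm u) *\<^sub>R (1, slab_pos N j *\<^sub>R first_dir + shrink N u)"

text \<open>A puncture lies on the ray through the middle of slab i. There u is (i - j) times the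
  first direction, so the factor 1 - 2 |u| (in the sup norm) is 1 or negative, never 1/2.\<close>

lemma wedge_sheet_ne:
  assumes "N \<ge> 1"
  shows "wedge_sheet N j u \<noteq> wedge_point N i"
proof
  assume eq: "wedge_sheet N j u = wedge_point N i"
  have 1: "1 - 2 * infnorm u = 1/2" using arg_cong[OF eq, of fst] by (simp only: wedge_sheet_def wedge_point_def fst_scaleR fst_conv) simp
  have "(1 - 2 * infnorm u) *\<^sub>R (slab_pos N j *\<^sub>R first_dir + shrink N u) = (slab_pos N i / 2) *\<^sub>R first_dir"
    using arg_cong[OF eq, of snd] by (simp only: wedge_sheet_def wedge_point_def snd_scaleR snd_conv)
  then have "2 *\<^sub>R ((1/2::real) *\<^sub>R (slab_pos N j *\<^sub>R first_dir + shrink N u)) = 2 *\<^sub>R ((slab_pos N i / 2) *\<^sub>R first_dir)"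
    unfolding 1 by (rule arg_cong)
  then have "slab_pos N j *\<^sub>R first_dir + shrink N u = slab_pos N i *\<^sub>R first_dir" by simp
  then have "shrink N u = (slab_pos N i - slab_pos N j) *\<^sub>R first_dir"
    by (simp add: algebra_simps)
  then have "u = (slab_pos N i - slab_pos N j) *\<^sub>R stretch N first_dir"
    using stretch_shrink[OF assms, of u] by (simp add: stretch_scaleR)
  also have "stretch N (first_dir::'a) = real N *\<^sub>R first_dir"
    by (simp add: stretch_def algebra_simps)
  finally have "u = (real i - real j) *\<^sub>R first_dir"
    using assms by (simp add: slab_pos_diff)
  then have "infnorm u = \<bar>real i - real j\<bar>" by (simp add: infnorm_mul)
  show False
  proof (cases "i = j")
    case True
    then have "infnorm u = 0" using \<open>infnorm u = \<bar>real i - real j\<bar>\<close> by simp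
    then show False using 1 by simp
  next
    case False
    then have "\<bar>real i - real j\<bar> \<ge> 1" by linarith
    then have "infnorm u \<ge> 1" using \<open>infnorm u = \<bar>real i - real j\<bar>\<close> by simp
    then show False using 1 by simp
  qed
qed

text \<open>Points z of the l-th sphere satisfy |z|^2 = 2 (l + 1) \<open>fst z\<close>; two
  different radii force \<open>fst z\<close> = 0 and then z = 0.\<close>

lemma wedge_incl_overlap:
  fixes x y :: "real \<times> 'd::euclidean_space"
  assumes "norm x = 1" "norm y = 1" "i \<noteq> j" "wedge_incl i x = wedge_incl j y"
  shows "x = sph_base" "y = sph_base"
proof -
  define z where "z = wedge_incl i x"
  have n: "norm z ^ 2 = 2 * real (Suc l) * fst z" if "z = wedge_incl l w" "norm w = 1" for l and w :: "real \<times> 'd"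
  proof -
    obtain a v where w: "w = (a, v)" by (cases w)
    have av: "a\<^sup>2 + (norm v)\<^sup>2 = 1" using that(2) by (simp add: w norm_Pair)
    define c where "c = real (Suc l)"
    have z: "z = (c * (a + 1), c *\<^sub>R v)" using that(1) by (simp add: w wedge_incl_def sph_base_def c_def)
    have "norm z ^ 2 = (c * (a + 1))\<^sup>2 + (c * norm v)\<^sup>2"
      by (simp add: z norm_Pair power_mult_distrib)
    also have "\<dots> = c\<^sup>2 * ((a + 1)\<^sup>2 + (norm v)\<^sup>2)"
      unfolding power_mult_distrib by (simp only: distrib_left)
    also have "\<dots> = c\<^sup>2 * (2 * (a + 1))" 
    proof -
      have "(a + 1)\<^sup>2 + (norm v)\<^sup>2 = 2 * (a + 1)" using av by (simp add: power2_sum)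
      then show ?thesis by simp
    qed
    also have "c\<^sup>2 * (2 * (a + 1)) = 2 * c * fst z" by (simp add: z power2_eq_square)
    finally show ?thesis unfolding c_def .
  qed
  have "2 * real (Suc i) * fst z = 2 * real (Suc j) * fst z"
    using n[of i x] n[of j y] assms by (simp add: z_def)
  then have "fst z = 0" using assms(3) by simp
  then have "norm z ^ 2 = 0" using n[of i x] assms(1) by (simp add: z_def)
  then have "z = 0" by simp
  then show "x = sph_base" "y = sph_base" using assms(4) by (simp_all add: z_def wedge_incl_def)
qed

lemma continuous_on_wedge_incl: "continuous_on A (wedge_incl j)"
  unfolding wedge_incl_def by (intro continuous_intros)

lemma wedge_incl_base [simp]: "wedge_incl j sph_base = 0"
  by (simp add: wedge_incl_def)

lemma wedge_incl_based:
  "N \<ge> 1 \<Longrightarrow> based_sphere_maps N (wedge_incl :: nat \<Rightarrow> real \<times> 'd::euclidean_space \<Rightarrow> _) (wedge_spheres N) 0"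
proof unfold_locales
  fix j and y :: "real \<times> 'd" assume "j < N" "norm y = 1"
  then have "wedge_incl j y \<in> wedge_incl j ` sphere 0 1" by (intro imageI) simp
  then show "wedge_incl j y \<in> wedge_spheres N" using \<open>j < N\<close> unfolding wedge_spheres_def by blast
qed (auto simp: continuous_on_wedge_incl)

text \<open>Each sheet is 0 on the boundary of the cube, so it descends to the j-th sphere. The
  descended maps agree at the base point, which is all that two spheres share, and therefore
  paste.\<close>

lemma wedge_map:
  assumes N: "N \<ge> 1"
  shows "\<exists>W :: real \<times> 'd::euclidean_space \<Rightarrow> real \<times> 'd. continuous_on (wedge_spheres N) W
    \<and> (\<forall>j u. j < N \<longrightarrow> infnorm u \<le> 1/2 \<longrightarrow> W (wedge_incl j (cap u)) = wedge_sheet N j u) \<and> W 0 = 0"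
proof -
  have "\<exists>V. continuous_on (sphere 0 1) V \<and> (\<forall>u::'d. infnorm u \<le> 1/2 \<longrightarrow> V (cap u) = wedge_sheet N j u)" 
    for j
  proof -
    have c: "continuous_on {u::'d. infnorm u \<le> 1/2} (wedge_sheet N j)"
      unfolding wedge_sheet_def shrink_def by (intro continuous_intros)
    have b: "wedge_sheet N j u = 0" if "infnorm u = 1/2" for u :: 'd
      unfolding wedge_sheet_def that by (simp add: zero_prod_def)
    show ?thesis by (rule factor_through_cap[OF c b])
  qed
  then obtain V :: "nat \<Rightarrow> real \<times> 'd \<Rightarrow> real \<times> 'd" where V: "\<And>j. continuous_on (sphere 0 1) (V j)"
    "\<And>j u. infnorm u \<le> 1/2 \<Longrightarrow> V j (cap u) = wedge_sheet N j u" by metis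
  have ib: "infnorm ((1/2) *\<^sub>R first_dir :: 'd) = 1/2" unfolding infnorm_mul by simp
  have "cap ((1/2) *\<^sub>R first_dir :: 'd) = sph_base" by (rule cap_eq_base) (simp only: ib order_refl)
  then have Vb: "V j sph_base = 0" for j
    using V(2)[of "(1/2) *\<^sub>R first_dir" j] ib by (simp add: wedge_sheet_def zero_prod_def)
  define T :: "nat \<Rightarrow> (real \<times> 'd) set" where "T j = wedge_incl j ` sphere 0 1" for j
  define f where "f j z = V j ((1 / real (Suc j)) *\<^sub>R z + sph_base)" for j z
  have fV: "f j (wedge_incl j y) = V j y" for j y by (simp add: f_def wedge_incl_def)
  have WT: "topspace (top_of_set (wedge_spheres N)) \<subseteq> \<Union> (T ` {..<N})" by (auto simp: wedge_spheres_def T_def)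
  have clo: "closedin (top_of_set (wedge_spheres N)) (T j)" if "j \<in> {..<N}" for j
  proof (rule closed_subset)
    show "T j \<subseteq> wedge_spheres N" using that by (auto simp: wedge_spheres_def T_def)
    show "closed (T j)" unfolding T_def 
      by (intro compact_imp_closed compact_continuous_image continuous_on_wedge_incl compact_sphere)
  qed
  have cont: "continuous_map (subtopology (top_of_set (wedge_spheres N)) (T j)) euclidean (f j)" if "j \<in> {..<N}" for j
  proof -
    have "continuous_on (T j) (f j)" unfolding f_def
    proof (rule continuous_on_compose2[OF V(1)])
      show "(\<lambda>z. (1 / real (Suc j)) *\<^sub>R z + sph_base) ` T j \<subseteq> sphere 0 1"
        by (auto simp: T_def wedge_incl_def)
    qed (intro continuous_intros)
    then have "continuous_on (wedge_spheres N \<inter> T j) (f j)" by (rule continuous_on_subset) auto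
    then show ?thesis by (simp add: subtopology_subtopology)
  qed
  have agree: "f i z = f j z" if "i \<in> {..<N}" "j \<in> {..<N}" "z \<in> topspace (top_of_set (wedge_spheres N)) \<inter> T i \<inter> T j" for i j z
  proof (cases "i = j")
    case False
    have "z \<in> T i" "z \<in> T j" using that(3) by auto
    then obtain x y where xy: "norm x = 1" "norm y = 1" "z = wedge_incl i x" "z = wedge_incl j y"
      unfolding T_def by auto
    then have "wedge_incl i x = wedge_incl j y" by simp
    note b = wedge_incl_overlap[OF xy(1,2) False this]
    have "f i z = V i x" unfolding xy(3) by (rule fV)
    moreover have "f j z = V j y" unfolding xy(4) by (rule fV)
    ultimately show ?thesis unfolding b Vb by simp
  qed simp
  have "\<exists>W. continuous_map (top_of_set (wedge_spheres N)) euclidean W \<and>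
     (\<forall>i z. i \<in> {..<N} \<longrightarrow> z \<in> topspace (top_of_set (wedge_spheres N)) \<inter> T i \<longrightarrow> W z = f i z)"
    by (rule pasting_lemma_exists_closed[OF finite_lessThan[of N] WT clo cont agree]) blast+
  then obtain W where W: "continuous_map (top_of_set (wedge_spheres N)) euclidean W"
     "\<And>z i. i \<in> {..<N} \<Longrightarrow> z \<in> topspace (top_of_set (wedge_spheres N)) \<inter> T i \<Longrightarrow> W z = f i z" by blast
  have WV: "W (wedge_incl j y) = V j y" if "j < N" "norm y = 1" for j y
  proof -
    have "wedge_incl j y \<in> T j" unfolding T_def using that by (intro imageI) simp
    moreover have "wedge_incl j y \<in> wedge_spheres N" by (rule based_sphere_maps.gZ[OF wedge_incl_based[OF N] that])
    ultimately show ?thesis using W(2)[of j "wedge_incl j y"] that(1) by (simp add: fV)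
  qed
  show ?thesis
  proof (intro exI[of _ W] conjI allI impI)
    show "continuous_on (wedge_spheres N) W" using W(1) by simp
    show "W (wedge_incl j (cap u)) = wedge_sheet N j u" if "j < N" "infnorm u \<le> 1/2" for j u
      using WV[OF that(1), of "cap u"] V(2)[OF that(2)] by simp
    have "W (wedge_incl 0 sph_base) = V 0 sph_base" 
      by (rule WV) (use N in \<open>auto simp: sph_base_def\<close>)
    then show "W 0 = 0" unfolding Vb wedge_incl_base .
  qed
qed

abbreviation wedge_points :: "nat \<Rightarrow> (real \<times> 'd::euclidean_space) set" where
  "wedge_points N \<equiv> wedge_point N ` {..<N}"

text \<open>For i different from j the two coordinates yield an equation between (i - j)/2 and a
  convex combination of terms of size at most 3/8. For i = j the first coordinate forces t = 1/2,
  where the cosine vanishes; the inner product with u is then a sum of nonnegative terms that cannot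
  both be 0.\<close>

lemma wedge_sheet_near_ne:
  fixes u :: "'d::euclidean_space"
  assumes N: "N \<ge> 1" and j: "j < N" "i < N" and \<epsilon>: "0 < \<epsilon>" "\<epsilon> * real N \<le> 1/4"
    and u: "infnorm u \<le> 1/2" and s: "0 \<le> s" "s \<le> 1"
  shows "(1 - s) *\<^sub>R wedge_sheet N j u + s *\<^sub>R (wedge_point N j + \<epsilon> *\<^sub>R cap u) \<noteq> wedge_point N i"
proof
  define t where "t = 2 * infnorm u"
  have t: "0 \<le> t" "t \<le> 1" using u by (auto simp: t_def infnorm_pos_le)
  define c where "c = cos (pi * t)"
  define \<sigma> where "\<sigma> = sin (pi * t) *\<^sub>R (u /\<^sub>R norm u)"
  have capu: "cap u = (c, \<sigma>)" using t(2) unfolding cap_def Let_def c_def \<sigma>_def t_def by simp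
  assume eq: "(1 - s) *\<^sub>R wedge_sheet N j u + s *\<^sub>R (wedge_point N j + \<epsilon> *\<^sub>R cap u) = wedge_point N i"
  have e1: "(1 - s) * (1 - t) + s * (1/2 + \<epsilon> * c) = 1/2"
    using arg_cong[OF eq, of fst] unfolding wedge_sheet_def wedge_point_def capu t_def by simp
  have e2: "(1 - s) *\<^sub>R ((1 - t) *\<^sub>R (slab_pos N j *\<^sub>R first_dir + shrink N u)) + s *\<^sub>R ((slab_pos N j / 2) *\<^sub>R first_dir + \<epsilon> *\<^sub>R \<sigma>)
     = (slab_pos N i / 2) *\<^sub>R first_dir"
    using arg_cong[OF eq, of snd] unfolding wedge_sheet_def wedge_point_def capu t_def by simp
  define P where "P = slab_pos N j"
  have c1: "\<bar>c\<bar> \<le> 1" by (simp add: c_def)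
  have "norm (cap u) = 1" by simp
  then have "norm \<sigma> \<le> 1" using norm_snd_le[of \<sigma> c] by (simp add: capu)
  then have \<sigma>1: "\<bar>\<sigma> \<bullet> first_dir\<bar> \<le> 1" using Basis_le_norm[OF first_dir_Basis, of \<sigma>] by linarith
  show False
  proof (cases "i = j")
    case False
    have N0: "real N > 0" using N by simp
    have e3: "(1 - s) * ((1 - t) * (P + (u \<bullet> first_dir) / real N)) + s * (P / 2 + \<epsilon> * (\<sigma> \<bullet> first_dir)) = slab_pos N i / 2"
      using arg_cong[OF e2, of "\<lambda>w. w \<bullet> first_dir"] by (simp add: inner_add_left shrink_first_dir P_def)
    \<comment> \<open>Subtracting P times the first coordinate removes the position of slab j from
      the right-hand side, up to the small term in c.\<close>
    have "(slab_pos N i - P) / 2 = (1 - s) * ((1 - t) * ((u \<bullet> first_dir) / real N)) + s * (\<epsilon> * ((\<sigma> \<bullet> first_dir) - P * c))"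
    proof -
      have "(slab_pos N i - P) / 2 = slab_pos N i / 2 - P * (1/2)" by (simp add: diff_divide_distrib)
      also have "\<dots> = ((1 - s) * ((1 - t) * (P + (u \<bullet> first_dir) / real N)) + s * (P / 2 + \<epsilon> * (\<sigma> \<bullet> first_dir)))
         - P * ((1 - s) * (1 - t) + s * (1/2 + \<epsilon> * c))" unfolding e3 e1 ..
      finally show ?thesis by (simp add: algebra_simps)
    qed
    then have "(real i - real j) / 2 = real N * ((1 - s) * ((1 - t) * ((u \<bullet> first_dir) / real N)) + s * (\<epsilon> * ((\<sigma> \<bullet> first_dir) - P * c)))"
      using slab_pos_diff[OF N, of i j] N0 unfolding P_def by (metis (no_types, opaque_lifting) nonzero_mult_div_cancel_left
         order_less_irrefl times_divide_eq_right)
    also have "\<dots> = (1 - s) * ((1 - t) * (u \<bullet> first_dir)) + s * ((\<epsilon> * real N) * ((\<sigma> \<bullet> first_dir) - P * c))"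
    proof -
      have "real N * ((1 - s) * ((1 - t) * ((u \<bullet> first_dir) / real N))) = (1 - s) * ((1 - t) * (u \<bullet> first_dir))"
        using N0 by simp
      moreover have "real N * (s * (\<epsilon> * ((\<sigma> \<bullet> first_dir) - P * c))) = s * ((\<epsilon> * real N) * ((\<sigma> \<bullet> first_dir) - P * c))"
        by simp
      ultimately show ?thesis by (simp only: distrib_left)
    qed
    finally have e4: "(real i - real j) / 2 = (1 - s) * ((1 - t) * (u \<bullet> first_dir)) + s * ((\<epsilon> * real N) * ((\<sigma> \<bullet> first_dir) - P * c))" .
    have "\<bar>u \<bullet> first_dir\<bar> \<le> t / 2" using Basis_le_infnorm[OF first_dir_Basis, of u] by (simp add: t_def)
    then have "\<bar>(1 - t) * (u \<bullet> first_dir)\<bar> \<le> (1 - t) * (t / 2)"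
      unfolding abs_mult using t by (intro mult_mono) auto
    also have "\<dots> \<le> 3/8" using sum_squares_ge_zero[of "t - 1/2" 0] by (simp add: power2_eq_square algebra_simps)
    finally have a1: "\<bar>(1 - t) * (u \<bullet> first_dir)\<bar> \<le> 3/8" .
    have "0 < 1 / (2 * real N)" using N0 by simp
    then have "\<bar>P\<bar> \<le> 1/2" using abs_slab_pos_le[OF j(1)] unfolding P_def by linarith
    then have "\<bar>P * c\<bar> \<le> 1/2 * 1" unfolding abs_mult using c1 by (intro mult_mono) auto
    then have "\<bar>(\<sigma> \<bullet> first_dir) - P * c\<bar> \<le> 3/2" using \<sigma>1 by linarith
    then have "\<bar>(\<epsilon> * real N) * ((\<sigma> \<bullet> first_dir) - P * c)\<bar> \<le> 1/4 * (3/2)"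
      unfolding abs_mult[of "\<epsilon> * real N"] using \<epsilon> by (intro mult_mono) auto
    then have a2: "\<bar>(\<epsilon> * real N) * ((\<sigma> \<bullet> first_dir) - P * c)\<bar> \<le> 3/8" by simp
    have "\<bar>(1 - s) * ((1 - t) * (u \<bullet> first_dir))\<bar> \<le> (1 - s) * (3/8)"
      unfolding abs_mult[of "1 - s"] using s a1 by (intro mult_mono) auto
    moreover have "\<bar>s * ((\<epsilon> * real N) * ((\<sigma> \<bullet> first_dir) - P * c))\<bar> \<le> s * (3/8)"
      unfolding abs_mult[of s] using s a2 by (intro mult_mono) auto
    moreover have "\<bar>X + Y\<bar> \<le> 3/8" if "\<bar>X\<bar> \<le> (1 - s) * (3/8)" "\<bar>Y\<bar> \<le> s * (3/8)" for X Y
      using that abs_triangle_ineq[of X Y] by (simp add: left_diff_distrib)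
    ultimately have "\<bar>(real i - real j) / 2\<bar> \<le> 3/8" unfolding e4 by blast
    then have "\<bar>real i - real j\<bar> / 2 \<le> 3/8" by (simp only: abs_divide abs_numeral)
    moreover have "\<bar>real i - real j\<bar> \<ge> 1" using False by linarith
    ultimately show False by simp
  next
    case True
    have e1': "(1 - s) * (1/2 - t) + s * \<epsilon> * c = 0" using e1 by (simp add: field_simps)
    \<comment> \<open>The cosine has the sign of 1/2 - t, so the two summands of \<open>e1'\<close>
      cannot cancel unless both vanish.\<close>
    have sg: "c > 0 \<longleftrightarrow> t < 1/2" "c < 0 \<longleftrightarrow> t > 1/2"
    proof -
      have "t < 1/2 \<Longrightarrow> c > 0" unfolding c_def using t by (intro cos_gt_zero_pi) (auto simp: field_simps intro: less_le_trans[of _ 0])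
      moreover have "t > 1/2 \<Longrightarrow> c < 0"
      proof -
        assume "t > 1/2"
        then have "cos (pi * t) < cos (pi / 2)" using t by (intro cos_monotone_0_pi) (auto intro: mult_left_le)
        then show "c < 0" by (simp add: c_def)
      qed
      moreover have "t = 1/2 \<Longrightarrow> c = 0"
      proof -
        assume "t = 1/2"
        then have "pi * t = pi / 2" by simp
        then show "c = 0" by (simp only: c_def cos_pi_half)
      qed
      ultimately show "c > 0 \<longleftrightarrow> t < 1/2" "c < 0 \<longleftrightarrow> t > 1/2" by linarith+
    qed
    have "t = 1/2"
    proof (rule ccontr)
      assume "t \<noteq> 1/2"
      then consider "t < 1/2" "c > 0" | "t > 1/2" "c < 0" using sg by linarith
      then show False
      proof cases
        case 1
        have "(1 - s) * (1/2 - t) \<ge> 0" "s * \<epsilon> * c \<ge> 0" using 1 s \<epsilon> by auto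
        then have "(1 - s) * (1/2 - t) = 0" "s * \<epsilon> * c = 0" using e1' by linarith+
        then show False using 1 \<epsilon> by auto
      next
        case 2
        have "(1 - s) * (1/2 - t) \<le> 0" "s * \<epsilon> * c \<le> 0" using 2 s \<epsilon> by (auto simp: mult_le_0_iff)
        then have "(1 - s) * (1/2 - t) = 0" "s * \<epsilon> * c = 0" using e1' by linarith+
        then show False using 2 \<epsilon> by auto
      qed
    qed
    then have c0: "c = 0" using sg by linarith
    have "u \<noteq> 0" using \<open>t = 1/2\<close> by (auto simp: t_def infnorm_0)
    have \<sigma>: "\<sigma> = inverse (norm u) *\<^sub>R u" 
    proof -
      have "pi * t = pi / 2" using \<open>t = 1/2\<close> by simp
      then show ?thesis by (simp only: \<sigma>_def sin_pi_half scaleR_one)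
    qed
    have "(1 - s) * ((1 - t) * (P * (first_dir \<bullet> u) + shrink N u \<bullet> u)) 
        + s * ((P / 2) * (first_dir \<bullet> u) + \<epsilon> * (\<sigma> \<bullet> u)) = (P / 2) * (first_dir \<bullet> u)"
      using arg_cong[OF e2, of "\<lambda>w. w \<bullet> u"] unfolding True P_def inner_add_left inner_scaleR_left .
    have "\<sigma> \<bullet> u = inverse (norm u) * (u \<bullet> u)" unfolding \<sigma> by simp
    have "(1 - s) * ((1 - 1/2) * (P * Q + A)) + s * ((P / 2) * Q + \<epsilon> * B) = (P / 2) * Q \<Longrightarrow>
        (1 - s) / 2 * A + (s * \<epsilon>) * B = 0" for Q A B
      by (simp add: field_simps)
    then have z: "(1 - s) / 2 * (shrink N u \<bullet> u) + (s * \<epsilon>) * (inverse (norm u) * (u \<bullet> u)) = 0"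
      using \<open>(1 - s) * ((1 - t) * (P * (first_dir \<bullet> u) + shrink N u \<bullet> u)) 
        + s * ((P / 2) * (first_dir \<bullet> u) + \<epsilon> * (\<sigma> \<bullet> u)) = (P / 2) * (first_dir \<bullet> u)\<close>
      unfolding \<open>t = 1/2\<close> \<open>\<sigma> \<bullet> u = inverse (norm u) * (u \<bullet> u)\<close> by blast
    have p: "shrink N u \<bullet> u > 0" "inverse (norm u) * (u \<bullet> u) > 0"
      using shrink_inner_pos[OF N \<open>u \<noteq> 0\<close>] \<open>u \<noteq> 0\<close> by auto
    show False
    proof (cases "s = 1")
      case True
      then show False using z p(2) \<epsilon> by simp
    next
      case False
      then have "(1 - s) / 2 * (shrink N u \<bullet> u) > 0" using s p by auto
      moreover have "(s * \<epsilon>) * (inverse (norm u) * (u \<bullet> u)) \<ge> 0" using s \<epsilon> p(2) by (intro mult_nonneg_nonneg) auto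
      ultimately show False using z by linarith
    qed
  qed
qed

lemma cap_inner_simps:
  assumes "infnorm u \<le> 1/2"
  shows "fst (cap u) = cos (pi * (2 * infnorm u))" "snd (cap u) = (sin (pi * (2 * infnorm u)) * inverse (norm u)) *\<^sub>R u"
proof -
  have "min 1 (2 * infnorm u) = 2 * infnorm u" using assms by linarith
  then show "fst (cap u) = cos (pi * (2 * infnorm u))" "snd (cap u) = (sin (pi * (2 * infnorm u)) * inverse (norm u)) *\<^sub>R u"
    by (simp_all only: cap_def Let_def fst_conv snd_conv scaleR_scaleR)
qed

lemma inverse_in_unit_interval:
  assumes "0 \<le> t" "t \<le> (1::real)"
  shows "0 \<le> pi * t" "pi * t \<le> pi"
  using assms by (auto intro: mult_left_le)

text \<open>B and the auxiliary map C, with factor K (1 + cos(2 pi |v|)) for the sup norm, send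
  \<open>cap v\<close> to the same ray, so the straight homotopy between them moves along rays. A
  puncture can be met only on the ray of a slab middle, where both factors are at least 1 while the
  puncture sits at 1/2. C and the round sphere K (y - base) share their first coordinate; where it
  is 1/2, the horizontal part lies farther out than any puncture.\<close>

lemma sheet_sum_homotopic_sphere:
  fixes B :: "real \<times> 'd::euclidean_space \<Rightarrow> real \<times> 'd"
  assumes N: "N \<ge> 1" and B: "continuous_on (sphere 0 1) B"
    and Bcap: "\<And>v. infnorm v \<le> 1/2 \<Longrightarrow> \<exists>\<mu>\<ge>0. B (cap v) = \<mu> *\<^sub>R (1, v) \<and> (\<forall>i<N. v = slab_pos N i *\<^sub>R first_dir \<longrightarrow> \<mu> = 1)"
  obtains K where "K \<ge> 2" "sphere_homotopic (- wedge_points N) B (\<lambda>y. K *\<^sub>R (y - sph_base))"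
proof -
  \<comment> \<open>Slab middles have 2 |v| <= 1 - 1/N in the sup norm, hence at most t1; the bound
    1/2 makes the cosine nonpositive beyond t1.\<close>
  define t1 where "t1 = max (1/2) (1 - 1 / real N)"
  have t1: "1/2 \<le> t1" "t1 < 1" "1 - 1 / real N \<le> t1" using N by (auto simp: t1_def)
  have mono: "cos (pi * t) \<le> cos (pi * s)" if "0 \<le> s" "s \<le> t" "t \<le> 1" for s t
    using that inverse_in_unit_interval[of s] inverse_in_unit_interval[of t] by (intro cos_monotone_0_pi_le) auto
  have "cos (pi * t1) > cos pi"
    using t1 inverse_in_unit_interval[of t1] by (intro cos_monotone_0_pi) auto
  then have pos: "1 + cos (pi * t1) > 0" by simp
  \<comment> \<open>Large enough for K (1 + cos(pi t)) >= 1 up to t1.\<close>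
  define K where "K = max 2 (1 / (1 + cos (pi * t1)))"
  have "K \<ge> 2" by (simp add: K_def)
  have "1 / (1 + cos (pi * t1)) * (1 + cos (pi * t1)) \<le> K * (1 + cos (pi * t1))"
    using pos by (intro mult_right_mono) (auto simp: K_def)
  then have Kt1: "1 \<le> K * (1 + cos (pi * t1))" using pos by simp
  have Kle: "1 \<le> K * (1 + cos (pi * t))" if "0 \<le> t" "t \<le> t1" for t
  proof -
    have "K * (1 + cos (pi * t1)) \<le> K * (1 + cos (pi * t))"
      using mono[of t t1] that t1 \<open>K \<ge> 2\<close> by (intro mult_left_mono) auto
    then show ?thesis using Kt1 by linarith
  qed
  define U where "U v = (K * (1 + cos (pi * (2 * infnorm v)))) *\<^sub>R (1::real, v)" for v :: 'd
  have cU: "continuous_on {v. infnorm v \<le> 1/2} U"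
    unfolding U_def by (intro continuous_intros)
  have bU: "U v = 0" if "infnorm v = 1/2" for v
    unfolding U_def that by (simp add: zero_prod_def)
  obtain C where C: "continuous_on (sphere 0 1) C" "\<And>v. infnorm v \<le> 1/2 \<Longrightarrow> C (cap v) = U v"
    using factor_through_cap[OF cU bU] by blast
  have "sphere_homotopic (- wedge_points N) B C"
  proof (rule sphere_homotopic_linear[OF B C(1)])
    fix y :: "real \<times> 'd" and s :: real assume y: "norm y = 1" and s: "0 \<le> s" "s \<le> 1"
    obtain v where v: "infnorm v \<le> 1/2" "cap v = y" using cap_surj[OF y] .
    define \<nu> where "\<nu> = K * (1 + cos (pi * (2 * infnorm v)))"
    obtain \<mu> where \<mu>: "\<mu> \<ge> 0" "B y = \<mu> *\<^sub>R (1, v)" "\<And>i. i < N \<Longrightarrow> v = slab_pos N i *\<^sub>R first_dir \<Longrightarrow> \<mu> = 1"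
      using Bcap[OF v(1)] v(2) by metis
    have Cy: "C y = \<nu> *\<^sub>R (1, v)" using C(2)[OF v(1)] v(2) by (simp only: U_def \<nu>_def)
    have "(1 - s) *\<^sub>R B y + s *\<^sub>R C y \<noteq> wedge_point N i" if i: "i < N" for i
    proof
      assume eq: "(1 - s) *\<^sub>R B y + s *\<^sub>R C y = wedge_point N i"
      define \<kappa> where "\<kappa> = (1 - s) * \<mu> + s * \<nu>"
      have "\<kappa> *\<^sub>R (1, v) = wedge_point N i" 
        using eq unfolding \<mu>(2) Cy \<kappa>_def by (simp only: scaleR_scaleR scaleR_left_distrib)
      then have k: "\<kappa> = 1/2" "\<kappa> *\<^sub>R v = (slab_pos N i / 2) *\<^sub>R first_dir" by (simp_all add: wedge_point_def)
      have "2 *\<^sub>R (\<kappa> *\<^sub>R v) = 2 *\<^sub>R ((slab_pos N i / 2) *\<^sub>R first_dir)" unfolding k(2) ..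
      then have vi: "v = slab_pos N i *\<^sub>R first_dir" unfolding k(1) by simp
      then have "\<mu> = 1" using \<mu>(3)[OF i] by blast
      have "infnorm v = \<bar>slab_pos N i\<bar>" unfolding vi infnorm_mul by simp
      then have "2 * infnorm v \<le> 2 * (1/2 - 1 / (2 * real N))" 
        using abs_slab_pos_le[OF i] by (simp only: mult_left_mono)
      then have "2 * infnorm v \<le> t1" using t1(3) by (simp add: right_diff_distrib)
      then have "\<nu> \<ge> 1" unfolding \<nu>_def by (intro Kle) (simp_all add: infnorm_pos_le)
      then have "(1 - s) * 1 + s * 1 \<le> \<kappa>" unfolding \<kappa>_def \<open>\<mu> = 1\<close> using s by (intro add_left_mono mult_left_mono) auto
      then show False using k(1) by simp
    qed
    then show "(1 - s) *\<^sub>R B y + s *\<^sub>R C y \<in> - wedge_points N" by force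
  qed
  moreover have "sphere_homotopic (- wedge_points N) C (\<lambda>y. K *\<^sub>R (y - sph_base))"
  proof (rule sphere_homotopic_linear[OF C(1)])
    show "continuous_on (sphere 0 1) (\<lambda>y. K *\<^sub>R (y - sph_base))" by (intro continuous_intros)
    fix y :: "real \<times> 'd" and s :: real assume y: "norm y = 1" and s: "0 \<le> s" "s \<le> 1"
    obtain v where v: "infnorm v \<le> 1/2" "cap v = y" using cap_surj[OF y] .
    define t where "t = 2 * infnorm v"
    have t: "0 \<le> t" "t \<le> 1" using v by (auto simp: t_def infnorm_pos_le)
    define c where "c = cos (pi * t)"
    define S where "S = sin (pi * t)"
    have y1: "fst y = c" "snd y = (S * inverse (norm v)) *\<^sub>R v"
      using cap_inner_simps[OF v(1)] unfolding v(2) c_def S_def t_def by auto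
    have Cy: "C y = (K * (1 + c)) *\<^sub>R (1, v)" using C(2)[OF v(1)] v(2) by (simp only: U_def c_def t_def)
    have "S \<ge> 0" unfolding S_def using inverse_in_unit_interval[OF t] by (intro sin_ge_zero) auto
    have cS: "c\<^sup>2 + S\<^sup>2 = 1" by (simp add: c_def S_def)
    have "(1 - s) *\<^sub>R C y + s *\<^sub>R (K *\<^sub>R (y - sph_base)) \<noteq> wedge_point N i" if i: "i < N" for i
    proof
      assume eq: "(1 - s) *\<^sub>R C y + s *\<^sub>R (K *\<^sub>R (y - sph_base)) = wedge_point N i"
      have f: "(1 - s) * (K * (1 + c)) + s * (K * (c + 1)) = 1/2"
        using arg_cong[OF eq, of fst] by (simp add: Cy y1 wedge_point_def sph_base_def)
      have Kc: "K * (1 + c) = 1/2"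
      proof -
        have "K * (1 + c) = (1 - s) * (K * (1 + c)) + s * (K * (c + 1))" by (simp add: algebra_simps)
        then show ?thesis using f by simp
      qed
      have tt: "t > t1" using Kle[of t] t(1) Kc unfolding c_def by fastforce
      then have "t > 1/2" using t1(1) by linarith
      then have "infnorm v > 0" by (simp add: t_def)
      then have "v \<noteq> 0" by (simp add: infnorm_pos_lt)
      define \<tau> where "\<tau> = (1 - s) * (K * (1 + c)) + s * (K * (S * inverse (norm v)))"
      have g: "\<tau> *\<^sub>R v = (slab_pos N i / 2) *\<^sub>R first_dir"
        using arg_cong[OF eq, of snd] by (simp add: Cy y1 wedge_point_def sph_base_def \<tau>_def scaleR_left_distrib mult.assoc)
      have "c \<le> cos (pi * (1/2))" unfolding c_def using \<open>t > 1/2\<close> t by (intro mono) auto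
      then have "c \<le> 0" by simp
      have "c > -1" 
      proof (rule ccontr)
        assume "\<not> ?thesis"
        then have "K * (1 + c) \<le> 0" using \<open>K \<ge> 2\<close> by (intro mult_nonneg_nonpos) auto
        then show False using Kc by simp
      qed
      have \<tau>0: "\<tau> \<noteq> 0"
      proof
        assume "\<tau> = 0"
        moreover have "(1 - s) * (K * (1 + c)) \<ge> 0" using s Kc by simp
        moreover have "s * (K * (S * inverse (norm v))) \<ge> 0" using s \<open>K \<ge> 2\<close> \<open>S \<ge> 0\<close> by simp
        ultimately have a: "(1 - s) * (K * (1 + c)) = 0" "s * (K * (S * inverse (norm v))) = 0" 
          unfolding \<tau>_def by linarith+
        then have "s = 1" using Kc by simp
        then have "S = 0" using a(2) \<open>K \<ge> 2\<close> \<open>v \<noteq> 0\<close> by simp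
        then have "c = -1" using cS \<open>c \<le> 0\<close> by (simp add: power2_eq_1_iff)
        then show False using \<open>c > -1\<close> by simp
      qed
      define r where "r = slab_pos N i / 2 / \<tau>"
      have "v = (1 / \<tau>) *\<^sub>R (\<tau> *\<^sub>R v)" using \<tau>0 by simp
      then have vr: "v = r *\<^sub>R first_dir" unfolding g r_def by simp
      have nv: "norm v = t / 2" 
      proof -
        have "norm v = \<bar>r\<bar>" "infnorm v = \<bar>r\<bar>" unfolding vr infnorm_mul by simp_all
        then show ?thesis by (simp add: t_def)
      qed
      \<comment> \<open>For c in (-1, 0] one has (1 + c)^2 <= 1 - c^2 = S^2. So the horizontal
        factor of the round sphere is at least that of C, which is 1/2 here.\<close>
      have "S \<ge> 1 + c"
      proof (rule power2_le_imp_le[OF _ \<open>S \<ge> 0\<close>])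
        have "0 \<le> (- c) * (1 + c)" using \<open>c \<le> 0\<close> \<open>c > -1\<close> by (intro mult_nonneg_nonneg) auto
        then show "(1 + c)\<^sup>2 \<le> S\<^sup>2" using cS by (simp add: power2_eq_square algebra_simps)
      qed
      moreover have "1 \<le> inverse (norm v)"
      proof (rule one_le_inverse)
        show "0 < norm v" "norm v \<le> 1" using nv t \<open>t > 1/2\<close> by auto
      qed
      ultimately have "(1 + c) * 1 \<le> S * inverse (norm v)" using \<open>c > -1\<close> \<open>S \<ge> 0\<close> by (intro mult_mono) auto
      then have "K * (1 + c) \<le> K * (S * inverse (norm v))" using \<open>K \<ge> 2\<close> by (intro mult_left_mono) auto
      then have "(1 - s) * (1/2) + s * (1/2) \<le> \<tau>" unfolding \<tau>_def Kc using s by (intro add_left_mono mult_left_mono) auto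
      then have "\<tau> \<ge> 1/2" unfolding distrib_right[symmetric] by simp
      have "\<tau> * (t / 2) = norm (\<tau> *\<^sub>R v)" using \<open>\<tau> \<ge> 1/2\<close> nv by simp
      also have "\<dots> = \<bar>slab_pos N i\<bar> / 2" unfolding g by simp
      also have "\<dots> \<le> (1/2 - 1 / (2 * real N)) / 2" using abs_slab_pos_le[OF i] by simp
      also have "\<dots> = 1/2 * ((1 - 1 / real N) / 2)" by (simp add: right_diff_distrib diff_divide_distrib)
      also have "\<dots> < 1/2 * (t / 2)" using tt t1(3) by simp
      also have "\<dots> \<le> \<tau> * (t / 2)" using \<open>\<tau> \<ge> 1/2\<close> t by (intro mult_right_mono) auto
      finally show False by simp
    qed
    then show "(1 - s) *\<^sub>R C y + s *\<^sub>R (K *\<^sub>R (y - sph_base)) \<in> - wedge_points N" by force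
  qed
  ultimately have "sphere_homotopic (- wedge_points N) B (\<lambda>y. K *\<^sub>R (y - sph_base))"
    by (rule homotopic_with_trans)
  then show thesis using that \<open>K \<ge> 2\<close> by blast
qed

text \<open>Two round spheres that enclose all punctures, centred at (K, 0) and at 0. The punctures
  have height 1/2 and horizontal distance at most 1/4; comparing norms at a hit would bound both s R
  and (1 - s) K below 1, though one of them is at least 1.\<close>

lemma shifted_sphere_homotopic:
  assumes "K \<ge> 2" "R \<ge> 2"
  shows "sphere_homotopic (- wedge_points N) (\<lambda>y. K *\<^sub>R (y - sph_base)) (\<lambda>y :: real \<times> 'd::euclidean_space. R *\<^sub>R y)"
proof (rule sphere_homotopic_linear)
  fix y :: "real \<times> 'd" and s :: real assume y: "norm y = 1" and s: "0 \<le> s" "s \<le> 1"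
  define \<rho> where "\<rho> = (1 - s) * K + s * R"
  have eq: "(1 - s) *\<^sub>R (K *\<^sub>R (y - sph_base)) + s *\<^sub>R (R *\<^sub>R y) = \<rho> *\<^sub>R y + ((1 - s) * K) *\<^sub>R (1, 0)"
    by (simp add: \<rho>_def sph_base_def prod_eq_iff algebra_simps)
  have "\<rho> *\<^sub>R y + ((1 - s) * K) *\<^sub>R (1, 0) \<noteq> wedge_point N i" if "i < N" for i
  proof
    define a where "a = (1 - s) * K"
    define q where "q = slab_pos N i / 2"
    assume "\<rho> *\<^sub>R y + ((1 - s) * K) *\<^sub>R (1, 0) = wedge_point N i"
    then have "\<rho> *\<^sub>R y = (1/2 - a, q *\<^sub>R first_dir)"
      by (simp add: prod_eq_iff wedge_point_def a_def q_def algebra_simps)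
    then have "(norm (\<rho> *\<^sub>R y))\<^sup>2 = (1/2 - a)\<^sup>2 + q\<^sup>2" by (simp add: norm_Pair)
    then have n: "\<rho>\<^sup>2 = (1/2 - a)\<^sup>2 + q\<^sup>2" using y by (simp add: power_mult_distrib)
    have "0 \<le> 1 / (2 * real N)" by simp
    moreover have "\<bar>q\<bar> = \<bar>slab_pos N i\<bar> / 2" by (simp add: q_def)
    ultimately have "\<bar>q\<bar> \<le> 1/4" using abs_slab_pos_le[OF that] by linarith
    then have "q\<^sup>2 \<le> (1/4)\<^sup>2" by (rule abs_le_square_iff[THEN iffD1, OF order_trans]) simp
    then have q: "q\<^sup>2 \<le> 1/16" by (simp add: power2_eq_square)
    have a: "a \<ge> 0" using s assms by (simp add: a_def)
    have b: "s * R \<ge> 0" using s assms by simp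
    have \<rho>: "\<rho> = a + s * R" by (simp add: \<rho>_def a_def)
    have "a\<^sup>2 + (s * R)\<^sup>2 + 2 * (a * (s * R)) = 1/4 - a + a\<^sup>2 + q\<^sup>2" 
      using n unfolding \<rho> by (simp add: power2_eq_square algebra_simps)
    moreover have "a * (s * R) \<ge> 0" using a b by simp
    ultimately have k: "(s * R)\<^sup>2 + a \<le> 1/4 + 1/16" using q by linarith
    show False
    proof (cases "s \<le> 1/2")
      case True
      then have "1/2 * 2 \<le> (1 - s) * K" using assms by (intro mult_mono) auto
      then show False using k a_def zero_le_power2[of "s * R"] by linarith
    next
      case False
      then have "1/2 * 2 \<le> s * R" using assms by (intro mult_mono) auto
      then have "1\<^sup>2 \<le> (s * R)\<^sup>2" by (intro power_mono) auto
      then show False using k a by simp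
    qed
  qed
  then show "(1 - s) *\<^sub>R (K *\<^sub>R (y - sph_base)) + s *\<^sub>R (R *\<^sub>R y) \<in> - wedge_points N" unfolding eq by force
qed (intro continuous_intros)+

text \<open>In the last clause, the standard sum of the inclusions at \<open>cap v\<close> runs
  through the sheet of the slab containing v. There \<open>stretch\<close> and \<open>shrink\<close>
  cancel, so the value lies on the ray of (1, v), with factor 1 at the slab middles: the situation
  compared above with a round sphere.\<close>

lemma wedge_to_punctured:
  assumes N: "N \<ge> 1"
  obtains W :: "real \<times> 'd::euclidean_space \<Rightarrow> real \<times> 'd" where
    "continuous_on (wedge_spheres N) W" "W ` wedge_spheres N \<subseteq> - wedge_points N"
    "\<And>j \<epsilon>. j < N \<Longrightarrow> 0 < \<epsilon> \<Longrightarrow> \<epsilon> * real N \<le> 1/4 \<Longrightarrow>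
       sphere_homotopic (- wedge_points N) (\<lambda>y. W (wedge_incl j y)) (\<lambda>y. wedge_point N j + \<epsilon> *\<^sub>R y)"
    "\<And>A R. continuous_on (sphere 0 1) A \<Longrightarrow> A ` sphere 0 1 \<subseteq> wedge_spheres N \<Longrightarrow> 
       (\<And>x. x \<in> cbox 0 One \<Longrightarrow> A (cube_to_sphere x) = cube_sum N (\<lambda>j. wedge_incl j \<circ> cube_to_sphere) x) \<Longrightarrow> R \<ge> 2 \<Longrightarrow>
       sphere_homotopic (- wedge_points N) (\<lambda>y. W (A y)) (\<lambda>y. R *\<^sub>R y)"
proof -
  obtain W :: "real \<times> 'd \<Rightarrow> real \<times> 'd" where W: "continuous_on (wedge_spheres N) W"
    "\<And>j u. j < N \<Longrightarrow> infnorm u \<le> 1/2 \<Longrightarrow> W (wedge_incl j (cap u)) = wedge_sheet N j u" "W 0 = 0"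
    using wedge_map[OF N, where 'd='d] by blast
  interpret based_sphere_maps N "wedge_incl :: nat \<Rightarrow> real \<times> 'd \<Rightarrow> _" "wedge_spheres N" 0
    by (rule wedge_incl_based[OF N])
  have cw: "continuous_on (sphere 0 1) (\<lambda>y. W (wedge_incl j y))" if "j < N" for j
    by (rule continuous_on_compose2[OF W(1) gcont[OF that]]) (use gZ[OF that] in auto)
  show thesis
  proof
    show "continuous_on (wedge_spheres N) W" by fact
    have "W z \<noteq> wedge_point N i" if z: "z \<in> wedge_spheres N" for z i
    proof -
      obtain j y where jy: "j < N" "norm y = 1" "z = wedge_incl j y" using z by (auto simp: wedge_spheres_def)
      obtain u where "infnorm u \<le> 1/2" "cap u = y" using cap_surj[OF jy(2)] .
      then show ?thesis using W(2)[OF jy(1)] wedge_sheet_ne[OF N] jy(3) by metis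
    qed
    then show "W ` wedge_spheres N \<subseteq> - wedge_points N" by (auto simp: image_subset_iff)
    show "sphere_homotopic (- wedge_points N) (\<lambda>y. W (wedge_incl j y)) (\<lambda>y. wedge_point N j + \<epsilon> *\<^sub>R y)"
      if j: "j < N" and \<epsilon>: "0 < \<epsilon>" "\<epsilon> * real N \<le> 1/4" for j \<epsilon>
    proof (rule sphere_homotopic_linear[OF cw[OF j]])
      fix y :: "real \<times> 'd" and s :: real assume y: "norm y = 1" and s: "0 \<le> s" "s \<le> 1"
      obtain u where u: "infnorm u \<le> 1/2" "cap u = y" using cap_surj[OF y] .
      show "(1 - s) *\<^sub>R W (wedge_incl j y) + s *\<^sub>R (wedge_point N j + \<epsilon> *\<^sub>R y) \<in> - wedge_points N"
        using wedge_sheet_near_ne[OF N j _ \<epsilon> u(1) s] W(2)[OF j u(1)] unfolding u(2) by force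
    qed (intro continuous_intros)
    show "sphere_homotopic (- wedge_points N) (\<lambda>y. W (A y)) (\<lambda>y. R *\<^sub>R y)"
      if A: "continuous_on (sphere 0 1) A" "A ` sphere 0 1 \<subseteq> wedge_spheres N" 
        and sum: "\<And>x. x \<in> cbox 0 One \<Longrightarrow> A (cube_to_sphere x) = cube_sum N (\<lambda>j. wedge_incl j \<circ> cube_to_sphere) x"
        and R: "R \<ge> 2" for A R
    proof -
      have cB: "continuous_on (sphere 0 1) (\<lambda>y. W (A y))"
        by (rule continuous_on_compose2[OF W(1) A])
      have Bcap: "\<exists>\<mu>\<ge>0. W (A (cap v)) = \<mu> *\<^sub>R (1, v) \<and> (\<forall>i<N. v = slab_pos N i *\<^sub>R first_dir \<longrightarrow> \<mu> = 1)"
        if v: "infnorm v \<le> 1/2" for v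
      proof -
        have m: "v + (1/2) *\<^sub>R One \<in> cbox 0 One" unfolding mem_unit_cube_iff using v by simp
        have Av: "A (cap v) = slab_glue N wedge_incl (1, v)"
          using sum[OF m] slab_glue_top[OF m] by (simp add: cube_to_sphere_eq_cap[OF m])
        obtain j where j: "j < N" "\<And>i. i < N \<Longrightarrow> i \<noteq> j \<Longrightarrow> slab_map N i (1, v) = sph_base"
          using slab_glue_ex[of "(1, v)"] by blast
        define w where "w = stretch N (v - slab_pos N j *\<^sub>R first_dir)"
        have Aj: "A (cap v) = wedge_incl j (slab_map N j (1, v))" unfolding Av by (rule slab_glue_eq[OF j])
        have ji: "w = 0" if "i < N" "v = slab_pos N i *\<^sub>R first_dir" for i
        proof -
          have "slab_map N i (1, v) = (1, 0)" by (simp add: slab_map_def that(2))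
          then have "slab_map N i (1, v) \<noteq> sph_base" by (simp add: sph_base_def)
          then have "i = j" using j(2)[OF that(1)] by blast
          then show ?thesis by (simp add: w_def that(2))
        qed
        show ?thesis
        proof (cases "infnorm w \<le> 1/2")
          case True
          have "slab_map N j (1, v) = cap w" by (simp add: slab_map_def w_def)
          then have "W (A (cap v)) = (1 - 2 * infnorm w) *\<^sub>R (1, slab_pos N j *\<^sub>R first_dir + shrink N w)"
            using W(2)[OF j(1) True] by (simp only: Aj wedge_sheet_def)
          also have "slab_pos N j *\<^sub>R first_dir + shrink N w = v" by (simp add: w_def shrink_stretch[OF N])
          finally show ?thesis using True ji by (intro exI[of _ "1 - 2 * infnorm w"]) (auto simp: infnorm_0)
        next
          case False
          then have "slab_map N j (1, v) = sph_base" by (intro slab_map_base) (simp add: w_def)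
          then have "W (A (cap v)) = 0 *\<^sub>R (1, v)" using W(3) by (simp add: Aj zero_prod_def)
          moreover have "w \<noteq> 0" using False by (auto simp: infnorm_0)
          ultimately show ?thesis using ji by (intro exI[of _ 0]) auto
        qed
      qed
      obtain K where "K \<ge> 2" "sphere_homotopic (- wedge_points N) (\<lambda>y. W (A y)) (\<lambda>y. K *\<^sub>R (y - sph_base))"
        using sheet_sum_homotopic_sphere[OF N cB Bcap] .
      then show ?thesis using shifted_sphere_homotopic[OF _ R, of K N] homotopic_with_trans by blast
    qed
  qed
qed

section \<open>Moving the punctures by shears\<close>

text \<open>Records the homotopy data alone: small spheres about a puncture go to small spheres
  about its partner, large spheres to large ones. All small and all large radii are allowed, so that
  such maps compose.\<close>

definition config_map :: "'i set \<Rightarrow> ('i \<Rightarrow> 'a::euclidean_space) \<Rightarrow> ('i \<Rightarrow> 'a) \<Rightarrow> ('a \<Rightarrow> 'a) \<Rightarrow> bool" where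
  "config_map I P Q \<tau> \<longleftrightarrow> continuous_on (- P ` I) \<tau> \<and> \<tau> ` (- P ` I) \<subseteq> - Q ` I \<and>
     (\<forall>j\<in>I. \<exists>e>0. \<forall>\<epsilon> \<delta>. 0 < \<epsilon> \<and> \<epsilon> < e \<and> 0 < \<delta> \<and> \<delta> < e \<longrightarrow>
        sphere_homotopic (- Q ` I) (\<lambda>x. \<tau> (P j + \<epsilon> *\<^sub>R x)) (\<lambda>x. Q j + \<delta> *\<^sub>R x)) \<and>
     (\<exists>R0. \<forall>R S. R0 < R \<and> R0 < S \<longrightarrow> sphere_homotopic (- Q ` I) (\<lambda>x. \<tau> (R *\<^sub>R x)) (\<lambda>x. S *\<^sub>R x))"

lemma config_mapD:
  assumes "config_map I P Q \<tau>"
  shows "continuous_on (- P ` I) \<tau>" "\<tau> ` (- P ` I) \<subseteq> - Q ` I"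
    and "j \<in> I \<Longrightarrow> \<exists>e>0. \<forall>\<epsilon> \<delta>. 0 < \<epsilon> \<and> \<epsilon> < e \<and> 0 < \<delta> \<and> \<delta> < e \<longrightarrow>
        sphere_homotopic (- Q ` I) (\<lambda>x. \<tau> (P j + \<epsilon> *\<^sub>R x)) (\<lambda>x. Q j + \<delta> *\<^sub>R x)"
    and "\<exists>R0. \<forall>R S. R0 < R \<and> R0 < S \<longrightarrow> sphere_homotopic (- Q ` I) (\<lambda>x. \<tau> (R *\<^sub>R x)) (\<lambda>x. S *\<^sub>R x)"
  using assms unfolding config_map_def by blast+

lemma config_map_trans:
  fixes P Q T :: "'i \<Rightarrow> 'a::euclidean_space"
  assumes "config_map I P Q \<tau>" "config_map I Q T \<sigma>"
  shows "config_map I P T (\<lambda>x. \<sigma> (\<tau> x))"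
proof -
  note 1 = config_mapD[OF assms(1)] and 2 = config_mapD[OF assms(2)]
  have left: "sphere_homotopic (- T ` I) (\<lambda>x. \<sigma> (f x)) (\<lambda>x. \<sigma> (g x))" 
    if "sphere_homotopic (- Q ` I) f g" for f g :: "'a \<Rightarrow> 'a"
    by (rule sphere_homotopic_left[OF that 2(1,2)])
  show ?thesis
  unfolding config_map_def
proof (intro conjI ballI)
  show "continuous_on (- P ` I) (\<lambda>x. \<sigma> (\<tau> x))"
    by (rule continuous_on_compose2[OF 2(1) 1(1,2)])
  show "(\<lambda>x. \<sigma> (\<tau> x)) ` (- P ` I) \<subseteq> - T ` I" using 1(2) 2(2) by (simp only: image_subset_iff) blast
  fix j assume j: "j \<in> I"
  obtain e1 where e1: "e1 > 0" "\<And>\<epsilon> \<delta>. 0 < \<epsilon> \<Longrightarrow> \<epsilon> < e1 \<Longrightarrow> 0 < \<delta> \<Longrightarrow> \<delta> < e1 \<Longrightarrow> 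
      sphere_homotopic (- Q ` I) (\<lambda>x. \<tau> (P j + \<epsilon> *\<^sub>R x)) (\<lambda>x. Q j + \<delta> *\<^sub>R x)" using 1(3)[OF j] by blast
  obtain e2 where e2: "e2 > 0" "\<And>\<epsilon> \<delta>. 0 < \<epsilon> \<Longrightarrow> \<epsilon> < e2 \<Longrightarrow> 0 < \<delta> \<Longrightarrow> \<delta> < e2 \<Longrightarrow> 
      sphere_homotopic (- T ` I) (\<lambda>x. \<sigma> (Q j + \<epsilon> *\<^sub>R x)) (\<lambda>x. T j + \<delta> *\<^sub>R x)" using 2(3)[OF j] by blast
  show "\<exists>e>0. \<forall>\<epsilon> \<delta>. 0 < \<epsilon> \<and> \<epsilon> < e \<and> 0 < \<delta> \<and> \<delta> < e \<longrightarrow>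
        sphere_homotopic (- T ` I) (\<lambda>x. \<sigma> (\<tau> (P j + \<epsilon> *\<^sub>R x))) (\<lambda>x. T j + \<delta> *\<^sub>R x)"
  proof (intro exI[of _ "min e1 e2"] conjI allI impI)
    fix \<epsilon> \<delta> assume a: "0 < \<epsilon> \<and> \<epsilon> < min e1 e2 \<and> 0 < \<delta> \<and> \<delta> < min e1 e2"
    have "sphere_homotopic (- T ` I) (\<lambda>x. \<sigma> (\<tau> (P j + \<epsilon> *\<^sub>R x))) (\<lambda>x. \<sigma> (Q j + \<epsilon> *\<^sub>R x))"
      by (rule left, rule e1(2)) (use a in auto)
    moreover have "sphere_homotopic (- T ` I) (\<lambda>x. \<sigma> (Q j + \<epsilon> *\<^sub>R x)) (\<lambda>x. T j + \<delta> *\<^sub>R x)"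
      by (rule e2(2)) (use a in auto)
    ultimately show "sphere_homotopic (- T ` I) (\<lambda>x. \<sigma> (\<tau> (P j + \<epsilon> *\<^sub>R x))) (\<lambda>x. T j + \<delta> *\<^sub>R x)"
      by (rule homotopic_with_trans)
  qed (use e1 e2 in auto)
next
  obtain R1 where R1: "\<And>R S. R1 < R \<Longrightarrow> R1 < S \<Longrightarrow> sphere_homotopic (- Q ` I) (\<lambda>x. \<tau> (R *\<^sub>R x)) (\<lambda>x. S *\<^sub>R x)"
    using 1(4) by blast
  obtain R2 where R2: "\<And>R S. R2 < R \<Longrightarrow> R2 < S \<Longrightarrow> sphere_homotopic (- T ` I) (\<lambda>x. \<sigma> (R *\<^sub>R x)) (\<lambda>x. S *\<^sub>R x)"
    using 2(4) by blast
  show "\<exists>R0. \<forall>R S. R0 < R \<and> R0 < S \<longrightarrow> sphere_homotopic (- T ` I) (\<lambda>x. \<sigma> (\<tau> (R *\<^sub>R x))) (\<lambda>x. S *\<^sub>R x)"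
  proof (intro exI[of _ "max R1 R2"] allI impI)
    fix R S assume a: "max R1 R2 < R \<and> max R1 R2 < S"
    have "sphere_homotopic (- Q ` I) (\<lambda>x. \<tau> (R *\<^sub>R x)) (\<lambda>x. R *\<^sub>R x)" by (rule R1) (use a in auto)
    then have "sphere_homotopic (- T ` I) (\<lambda>x. \<sigma> (\<tau> (R *\<^sub>R x))) (\<lambda>x. \<sigma> (R *\<^sub>R x))"
      by (rule left)
    moreover have "sphere_homotopic (- T ` I) (\<lambda>x. \<sigma> (R *\<^sub>R x)) (\<lambda>x. S *\<^sub>R x)" by (rule R2) (use a in auto)
    ultimately show "sphere_homotopic (- T ` I) (\<lambda>x. \<sigma> (\<tau> (R *\<^sub>R x))) (\<lambda>x. S *\<^sub>R x)"
      by (rule homotopic_with_trans)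
  qed
qed
qed

text \<open>Hyperplanes orthogonal to a are translated within themselves: y goes to y +
  \<open>\<phi>\<close>(y . a), where \<open>\<phi>\<close> is orthogonal to a and is the required
  displacement at the heights of the punctures. Distinct heights make it well defined, and Tietze's
  theorem provides a bounded extension, so that large spheres are moved by a bounded amount.\<close>

lemma config_map_shear:
  fixes P Q :: "'i \<Rightarrow> 'a::euclidean_space"
  assumes I: "finite I" and a: "norm a = 1"
    and inj: "inj_on (\<lambda>j. P j \<bullet> a) I" and perp: "\<And>j. j \<in> I \<Longrightarrow> P j \<bullet> a = Q j \<bullet> a"
  shows "\<exists>\<tau>. config_map I P Q \<tau>"
proof -
  have aa: "a \<bullet> a = 1" using a by (simp add: norm_eq_1)
  define T where "T = (\<lambda>j. P j \<bullet> a) ` I"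
  define g where "g t = (let j = the_inv_into I (\<lambda>j. P j \<bullet> a) t in Q j - P j)" for t
  have g: "g (P j \<bullet> a) = Q j - P j" if "j \<in> I" for j
    by (simp add: g_def the_inv_into_f_f[OF inj that])
  have "finite T" using I by (simp add: T_def)
  define B where "B = (\<Sum>t\<in>T. norm (g t))"
  have B0: "0 \<le> B" unfolding B_def by (intro sum_nonneg) auto
  have gB: "norm (g t) \<le> B" if "t \<in> T" for t
    unfolding B_def using member_le_sum[OF that, of "\<lambda>t. norm (g t)"] \<open>finite T\<close> by simp
  have cg: "continuous_on T g" using \<open>finite T\<close> by (rule continuous_on_finite)
  have cl: "closedin (top_of_set UNIV) T" using \<open>finite T\<close> by (simp add: finite_imp_closed)
  obtain \<phi>0 where \<phi>0: "continuous_on UNIV \<phi>0" "\<And>t. t \<in> T \<Longrightarrow> \<phi>0 t = g t" "\<And>t. norm (\<phi>0 t) \<le> B"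
    using Tietze[OF cg cl B0 gB] by (metis UNIV_I)
  \<comment> \<open>Removing the component along a preserves heights. At the heights of the
    punctures nothing changes, as the displacement there is already orthogonal to a.\<close>
  define \<phi> where "\<phi> t = \<phi>0 t - (\<phi>0 t \<bullet> a) *\<^sub>R a" for t
  have c\<phi>: "continuous_on UNIV \<phi>" unfolding \<phi>_def by (intro continuous_intros \<phi>0(1))
  have \<phi>a: "\<phi> t \<bullet> a = 0" for t by (simp add: \<phi>_def inner_diff_left aa)
  have \<phi>B: "norm (\<phi> t) \<le> 2 * B" for t
  proof -
    have "norm (\<phi> t) \<le> norm (\<phi>0 t) + \<bar>\<phi>0 t \<bullet> a\<bar> * norm a"
      unfolding \<phi>_def using norm_triangle_ineq4[of "\<phi>0 t" "(\<phi>0 t \<bullet> a) *\<^sub>R a"] by simp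
    moreover have "\<bar>\<phi>0 t \<bullet> a\<bar> \<le> norm (\<phi>0 t)" using Cauchy_Schwarz_ineq2[of "\<phi>0 t" a] a by simp
    ultimately show ?thesis using \<phi>0(3)[of t] a by simp
  qed
  have \<phi>P: "\<phi> (P j \<bullet> a) = Q j - P j" if "j \<in> I" for j
  proof -
    have "\<phi>0 (P j \<bullet> a) = Q j - P j" using \<phi>0(2) g that by (simp add: T_def)
    then show ?thesis using perp[OF that] by (simp add: \<phi>_def inner_diff_left)
  qed
  define \<tau> where "\<tau> y = y + \<phi> (y \<bullet> a)" for y
  have c\<tau>: "continuous_on UNIV \<tau>"
    unfolding \<tau>_def by (intro continuous_intros continuous_on_compose2[OF c\<phi>]) auto
  have \<tau>a: "\<tau> y \<bullet> a = y \<bullet> a" for y by (simp add: \<tau>_def inner_add_left \<phi>a)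
  have \<tau>P: "\<tau> (P j) = Q j" if "j \<in> I" for j using \<phi>P[OF that] by (simp add: \<tau>_def)
  have inv: "y = P j" if "\<tau> y = Q j" "j \<in> I" for y j
  proof -
    have "y \<bullet> a = P j \<bullet> a" using \<tau>a[of y] that perp by simp
    then have "y + (Q j - P j) = Q j" using that \<phi>P by (simp add: \<tau>_def)
    then show ?thesis by (simp add: algebra_simps)
  qed
  show ?thesis
  proof (rule exI[of _ \<tau>], unfold config_map_def, intro conjI ballI)
    show "continuous_on (- P ` I) \<tau>" by (rule continuous_on_subset[OF c\<tau>]) auto
    show "\<tau> ` (- P ` I) \<subseteq> - Q ` I" using inv by (auto simp: image_subset_iff)
    fix j assume j: "j \<in> I"
    have "open (- (Q ` (I - {k \<in> I. Q k = Q j})))" using I by (intro open_Compl finite_imp_closed) auto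
    moreover have "Q j \<in> - (Q ` (I - {k \<in> I. Q k = Q j}))" by auto
    ultimately obtain \<eta> where \<eta>: "\<eta> > 0" "ball (Q j) \<eta> \<subseteq> - (Q ` (I - {k \<in> I. Q k = Q j}))" by (rule openE)
    have "isCont \<tau> (P j)" using c\<tau> by (simp add: continuous_on_eq_continuous_at)
    then obtain d where d: "d > 0" "\<And>y. dist y (P j) < d \<Longrightarrow> dist (\<tau> y) (Q j) < \<eta>"
      using \<eta>(1) \<tau>P[OF j] unfolding continuous_at_eps_delta by metis
    show "\<exists>e>0. \<forall>\<epsilon> \<delta>. 0 < \<epsilon> \<and> \<epsilon> < e \<and> 0 < \<delta> \<and> \<delta> < e \<longrightarrow>
        sphere_homotopic (- Q ` I) (\<lambda>x. \<tau> (P j + \<epsilon> *\<^sub>R x)) (\<lambda>x. Q j + \<delta> *\<^sub>R x)"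
    proof (intro exI[of _ "min \<eta> d"] conjI allI impI)
      show "0 < min \<eta> d" using \<eta> d by simp
      fix \<epsilon> \<delta> assume e: "0 < \<epsilon> \<and> \<epsilon> < min \<eta> d \<and> 0 < \<delta> \<and> \<delta> < min \<eta> d"
      show "sphere_homotopic (- Q ` I) (\<lambda>x. \<tau> (P j + \<epsilon> *\<^sub>R x)) (\<lambda>x. Q j + \<delta> *\<^sub>R x)"
      proof (rule sphere_homotopic_linear)
        show "continuous_on (sphere 0 1) (\<lambda>x. \<tau> (P j + \<epsilon> *\<^sub>R x))"
          by (rule continuous_on_compose2[OF c\<tau>]) (auto intro!: continuous_intros)
        fix x :: 'a and s :: real assume x: "norm x = 1" and s: "0 \<le> s" "s \<le> 1"
        let ?z = "(1 - s) *\<^sub>R \<tau> (P j + \<epsilon> *\<^sub>R x) + s *\<^sub>R (Q j + \<delta> *\<^sub>R x)"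
        have "\<tau> (P j + \<epsilon> *\<^sub>R x) \<in> ball (Q j) \<eta>" using d(2)[of "P j + \<epsilon> *\<^sub>R x"] e x by (simp add: dist_norm norm_minus_commute)
        moreover have "Q j + \<delta> *\<^sub>R x \<in> ball (Q j) \<eta>" using e x by (simp add: dist_norm)
        ultimately have "?z \<in> ball (Q j) \<eta>" using s by (intro convexD[OF convex_ball]) auto
        moreover have "?z \<noteq> Q j"
        proof
          assume z: "?z = Q j"
          have pos: "(1 - s) * \<epsilon> + s * \<delta> > 0" using s e 
            by (cases "s = 1") (auto intro!: add_pos_nonneg mult_pos_pos)
          \<comment> \<open>The height differs from that of \<open>Q j\<close> by a positive
            multiple of x . a. A hit therefore needs x orthogonal to a, and on such x the shear acts
            as a translation.\<close>
          have "?z \<bullet> a = Q j \<bullet> a + ((1 - s) * \<epsilon> + s * \<delta>) * (x \<bullet> a)"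
            using perp[OF j] by (simp add: inner_add_left \<tau>a algebra_simps)
          then have xa: "x \<bullet> a = 0" using z pos by simp
          then have "\<tau> (P j + \<epsilon> *\<^sub>R x) = Q j + \<epsilon> *\<^sub>R x" using \<phi>P[OF j] by (simp add: \<tau>_def inner_add_left)
          then have "?z = Q j + ((1 - s) * \<epsilon> + s * \<delta>) *\<^sub>R x" by (simp add: algebra_simps)
          then have "((1 - s) * \<epsilon> + s * \<delta>) *\<^sub>R x = 0" using z by simp
          then show False using pos x by auto
        qed
        ultimately show "?z \<in> - Q ` I" using \<eta>(2) by auto
      qed (auto intro!: continuous_intros)
    qed
  next
    define B' where "B' = (\<Sum>j\<in>I. norm (Q j))"
    have QB: "norm (Q j) \<le> B'" if "j \<in> I" for j
      unfolding B'_def using member_le_sum[OF that, of "\<lambda>j. norm (Q j)"] I by simp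
    show "\<exists>R0. \<forall>R S. R0 < R \<and> R0 < S \<longrightarrow> sphere_homotopic (- Q ` I) (\<lambda>x. \<tau> (R *\<^sub>R x)) (\<lambda>x. S *\<^sub>R x)"
    proof (intro exI[of _ "2 * B + B'"] allI impI)
      fix R S assume RS: "2 * B + B' < R \<and> 2 * B + B' < S"
      show "sphere_homotopic (- Q ` I) (\<lambda>x. \<tau> (R *\<^sub>R x)) (\<lambda>x. S *\<^sub>R x)"
      proof (rule sphere_homotopic_linear)
        show "continuous_on (sphere 0 1) (\<lambda>x. \<tau> (R *\<^sub>R x))"
          by (rule continuous_on_compose2[OF c\<tau>]) (auto intro!: continuous_intros)
        fix x :: 'a and s :: real assume x: "norm x = 1" and s: "0 \<le> s" "s \<le> 1"
        define \<rho> where "\<rho> = (1 - s) * R + s * S"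
        have "(1 - s) * (2 * B + B') + s * (2 * B + B') \<le> \<rho>"
          unfolding \<rho>_def using RS s by (intro add_mono mult_left_mono) auto
        moreover have "\<rho> \<noteq> 2 * B + B'"
        proof
          assume "\<rho> = 2 * B + B'"
          then have z: "(1 - s) * (R - (2 * B + B')) + s * (S - (2 * B + B')) = 0" by (simp add: \<rho>_def algebra_simps)
          have "(1 - s) * (R - (2 * B + B')) \<ge> 0" "s * (S - (2 * B + B')) \<ge> 0" using RS s by auto
          then have "(1 - s) * (R - (2 * B + B')) = 0" "s * (S - (2 * B + B')) = 0" using z by linarith+
          then show False using RS by auto
        qed
        ultimately have \<rho>: "\<rho> > 2 * B + B'" by (simp add: algebra_simps)
        have eq: "(1 - s) *\<^sub>R \<tau> (R *\<^sub>R x) + s *\<^sub>R (S *\<^sub>R x) = \<rho> *\<^sub>R x + (1 - s) *\<^sub>R \<phi> (R *\<^sub>R x \<bullet> a)"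
          by (simp add: \<tau>_def \<rho>_def algebra_simps)
        have "B' \<ge> 0" unfolding B'_def by (intro sum_nonneg) auto
        have "norm ((1 - s) *\<^sub>R \<phi> (R *\<^sub>R x \<bullet> a)) \<le> 1 * (2 * B)" 
          unfolding norm_scaleR using s \<phi>B by (intro mult_mono) auto
        moreover have "norm (\<rho> *\<^sub>R x) = \<rho>" using x \<rho> B0 \<open>B' \<ge> 0\<close> by simp
        ultimately have "norm (\<rho> *\<^sub>R x + (1 - s) *\<^sub>R \<phi> (R *\<^sub>R x \<bullet> a)) > B'"
          using norm_diff_ineq[of "\<rho> *\<^sub>R x" "(1 - s) *\<^sub>R \<phi> (R *\<^sub>R x \<bullet> a)"] \<rho> by linarith
        then show "(1 - s) *\<^sub>R \<tau> (R *\<^sub>R x) + s *\<^sub>R (S *\<^sub>R x) \<in> - Q ` I"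
          unfolding eq using QB by force
      qed (auto intro!: continuous_intros)
    qed
  qed
qed

text \<open>Two shears suffice. The first moves \<open>P j\<close> along w, orthogonal to a, until
  its coordinate along c is that of \<open>Q j\<close>; the second preserves this coordinate and
  does the rest. Moving along w changes the coordinate along c since a and c are not
  parallel.\<close>

lemma config_map_exists:
  fixes P Q :: "'i \<Rightarrow> 'a::euclidean_space"
  assumes I: "finite I" and ac: "norm a = 1" "norm c = 1" "\<bar>a \<bullet> c\<bar> \<noteq> 1"
    and inj: "inj_on (\<lambda>j. P j \<bullet> a) I" "inj_on (\<lambda>j. Q j \<bullet> c) I"
  shows "\<exists>\<tau>. config_map I P Q \<tau>"
proof -
  have aa: "a \<bullet> a = 1" "c \<bullet> c = 1" using ac by (auto simp: norm_eq_1)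
  define w where "w = c - (a \<bullet> c) *\<^sub>R a"
  have wa: "w \<bullet> a = 0" by (simp add: w_def inner_diff_left aa inner_commute[of c a])
  have "w \<bullet> c = 1 - (a \<bullet> c)\<^sup>2" by (simp add: w_def inner_diff_left aa power2_eq_square)
  then have wc: "w \<bullet> c \<noteq> 0" using ac(3) by (auto simp: power2_eq_1_iff)
  define P1 where "P1 j = P j + ((Q j \<bullet> c - P j \<bullet> c) / (w \<bullet> c)) *\<^sub>R w" for j
  have P1: "P1 j \<bullet> a = P j \<bullet> a" "P1 j \<bullet> c = Q j \<bullet> c" for j
    using wa wc by (simp_all add: P1_def inner_add_left)
  obtain \<tau>1 where 1: "config_map I P P1 \<tau>1"
    using config_map_shear[OF I ac(1) inj(1), of P1] P1 by auto
  have "inj_on (\<lambda>j. P1 j \<bullet> c) I" using inj(2) by (simp add: P1)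
  then obtain \<tau>2 where 2: "config_map I P1 Q \<tau>2"
    using config_map_shear[OF I ac(2), of P1 Q] P1 by auto
  show ?thesis using config_map_trans[OF 1 2] by blast
qed

text \<open>Almost every x lies off the finitely many hyperplanes orthogonal to the differences
  \<open>Q i - Q j\<close> and to f; the last one keeps x from being parallel to e.\<close>

lemma generic_direction:
  fixes Q :: "'i \<Rightarrow> 'a::euclidean_space"
  assumes I: "finite I" and Q: "inj_on Q I" and ef: "norm e = 1" "norm f = 1" "e \<bullet> f = 0"
  shows "\<exists>a. norm a = 1 \<and> \<bar>a \<bullet> e\<bar> \<noteq> 1 \<and> inj_on (\<lambda>j. Q j \<bullet> a) I"
proof -
  define H where "H v = {x. v \<bullet> x = 0}" for v :: 'a
  have H: "negligible (H v)" if "v \<noteq> 0" for v using negligible_hyperplane[of v 0] that by (simp add: H_def)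
  define \<F> where "\<F> = insert (H f) ((\<lambda>(i, j). H (Q i - Q j)) ` {(i, j) \<in> I \<times> I. i \<noteq> j})"
  have "finite {(i, j) \<in> I \<times> I. i \<noteq> j}" by (rule finite_subset[of _ "I \<times> I"]) (use I in auto)
  then have "finite \<F>" by (simp add: \<F>_def)
  moreover have "negligible S" if "S \<in> \<F>" for S
    using that unfolding \<F>_def
  proof (elim insertE imageE)
    assume "S = H f"
    moreover have "f \<noteq> 0" using ef(2) by auto
    ultimately show ?thesis using H by simp
  next
    fix ij assume ij: "S = (case ij of (i, j) \<Rightarrow> H (Q i - Q j))" "ij \<in> {(i, j) \<in> I \<times> I. i \<noteq> j}"
    then obtain i j where "S = H (Q i - Q j)" "i \<in> I" "j \<in> I" "i \<noteq> j" by auto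
    moreover from this have "Q i \<noteq> Q j" using Q by (auto dest: inj_onD)
    ultimately show ?thesis using H by simp
  qed
  ultimately have "negligible (\<Union>\<F>)" by (intro negligible_Union) auto
  then have "\<Union>\<F> \<noteq> UNIV" using non_negligible_UNIV by metis
  then obtain x where x: "x \<notin> \<Union>\<F>" by blast
  have xf: "f \<bullet> x \<noteq> 0" using x by (auto simp: \<F>_def H_def)
  have xQ: "(Q i - Q j) \<bullet> x \<noteq> 0" if "i \<in> I" "j \<in> I" "i \<noteq> j" for i j
    using x that by (auto simp: \<F>_def H_def)
  have x0: "x \<noteq> 0" using xf by auto
  define a where "a = x /\<^sub>R norm x"
  have na: "norm a = 1" using x0 by (simp add: a_def)
  have af: "a \<bullet> f \<noteq> 0" using xf x0 by (simp add: a_def inner_commute)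
  have "\<bar>a \<bullet> e\<bar> \<noteq> 1"
  proof
    assume "\<bar>a \<bullet> e\<bar> = 1"
    then have "\<bar>a \<bullet> e\<bar> = norm a * norm e" using na ef(1) by simp
    then have "norm a *\<^sub>R e = norm e *\<^sub>R a \<or> norm a *\<^sub>R e = - norm e *\<^sub>R a"
      by (simp add: norm_cauchy_schwarz_abs_eq)
    then have "a = e \<or> a = - e" using na ef(1) by auto
    then have "a \<bullet> f = 0" using ef(3) by auto
    then show False using af by simp
  qed
  moreover have "inj_on (\<lambda>j. Q j \<bullet> a) I"
  proof (rule inj_onI, rule ccontr)
    fix i j assume ij: "i \<in> I" "j \<in> I" "Q i \<bullet> a = Q j \<bullet> a" "i \<noteq> j"
    then have "(Q i - Q j) \<bullet> a = 0" by (simp add: inner_diff_left)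
    then have "(Q i - Q j) \<bullet> x = 0" using x0 by (simp add: a_def)
    then show False using xQ ij by blast
  qed
  ultimately show ?thesis using na by blast
qed

section \<open>The map of punctured spaces provided by the condition on beta\<close>

text \<open>The glued map at height 1 is 0 on the boundary of the cube and so descends to the
  sphere. It is the representative of the sum of the inclusions to which \<open>cond_star\<close> is
  applied.\<close>

lemma wedge_sum_exists:
  assumes N: "N \<ge> 1"
  obtains A :: "real \<times> 'd::euclidean_space \<Rightarrow> real \<times> 'd" where
    "continuous_on (sphere 0 1) A" "A ` sphere 0 1 \<subseteq> wedge_spheres N"
    "\<And>x. x \<in> cbox 0 One \<Longrightarrow> A (cube_to_sphere x) = cube_sum N (\<lambda>j. wedge_incl j \<circ> cube_to_sphere) x"
proof -
  interpret based_sphere_maps N "wedge_incl :: nat \<Rightarrow> real \<times> 'd \<Rightarrow> _" "wedge_spheres N" 0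
    by (rule wedge_incl_based[OF N])
  define f where "f u = slab_glue N wedge_incl (1, u)" for u :: 'd
  have c: "continuous_on {u. infnorm u \<le> 1/2} f"
    unfolding f_def by (rule continuous_on_compose2[OF continuous_on_slab_glue]) (auto intro!: continuous_intros)
  have b: "f u = 0" if "infnorm u = 1/2" for u
    unfolding f_def
  proof (rule slab_glue_base, rule slab_map_base, rule disjI2)
    fix i assume "i < N"
    have "1 \<le> 2 * infnorm u" using that by linarith
    from infnorm_stretch_slab[OF N \<open>i < N\<close> this]
    show "1 \<le> 2 * infnorm (stretch N (snd (1::real, u) - slab_pos N i *\<^sub>R first_dir))" by simp
  qed
  obtain A where A: "continuous_on (sphere 0 1) A" "\<And>u. infnorm u \<le> 1/2 \<Longrightarrow> A (cap u) = f u"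
    using factor_through_cap[OF c b] by blast
  show thesis
  proof
    show "continuous_on (sphere 0 1) A" by fact
    show "A ` sphere 0 1 \<subseteq> wedge_spheres N"
    proof (rule image_subsetI)
      fix y :: "real \<times> 'd" assume "y \<in> sphere 0 1"
      then have "norm y = 1" by simp
      then obtain u where "infnorm u \<le> 1/2" "cap u = y" using cap_surj by blast
      then show "A y \<in> wedge_spheres N" using A(2) slab_glue_in unfolding f_def by metis
    qed
    show "A (cube_to_sphere x) = cube_sum N (\<lambda>j. wedge_incl j \<circ> cube_to_sphere) x" if x: "x \<in> cbox 0 One" for x
      using A(2)[of "x - (1/2) *\<^sub>R One"] slab_glue_top[OF x] x
      unfolding mem_unit_cube_iff f_def cube_to_sphere_eq_cap[OF x] by metis
  qed
qed

text \<open>A composite of four maps: \<open>\<tau>1\<close> moves P to the cone apexes, H glues the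
  maps \<open>gs j\<close> supplied by \<open>cond_star\<close> into a map to the wedge, W places
  the wedge around its punctures, \<open>\<tau>2\<close> moves these to Q. Near \<open>P j\<close>
  one sees \<open>gs j\<close>, which is homotopic to the j-th inclusion after beta. On a large
  sphere one sees the sum of the \<open>gs j\<close>, which by \<open>cond_star\<close> is homotopic
  to A after beta, and W turns A into a large sphere.\<close>

lemma punctured_space_map:
  fixes \<beta> :: "real \<times> 'k::euclidean_space \<Rightarrow> real \<times> 'n::euclidean_space"
    and N :: nat and P :: "nat \<Rightarrow> real \<times> 'k" and Q :: "nat \<Rightarrow> real \<times> 'n"
  assumes \<beta>: "continuous_on (sphere 0 1) \<beta>" "\<beta> ` sphere 0 1 \<subseteq> sphere 0 1" and star: "cond_star \<beta>"
    and N: "N \<ge> 1"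
    and P: "inj_on P {..<N}" and Q: "inj_on Q {..<N}"
  shows "\<exists>F. continuous_on (- P ` {..<N}) F \<and> F ` (- P ` {..<N}) \<subseteq> - Q ` {..<N} \<and>
     (\<forall>j<N. \<exists>e>0. \<forall>\<epsilon> \<delta>. 0 < \<epsilon> \<and> \<epsilon> < e \<and> 0 < \<delta> \<and> \<delta> < e \<longrightarrow>
        sphere_homotopic (- Q ` {..<N}) (\<lambda>x. F (P j + \<epsilon> *\<^sub>R x)) (\<lambda>x. Q j + \<delta> *\<^sub>R \<beta> x)) \<and>
     (\<exists>R0. \<forall>R S. R0 < R \<and> R0 < S \<longrightarrow> sphere_homotopic (- Q ` {..<N}) (\<lambda>x. F (R *\<^sub>R x)) (\<lambda>x. S *\<^sub>R \<beta> x))"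
proof -
  let ?I = "{..<N}"
  let ?Y = "wedge_spheres N :: (real \<times> 'n) set"
  obtain A :: "real \<times> 'n \<Rightarrow> real \<times> 'n" where A: "continuous_on (sphere 0 1) A" "A ` sphere 0 1 \<subseteq> ?Y"
    "\<And>x. x \<in> cbox 0 One \<Longrightarrow> A (cube_to_sphere x) = cube_sum N (\<lambda>j. wedge_incl j \<circ> cube_to_sphere) x"
    using wedge_sum_exists[OF N, where 'd='n] by blast
  obtain W :: "real \<times> 'n \<Rightarrow> real \<times> 'n" where W:
    "continuous_on ?Y W" "W ` ?Y \<subseteq> - wedge_points N"
    "\<And>j \<epsilon>. j < N \<Longrightarrow> 0 < \<epsilon> \<Longrightarrow> \<epsilon> * real N \<le> 1/4 \<Longrightarrow>
       sphere_homotopic (- wedge_points N) (\<lambda>y. W (wedge_incl j y)) (\<lambda>y. wedge_point N j + \<epsilon> *\<^sub>R y)"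
    "\<And>A R. continuous_on (sphere 0 1) A \<Longrightarrow> A ` sphere 0 1 \<subseteq> ?Y \<Longrightarrow> 
       (\<And>x. x \<in> cbox 0 One \<Longrightarrow> A (cube_to_sphere x) = cube_sum N (\<lambda>j. wedge_incl j \<circ> cube_to_sphere) x) \<Longrightarrow> R \<ge> 2 \<Longrightarrow>
       sphere_homotopic (- wedge_points N) (\<lambda>y. W (A y)) (\<lambda>y. R *\<^sub>R y)"
    using wedge_to_punctured[OF N, where 'd='n] by blast
  interpret B: based_sphere_maps N "wedge_incl :: nat \<Rightarrow> real \<times> 'n \<Rightarrow> _" ?Y 0
    by (rule wedge_incl_based[OF N])
  have "is_sphere_sum ?Y 0 N wedge_incl A"
    unfolding is_sphere_sum_def
  proof (intro exI[of _ wedge_incl] exI[of _ A] conjI allI impI ballI)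
    show "sphere_homotopic ?Y (wedge_incl j) (wedge_incl j)" if "j < N" for j
      by (rule sphere_homotopic_refl[OF B.gcont B.gZ]) (use that in auto)
    show "sphere_homotopic ?Y A A" by (rule sphere_homotopic_refl[OF A(1)]) (use A(2) in auto)
  qed (use A in auto)
  then have "is_sphere_sum ?Y 0 N (\<lambda>j. wedge_incl j \<circ> \<beta>) (A \<circ> \<beta>)"
    using star N unfolding cond_star_def by blast
  then obtain gs G where gs: "\<And>j. j < N \<Longrightarrow> sphere_homotopic ?Y (wedge_incl j \<circ> \<beta>) (gs j)"
      "\<And>j. j < N \<Longrightarrow> gs j sph_base = 0"
    and G: "continuous_on (sphere 0 1) G" "G ` sphere 0 1 \<subseteq> ?Y"
      "\<And>x. x \<in> cbox 0 One \<Longrightarrow> G (cube_to_sphere x) = cube_sum N (\<lambda>j. gs j \<circ> cube_to_sphere) x"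
      "sphere_homotopic ?Y (A \<circ> \<beta>) G"
    unfolding is_sphere_sum_def by blast
  interpret g: based_sphere_maps N gs ?Y 0
  proof
    fix j assume j: "j < N"
    show "continuous_on (sphere 0 1) (gs j)" using homotopic_with_imp_continuous[OF gs(1)[OF j]] by blast
    show "gs j y \<in> ?Y" if "norm y = 1" for y
      using homotopic_with_imp_subset2[OF gs(1)[OF j]] that by auto
  qed (use N gs in auto)
  define D where "D j = (0 :: real, slab_pos N j *\<^sub>R first_dir :: 'k)" for j
  have inj: "inj_on (slab_pos N) ?I"
  proof (rule inj_onI)
    fix i j assume "slab_pos N i = slab_pos N j"
    then have "(real i - real j) / real N = 0" using slab_pos_diff[OF N, of i j] by simp
    then show "i = j" using N by simp
  qed
  \<comment> \<open>The first direction separates the apexes, and likewise the wedge points, so it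
    is admissible for a shear at either end.\<close>
  have iD: "inj_on (\<lambda>j. D j \<bullet> (0, first_dir)) ?I" using inj by (simp add: D_def inner_prod_def)
  have iW: "inj_on (\<lambda>j. (wedge_point N j :: real \<times> 'n) \<bullet> (0, first_dir)) ?I"
    using inj by (simp add: wedge_point_def inner_prod_def inj_on_def)
  have nfd: "norm (0 :: real, first_dir :: 'k) = 1" "norm (0 :: real, first_dir :: 'n) = 1"
    "norm (1 :: real, 0 :: 'k) = 1" "norm (1 :: real, 0 :: 'n) = 1" by (simp_all add: norm_Pair)
  have perp: "(0 :: real, first_dir :: 'k) \<bullet> (1, 0) = 0" "(0 :: real, first_dir :: 'n) \<bullet> (1, 0) = 0"
    by (simp_all add: inner_prod_def)
  obtain a1 where a1: "norm a1 = 1" "\<bar>a1 \<bullet> (0, first_dir)\<bar> \<noteq> 1" "inj_on (\<lambda>j. P j \<bullet> a1) ?I"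
    using generic_direction[OF finite_lessThan P nfd(1,3) perp(1)] by blast
  obtain \<tau>1 where \<tau>1: "config_map ?I P D \<tau>1"
    using config_map_exists[OF finite_lessThan a1(1) nfd(1) a1(2) a1(3) iD] by blast
  obtain a2 where a2: "norm a2 = 1" "\<bar>a2 \<bullet> (0, first_dir)\<bar> \<noteq> 1" "inj_on (\<lambda>j. Q j \<bullet> a2) ?I"
    using generic_direction[OF finite_lessThan Q nfd(2,4) perp(2)] by blast
  have "\<bar>(0, first_dir) \<bullet> a2\<bar> \<noteq> 1" using a2(2) by (simp add: inner_commute)
  then obtain \<tau>2 where \<tau>2: "config_map ?I (wedge_point N) Q \<tau>2"
    using config_map_exists[OF finite_lessThan nfd(2) a2(1) _ iW a2(3)] by blast
  note t1 = config_mapD[OF \<tau>1] and t2 = config_mapD[OF \<tau>2]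
  define H where "H = slab_glue N gs"
  have H: "continuous_on (- D ` ?I) H" "H ` (- D ` ?I) \<subseteq> ?Y"
    using g.continuous_on_slab_glue g.slab_glue_in by (auto simp: H_def D_def)
  define F where "F x = \<tau>2 (W (H (\<tau>1 x)))" for x
  have cW: "continuous_on ?Y (\<lambda>z. \<tau>2 (W z))" by (rule continuous_on_compose2[OF t2(1) W(1,2)])
  have iW2: "(\<lambda>z. \<tau>2 (W z)) ` ?Y \<subseteq> - Q ` ?I" using t2(2) W(2) by (simp only: image_subset_iff) blast
  have cH: "continuous_on (- D ` ?I) (\<lambda>y. \<tau>2 (W (H y)))" by (rule continuous_on_compose2[OF cW H])
  have iH: "(\<lambda>y. \<tau>2 (W (H y))) ` (- D ` ?I) \<subseteq> - Q ` ?I" using iW2 H(2) by (simp only: image_subset_iff) blast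
  have left\<tau>: "sphere_homotopic (- Q ` ?I) (\<lambda>x. \<tau>2 (f x)) (\<lambda>x. \<tau>2 (g x))" 
    if "sphere_homotopic (- wedge_points N) f g" for f g :: "real \<times> 'k \<Rightarrow> _"
    by (rule sphere_homotopic_left[OF that t2(1,2)])
  have leftW: "sphere_homotopic (- Q ` ?I) (\<lambda>x. \<tau>2 (W (f x))) (\<lambda>x. \<tau>2 (W (g x)))" 
    if "sphere_homotopic ?Y f g" for f g :: "real \<times> 'k \<Rightarrow> _"
    by (rule sphere_homotopic_left[OF that cW iW2])
  have leftH: "sphere_homotopic (- Q ` ?I) (\<lambda>x. \<tau>2 (W (H (f x)))) (\<lambda>x. \<tau>2 (W (H (g x))))" 
    if "sphere_homotopic (- D ` ?I) f g" for f g :: "real \<times> 'k \<Rightarrow> _"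
    by (rule sphere_homotopic_left[OF that cH iH])
  note trans = homotopic_with_trans
  show ?thesis
  proof (intro exI[of _ F] conjI allI impI)
    show "continuous_on (- P ` ?I) F" unfolding F_def by (rule continuous_on_compose2[OF cH t1(1,2)])
    show "F ` (- P ` ?I) \<subseteq> - Q ` ?I" unfolding F_def using t1(2) iH by (simp only: image_subset_iff) blast
    fix j assume j: "j < N"
    then have jI: "j \<in> ?I" by simp
    obtain e1 where e1: "e1 > 0" "\<And>\<epsilon> \<delta>. 0 < \<epsilon> \<Longrightarrow> \<epsilon> < e1 \<Longrightarrow> 0 < \<delta> \<Longrightarrow> \<delta> < e1 \<Longrightarrow> 
      sphere_homotopic (- D ` ?I) (\<lambda>x. \<tau>1 (P j + \<epsilon> *\<^sub>R x)) (\<lambda>x. D j + \<delta> *\<^sub>R x)" using t1(3)[OF jI] by blast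
    obtain e2 where e2: "e2 > 0" "\<And>\<epsilon> \<delta>. 0 < \<epsilon> \<Longrightarrow> \<epsilon> < e2 \<Longrightarrow> 0 < \<delta> \<Longrightarrow> \<delta> < e2 \<Longrightarrow> 
      sphere_homotopic (- Q ` ?I) (\<lambda>x. \<tau>2 (wedge_point N j + \<epsilon> *\<^sub>R x)) (\<lambda>x. Q j + \<delta> *\<^sub>R x)" using t2(3)[OF jI] by blast
    define e where "e = min (min e1 e2) (1 / (4 * real N))"
    have e0: "e > 0" using e1 e2 N by (simp add: e_def)
    define \<rho> where "\<rho> = e / 2"
    have \<rho>: "0 < \<rho>" "\<rho> < e1" "\<rho> < e2" using e0 by (auto simp: \<rho>_def e_def)
    have "\<rho> \<le> e" using e0 by (simp add: \<rho>_def)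
    moreover have "e \<le> 1 / (4 * real N)" by (simp add: e_def)
    ultimately have "\<rho> \<le> 1 / (4 * real N)" by (rule order_trans)
    then have "\<rho> * real N \<le> 1 / (4 * real N) * real N" by (intro mult_right_mono) auto
    also have "\<dots> = 1/4" using N by simp
    finally have \<rho>N: "\<rho> * real N \<le> 1/4" .
    show "\<exists>e>0. \<forall>\<epsilon> \<delta>. 0 < \<epsilon> \<and> \<epsilon> < e \<and> 0 < \<delta> \<and> \<delta> < e \<longrightarrow>
        sphere_homotopic (- Q ` ?I) (\<lambda>x. F (P j + \<epsilon> *\<^sub>R x)) (\<lambda>x. Q j + \<delta> *\<^sub>R \<beta> x)"
    proof (intro exI[of _ e] conjI allI impI e0)
      fix \<epsilon> \<delta> assume a: "0 < \<epsilon> \<and> \<epsilon> < e \<and> 0 < \<delta> \<and> \<delta> < e"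
      have 1: "sphere_homotopic (- Q ` ?I) (\<lambda>x. F (P j + \<epsilon> *\<^sub>R x)) (\<lambda>x. \<tau>2 (W (H (D j + \<rho> *\<^sub>R x))))"
        unfolding F_def by (rule leftH, rule e1(2)) (use a \<rho> in \<open>auto simp: e_def\<close>)
      have 2: "sphere_homotopic (- Q ` ?I) (\<lambda>x. \<tau>2 (W (H (D j + \<rho> *\<^sub>R x)))) (\<lambda>x. \<tau>2 (W (gs j x)))"
        unfolding H_def D_def by (rule leftW, rule g.slab_glue_near[OF j \<rho>(1)]) (use \<rho>N in linarith)
      have "sphere_homotopic ?Y (gs j) (\<lambda>x. wedge_incl j (\<beta> x))"
        using homotopic_with_symD[OF gs(1)[OF j]] by (simp add: o_def)
      then have 3: "sphere_homotopic (- Q ` ?I) (\<lambda>x. \<tau>2 (W (gs j x))) (\<lambda>x. \<tau>2 (W (wedge_incl j (\<beta> x))))"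
        by (rule leftW)
      have 4: "sphere_homotopic (- Q ` ?I) (\<lambda>x. \<tau>2 (W (wedge_incl j (\<beta> x)))) (\<lambda>x. \<tau>2 (wedge_point N j + \<rho> *\<^sub>R \<beta> x))"
        by (rule left\<tau>, rule sphere_homotopic_right[OF W(3)[OF j \<rho>(1) \<rho>N] \<beta>])
      have "sphere_homotopic (- Q ` ?I) (\<lambda>x. \<tau>2 (wedge_point N j + \<rho> *\<^sub>R x)) (\<lambda>x. Q j + \<delta> *\<^sub>R x)"
        by (rule e2(2)) (use a \<rho> in \<open>auto simp: e_def\<close>)
      then have 5: "sphere_homotopic (- Q ` ?I) (\<lambda>x. \<tau>2 (wedge_point N j + \<rho> *\<^sub>R \<beta> x)) (\<lambda>x. Q j + \<delta> *\<^sub>R \<beta> x)"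
        by (rule sphere_homotopic_right[OF _ \<beta>])
      show "sphere_homotopic (- Q ` ?I) (\<lambda>x. F (P j + \<epsilon> *\<^sub>R x)) (\<lambda>x. Q j + \<delta> *\<^sub>R \<beta> x)"
        by (rule trans[OF 1 trans[OF 2 trans[OF 3 trans[OF 4 5]]]])
    qed
  next
    obtain R1 where R1: "\<And>R S. R1 < R \<Longrightarrow> R1 < S \<Longrightarrow> sphere_homotopic (- D ` ?I) (\<lambda>x. \<tau>1 (R *\<^sub>R x)) (\<lambda>x. S *\<^sub>R x)"
      using t1(4) by blast
    obtain R2 where R2: "\<And>R S. R2 < R \<Longrightarrow> R2 < S \<Longrightarrow> sphere_homotopic (- Q ` ?I) (\<lambda>x. \<tau>2 (R *\<^sub>R x)) (\<lambda>x. S *\<^sub>R x)"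
      using t2(4) by blast
    define R0 where "R0 = max (max R1 R2) (max 2 (1 + sqrt (real DIM('k))))"
    show "\<exists>R0. \<forall>R S. R0 < R \<and> R0 < S \<longrightarrow> sphere_homotopic (- Q ` ?I) (\<lambda>x. F (R *\<^sub>R x)) (\<lambda>x. S *\<^sub>R \<beta> x)"
    proof (intro exI[of _ R0] allI impI)
      fix R S assume RS: "R0 < R \<and> R0 < S"
      have 1: "sphere_homotopic (- Q ` ?I) (\<lambda>x. F (R *\<^sub>R x)) (\<lambda>x. \<tau>2 (W (H (R *\<^sub>R x))))"
        unfolding F_def by (rule leftH, rule R1) (use RS in \<open>auto simp: R0_def\<close>)
      have 2: "sphere_homotopic (- Q ` ?I) (\<lambda>x. \<tau>2 (W (H (R *\<^sub>R x)))) (\<lambda>x. \<tau>2 (W (G x)))"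
        unfolding H_def by (rule leftW, rule g.slab_glue_far[OF _ G(1,2,3)]) (use RS in \<open>auto simp: R0_def\<close>)
      have "sphere_homotopic ?Y G (\<lambda>x. A (\<beta> x))"
        using homotopic_with_symD[OF G(4)] by (simp add: o_def)
      then have 3: "sphere_homotopic (- Q ` ?I) (\<lambda>x. \<tau>2 (W (G x))) (\<lambda>x. \<tau>2 (W (A (\<beta> x))))" by (rule leftW)
      have "sphere_homotopic (- wedge_points N) (\<lambda>y. W (A y)) (\<lambda>y. R *\<^sub>R y)"
      proof (rule W(4)[OF A])
        have "2 \<le> R0" unfolding R0_def by (meson max.cobounded1 max.cobounded2 order_trans)
        then show "2 \<le> R" using RS by linarith
      qed
      then have 4: "sphere_homotopic (- Q ` ?I) (\<lambda>x. \<tau>2 (W (A (\<beta> x)))) (\<lambda>x. \<tau>2 (R *\<^sub>R \<beta> x))"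
        by (intro left\<tau>) (rule sphere_homotopic_right[OF _ \<beta>])
      have "sphere_homotopic (- Q ` ?I) (\<lambda>x. \<tau>2 (R *\<^sub>R x)) (\<lambda>x. S *\<^sub>R x)"
        by (rule R2) (use RS in \<open>auto simp: R0_def\<close>)
      then have 5: "sphere_homotopic (- Q ` ?I) (\<lambda>x. \<tau>2 (R *\<^sub>R \<beta> x)) (\<lambda>x. S *\<^sub>R \<beta> x)"
        by (rule sphere_homotopic_right[OF _ \<beta>])
      show "sphere_homotopic (- Q ` ?I) (\<lambda>x. F (R *\<^sub>R x)) (\<lambda>x. S *\<^sub>R \<beta> x)"
        by (rule trans[OF 1 trans[OF 2 trans[OF 3 trans[OF 4 5]]]])
    qed
  qed
qed

section \<open>Lipschitz extension and approximation\<close>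

text \<open>The constant is suppressed: it is tracked only in the self-similar iteration, where it
  must not grow.\<close>

definition lipschitz_map :: "'a::metric_space set \<Rightarrow> ('a \<Rightarrow> 'b::metric_space) \<Rightarrow> bool" where
  "lipschitz_map X f \<longleftrightarrow> (\<exists>L. L-lipschitz_on X f)"

lemma lipschitz_mapE:
  assumes "lipschitz_map X f"
  obtains L where "L > 0" "L-lipschitz_on X f"
proof -
  obtain M where M: "M-lipschitz_on X f" using assms by (auto simp: lipschitz_map_def)
  have "(max M 1)-lipschitz_on X f" by (rule lipschitz_on_mono[OF M]) auto
  then show thesis using that[of "max M 1"] by auto
qed

lemma lipschitz_map_bound:
  assumes "\<And>x y. x \<in> X \<Longrightarrow> y \<in> X \<Longrightarrow> dist (f x) (f y) \<le> C * dist x y"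
  shows "lipschitz_map X f"
proof -
  have "\<bar>C\<bar>-lipschitz_on X f"
  proof (rule lipschitz_onI)
    fix x y assume "x \<in> X" "y \<in> X"
    then have "dist (f x) (f y) \<le> C * dist x y" by (rule assms)
    also have "\<dots> \<le> \<bar>C\<bar> * dist x y" by (intro mult_right_mono) auto
    finally show "dist (f x) (f y) \<le> \<bar>C\<bar> * dist x y" .
  qed simp
  then show ?thesis by (auto simp: lipschitz_map_def)
qed

lemma lipschitz_map_continuous: "lipschitz_map X f \<Longrightarrow> continuous_on X f"
  by (auto simp: lipschitz_map_def intro: lipschitz_on_continuous_on)

lemma lipschitz_map_subset: "lipschitz_map X f \<Longrightarrow> Y \<subseteq> X \<Longrightarrow> lipschitz_map Y f"
  by (auto simp: lipschitz_map_def intro: lipschitz_on_subset)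

lemma lipschitz_map_cong: "lipschitz_map X f \<Longrightarrow> (\<And>x. x \<in> X \<Longrightarrow> g x = f x) \<Longrightarrow> lipschitz_map X g"
  unfolding lipschitz_map_def by (metis lipschitz_on_transform)

lemma lipschitz_map_compose:
  assumes "lipschitz_map Y g" "lipschitz_map X f" "f ` X \<subseteq> Y"
  shows "lipschitz_map X (\<lambda>x. g (f x))"
proof -
  obtain L where L: "L-lipschitz_on X f" using assms(2) by (auto simp: lipschitz_map_def)
  obtain M where "M-lipschitz_on Y g" using assms(1) by (auto simp: lipschitz_map_def)
  then have M: "M-lipschitz_on (f ` X) g" using assms(3) lipschitz_on_subset by blast
  show ?thesis unfolding lipschitz_map_def using lipschitz_on_compose2[OF L M] by blast
qed

lemma lipschitz_map_add:
  fixes f g :: "'a::metric_space \<Rightarrow> 'b::real_normed_vector"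
  shows "lipschitz_map X f \<Longrightarrow> lipschitz_map X g \<Longrightarrow> lipschitz_map X (\<lambda>x. f x + g x)"
  unfolding lipschitz_map_def using lipschitz_on_add by blast

lemma lipschitz_map_bounded_linear:
  assumes "bounded_linear h"
  shows "lipschitz_map X h"
proof -
  interpret bounded_linear h by fact
  obtain K where "\<And>x. norm (h x) \<le> norm x * K" using nonneg_bounded by blast
  then show ?thesis by (intro lipschitz_map_bound[of _ _ K]) (simp add: dist_norm diff[symmetric] mult.commute)
qed

lemma lipschitz_map_const: "lipschitz_map X (\<lambda>x. c)"
  by (auto simp: lipschitz_map_def intro: lipschitz_on_constant)

lemma lipschitz_map_components:
  fixes f :: "'a::metric_space \<Rightarrow> 'b::euclidean_space"
  assumes "\<And>b. b \<in> Basis \<Longrightarrow> lipschitz_map X (\<lambda>x. f x \<bullet> b)"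
  shows "lipschitz_map X f"
proof -
  obtain L where L: "\<And>b. b \<in> Basis \<Longrightarrow> (L b)-lipschitz_on X (\<lambda>x. f x \<bullet> b)"
    using assms unfolding lipschitz_map_def by metis
  show ?thesis
  proof (rule lipschitz_map_bound)
    fix x y assume xy: "x \<in> X" "y \<in> X"
    have "dist (f x) (f y) \<le> (\<Sum>b\<in>Basis. \<bar>(f x - f y) \<bullet> b\<bar>)"
      unfolding dist_norm by (rule norm_le_l1)
    also have "\<dots> \<le> (\<Sum>b\<in>Basis. L b * dist x y)"
      using lipschitz_onD[OF L xy] by (intro sum_mono) (simp add: dist_real_def inner_diff_left)
    finally show "dist (f x) (f y) \<le> (\<Sum>b\<in>Basis. L b) * dist x y" by (simp add: sum_distrib_right)
  qed
qed

lemma lipschitz_map_bounded_image: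
  fixes f :: "'a::metric_space \<Rightarrow> 'b::real_normed_vector"
  assumes "lipschitz_map X f" "bounded X"
  shows "\<exists>B\<ge>0. \<forall>x\<in>X. norm (f x) \<le> B"
proof (cases "X = {}")
  case False
  then obtain a where a: "a \<in> X" by blast
  obtain L where L: "L > 0" "L-lipschitz_on X f" by (rule lipschitz_mapE[OF assms(1)])
  obtain r where r: "\<And>x. x \<in> X \<Longrightarrow> dist a x \<le> r" using assms(2) bounded_any_center[of X a] by blast
  have "0 \<le> r" using r[OF a] by simp
  have "norm (f x) \<le> norm (f a) + L * r" if "x \<in> X" for x
  proof -
    have "dist (f x) (f a) \<le> L * dist x a" by (rule lipschitz_onD[OF L(2) that a])
    also have "\<dots> \<le> L * r" using r[OF that] L(1) by (simp add: dist_commute)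
    finally show ?thesis using norm_triangle_ineq2[of "f x" "f a"] by (simp add: dist_norm)
  qed
  moreover have "0 \<le> norm (f a) + L * r" using L(1) \<open>0 \<le> r\<close> by simp
  ultimately show ?thesis by blast
qed auto

lemma lipschitz_map_mult:
  fixes f g :: "'a::metric_space \<Rightarrow> real"
  assumes f: "lipschitz_map X f" and g: "lipschitz_map X g" and X: "bounded X"
  shows "lipschitz_map X (\<lambda>x. f x * g x)"
proof -
  obtain L where L: "L > 0" "L-lipschitz_on X f" by (rule lipschitz_mapE[OF f])
  obtain M where M: "M > 0" "M-lipschitz_on X g" by (rule lipschitz_mapE[OF g])
  obtain B where B: "B \<ge> 0" "\<And>x. x \<in> X \<Longrightarrow> norm (f x) \<le> B" by (use lipschitz_map_bounded_image[OF f X] in blast)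
  obtain C where C: "C \<ge> 0" "\<And>x. x \<in> X \<Longrightarrow> norm (g x) \<le> C" by (use lipschitz_map_bounded_image[OF g X] in blast)
  show ?thesis
  proof (rule lipschitz_map_bound)
    fix x y assume xy: "x \<in> X" "y \<in> X"
    have "f x * g x - f y * g y = f x * (g x - g y) + (f x - f y) * g y" by (simp add: algebra_simps)
    then have "dist (f x * g x) (f y * g y) \<le> \<bar>f x\<bar> * \<bar>g x - g y\<bar> + \<bar>f x - f y\<bar> * \<bar>g y\<bar>"
      unfolding dist_real_def by (metis abs_mult abs_triangle_ineq)
    also have "\<dots> \<le> B * (M * dist x y) + (L * dist x y) * C"
      using B C L M xy lipschitz_onD[OF L(2) xy] lipschitz_onD[OF M(2) xy]
      by (intro add_mono mult_mono) (auto simp: dist_real_def)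
    finally show "dist (f x * g x) (f y * g y) \<le> (B * M + L * C) * dist x y" by (simp add: algebra_simps)
  qed
qed

lemma lipschitz_map_polynomial:
  fixes f :: "'a::euclidean_space \<Rightarrow> 'b::euclidean_space"
  assumes "polynomial_function f" "bounded X"
  shows "lipschitz_map X f"
proof (rule lipschitz_map_components)
  have "lipschitz_map X g" if "real_polynomial_function g" for g :: "'a \<Rightarrow> real"
    using that
    by induction (auto intro: lipschitz_map_bounded_linear lipschitz_map_const lipschitz_map_add
        lipschitz_map_mult assms(2))
  moreover have "real_polynomial_function (\<lambda>x. f x \<bullet> b)" for b
    using assms(1) bounded_linear_inner_left[of b] by (auto simp: polynomial_function_def o_def)
  ultimately show "lipschitz_map X (\<lambda>x. f x \<bullet> b)" for b by blast
qed

text \<open>McShane's formula: the infimum over a in A of f a + L \<open>dist x a\<close>.\<close>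

lemma lipschitz_extension_real:
  fixes f :: "'a::metric_space \<Rightarrow> real"
  assumes "lipschitz_map A f"
  shows "\<exists>g. lipschitz_map UNIV g \<and> (\<forall>x\<in>A. g x = f x)"
proof (cases "A = {}")
  case True
  then show ?thesis using lipschitz_map_const[of UNIV 0] by blast
next
  case False
  then obtain a0 where a0: "a0 \<in> A" by blast
  obtain L where L: "L > 0" "L-lipschitz_on A f" by (rule lipschitz_mapE[OF assms])
  have Lf: "f a \<le> f b + L * dist a b" if "a \<in> A" "b \<in> A" for a b
    using lipschitz_onD[OF L(2) that] by (auto simp: dist_real_def abs_le_iff)
  define g where "g x = (INF a\<in>A. f a + L * dist x a)" for x
  have tri: "L * dist x a \<le> L * dist x y + L * dist y a" for x y a
    using dist_triangle[of x a y] L(1) by (metis distrib_left mult_le_cancel_left_pos)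
  have bdd: "bdd_below ((\<lambda>a. f a + L * dist x a) ` A)" for x
  proof (rule bdd_belowI2)
    fix a assume "a \<in> A"
    show "f a0 - L * dist x a0 \<le> f a + L * dist x a"
      using Lf[OF a0 \<open>a \<in> A\<close>] tri[of a0 a x] by (simp add: dist_commute)
  qed
  have le: "g x \<le> f a + L * dist x a" if "a \<in> A" for x a
    unfolding g_def by (rule cINF_lower[OF bdd that])
  have one: "g x \<le> g y + L * dist x y" for x y
  proof -
    have "g x - L * dist x y \<le> (INF a\<in>A. f a + L * dist y a)"
    proof (rule cINF_greatest[OF False])
      fix a assume "a \<in> A"
      show "g x - L * dist x y \<le> f a + L * dist y a"
        using le[OF \<open>a \<in> A\<close>, of x] tri[of x a y] by linarith
    qed
    then show ?thesis by (simp add: g_def)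
  qed
  show ?thesis
  proof (intro exI[of _ g] conjI ballI)
    show "lipschitz_map UNIV g"
    proof (rule lipschitz_map_bound)
      show "dist (g x) (g y) \<le> L * dist x y" for x y
        using one[of x y] one[of y x] by (simp add: dist_real_def abs_le_iff dist_commute)
    qed
    fix x assume x: "x \<in> A"
    have "f x \<le> g x" unfolding g_def
      by (rule cINF_greatest[OF False]) (use Lf[OF x] in auto)
    then show "g x = f x" using le[OF x, of x] by simp
  qed
qed

lemma lipschitz_extension:
  fixes f :: "'a::metric_space \<Rightarrow> 'b::euclidean_space"
  assumes "lipschitz_map A f"
  shows "\<exists>g. lipschitz_map UNIV g \<and> (\<forall>x\<in>A. g x = f x)"
proof -
  have "\<exists>g. lipschitz_map UNIV g \<and> (\<forall>x\<in>A. g x = f x \<bullet> b)" for b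
  proof -
    have "lipschitz_map A (\<lambda>x. f x \<bullet> b)"
      using lipschitz_map_compose[OF lipschitz_map_bounded_linear[OF bounded_linear_inner_left] assms subset_UNIV] .
    from lipschitz_extension_real[OF this] show ?thesis .
  qed
  then obtain g where g: "\<And>b. lipschitz_map UNIV (g b)" "\<And>b x. x \<in> A \<Longrightarrow> g b x = f x \<bullet> b" by metis
  show ?thesis
  proof (intro exI[of _ "\<lambda>x. \<Sum>b\<in>Basis. g b x *\<^sub>R b"] conjI ballI)
    show "lipschitz_map UNIV (\<lambda>x. \<Sum>b\<in>Basis. g b x *\<^sub>R b)"
      by (rule lipschitz_map_components) (simp add: g)
    show "(\<Sum>b\<in>Basis. g b x *\<^sub>R b) = f x" if "x \<in> A" for x
      using g(2)[OF that] by (simp add: euclidean_representation)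
  qed
qed

text \<open>Kills [-e, e] and pulls everything else towards 0 by e. It makes an approximation exact
  where the approximated function vanishes.\<close>

definition soft_threshold :: "real \<Rightarrow> real \<Rightarrow> real" where
  "soft_threshold e t = t - max (- e) (min e t)"

lemma soft_threshold:
  assumes "e > 0"
  shows "\<bar>t\<bar> \<le> e \<Longrightarrow> soft_threshold e t = 0" "\<bar>soft_threshold e t - t\<bar> \<le> e"
    "\<bar>soft_threshold e s - soft_threshold e t\<bar> \<le> 2 * \<bar>s - t\<bar>"
  using assms by (auto simp: soft_threshold_def max_def min_def abs_if split: if_splits)

text \<open>Subtract a Lipschitz extension E of f from A and approximate the rest by a polynomial h
  within d. The rest vanishes on A, so there the components of h are below d and soft thresholding
  annihilates them.\<close>

lemma lipschitz_approximation_rel: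
  fixes f :: "'a::euclidean_space \<Rightarrow> 'b::euclidean_space"
  assumes X: "compact X" and f: "continuous_on X f" and A: "A \<subseteq> X" "lipschitz_map A f" and "e > 0"
  shows "\<exists>g. lipschitz_map X g \<and> (\<forall>x\<in>A. g x = f x) \<and> (\<forall>x\<in>X. norm (g x - f x) \<le> e)"
proof -
  obtain E where E: "lipschitz_map UNIV E" "\<And>x. x \<in> A \<Longrightarrow> E x = f x" using lipschitz_extension[OF A(2)] by blast
  \<comment> \<open>Thresholding costs d in each coordinate, the polynomial another d.\<close>
  define d where "d = e / (1 + real DIM('b))"
  have d: "d > 0" "d * (1 + real DIM('b)) = e" using \<open>e > 0\<close> by (auto simp: d_def add_nonneg_eq_0_iff)
  have cD: "continuous_on X (\<lambda>x. f x - E x)"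
    by (intro continuous_intros f continuous_on_subset[OF lipschitz_map_continuous[OF E(1)]]) auto
  obtain h where h: "polynomial_function h" "\<And>x. x \<in> X \<Longrightarrow> norm (f x - E x - h x) < d"
    using Stone_Weierstrass_polynomial_function[OF X cD d(1)] by blast
  define s where "s x = (\<Sum>b\<in>Basis. soft_threshold d (h x \<bullet> b) *\<^sub>R b)" for x
  have sb: "s x \<bullet> b = soft_threshold d (h x \<bullet> b)" if "b \<in> Basis" for x b
    using that by (simp add: s_def)
  have lh: "lipschitz_map X h" by (rule lipschitz_map_polynomial[OF h(1) compact_imp_bounded[OF X]])
  have ls: "lipschitz_map UNIV (soft_threshold d)"
    by (rule lipschitz_map_bound[of _ _ 2]) (use soft_threshold(3)[OF d(1)] in \<open>simp add: dist_real_def\<close>)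
  have "lipschitz_map X s"
  proof (rule lipschitz_map_components)
    fix b :: 'b assume b: "b \<in> Basis"
    have "lipschitz_map X (\<lambda>x. h x \<bullet> b)"
      by (rule lipschitz_map_compose[OF lipschitz_map_bounded_linear[OF bounded_linear_inner_left] lh subset_UNIV])
    then have "lipschitz_map X (\<lambda>x. soft_threshold d (h x \<bullet> b))"
      by (rule lipschitz_map_compose[OF ls _ subset_UNIV])
    then show "lipschitz_map X (\<lambda>x. s x \<bullet> b)" by (simp add: sb[OF b])
  qed
  show ?thesis
  proof (intro exI[of _ "\<lambda>x. E x + s x"] conjI ballI)
    show "lipschitz_map X (\<lambda>x. E x + s x)"
      by (rule lipschitz_map_add[OF lipschitz_map_subset[OF E(1)] \<open>lipschitz_map X s\<close>]) simp
    show "E x + s x = f x" if x: "x \<in> A" for x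
    proof -
      have n: "norm (h x) < d" using h(2)[of x] E(2)[OF x] A(1) x by auto
      have zero: "s x \<bullet> b = 0" if b: "b \<in> Basis" for b
      proof -
        have "\<bar>h x \<bullet> b\<bar> \<le> d" using Basis_le_norm[OF b, of "h x"] n by linarith
        then show ?thesis using soft_threshold(1)[OF d(1)] sb[OF b] by simp
      qed
      have "s x = 0" by (rule euclidean_eqI) (simp add: zero)
      then show ?thesis using E(2)[OF x] by simp
    qed
    show "norm (E x + s x - f x) \<le> e" if x: "x \<in> X" for x
    proof -
      have "norm (s x - h x) \<le> (\<Sum>b\<in>Basis. \<bar>(s x - h x) \<bullet> b\<bar>)" by (rule norm_le_l1)
      also have "\<dots> \<le> (\<Sum>b\<in>(Basis::'b set). d)"
        using soft_threshold(2)[OF d(1)] by (intro sum_mono) (simp add: inner_diff_left sb)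
      finally have "norm (s x - h x) \<le> real DIM('b) * d" by simp
      moreover have "norm (E x + s x - f x) \<le> norm (s x - h x) + norm (f x - E x - h x)"
        using norm_triangle_ineq4[of "s x - h x" "f x - E x - h x"] by (simp add: algebra_simps)
      ultimately have "norm (E x + s x - f x) \<le> d * (1 + real DIM('b))"
        using h(2)[OF x] by (simp add: algebra_simps)
      then show ?thesis unfolding d(2) .
    qed
  qed
qed

section \<open>Pushing into the cubical grid\<close>

lemma lipschitz_map_infnorm: "lipschitz_map X (infnorm :: 'a::euclidean_space \<Rightarrow> real)"
  by (rule lipschitz_map_bound[of _ _ 1])
     (use absdiff_infnorm infnorm_le_norm in \<open>auto simp: dist_norm intro: order_trans\<close>)

lemma lipschitz_map_rescale:
  fixes X :: "'a::euclidean_space set"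
  assumes X: "bounded X" and \<nu>: "lipschitz_map X \<nu>" and c: "c > 0" "\<And>x. x \<in> X \<Longrightarrow> c \<le> \<nu> x"
  shows "lipschitz_map X (\<lambda>x. inverse (\<nu> x) *\<^sub>R x)"
proof -
  have pos: "\<nu> x > 0" if "x \<in> X" for x using c that less_le_trans by blast
  have "lipschitz_map X (\<lambda>x. inverse (\<nu> x))"
  proof -
    obtain L where L: "L > 0" "L-lipschitz_on X \<nu>" by (rule lipschitz_mapE[OF \<nu>])
    show ?thesis
    proof (rule lipschitz_map_bound)
      fix x y assume xy: "x \<in> X" "y \<in> X"
      have "inverse (\<nu> x) - inverse (\<nu> y) = (\<nu> y - \<nu> x) * (inverse (\<nu> x) * inverse (\<nu> y))"
        using pos[OF xy(1)] pos[OF xy(2)] by (simp add: field_simps)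
      then have "dist (inverse (\<nu> x)) (inverse (\<nu> y)) = dist (\<nu> x) (\<nu> y) * (inverse (\<nu> x) * inverse (\<nu> y))"
        using pos[OF xy(1)] pos[OF xy(2)] by (simp add: dist_real_def abs_mult abs_minus_commute)
      also have "\<dots> \<le> (L * dist x y) * (inverse c * inverse c)"
        using lipschitz_onD[OF L(2) xy] c xy pos L(1)
        by (intro mult_mono le_imp_inverse_le mult_nonneg_nonneg) (auto simp: less_imp_le)
      finally show "dist (inverse (\<nu> x)) (inverse (\<nu> y)) \<le> (L * (inverse c * inverse c)) * dist x y"
        by (simp add: ac_simps)
    qed
  qed
  note inv = this
  show ?thesis
  proof (rule lipschitz_map_components)
    fix b :: 'a
    have "lipschitz_map X (\<lambda>x. x \<bullet> b)" by (rule lipschitz_map_bounded_linear[OF bounded_linear_inner_left])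
    from lipschitz_map_mult[OF inv this X] show "lipschitz_map X (\<lambda>x. (inverse (\<nu> x) *\<^sub>R x) \<bullet> b)"
      by simp
  qed
qed

text \<open>The codimension one skeleton of the unit cubes with integer vertices.\<close>

definition grid :: "'a::euclidean_space set" where
  "grid = {y. \<exists>b\<in>Basis. y \<bullet> b \<in> \<int>}"

lemma negligible_grid: "negligible (grid :: 'a::euclidean_space set)"
proof -
  have "grid = (\<Union>b\<in>Basis. \<Union>i::int. {y::'a. y \<bullet> b = of_int i})"
    by (auto simp: grid_def Ints_def)
  moreover have "negligible (\<Union>i::int. {y::'a. y \<bullet> b = of_int i})" if "b \<in> Basis" for b
    by (intro negligible_countable_Union) (use negligible_standard_hyperplane[OF that] in auto)
  then have "negligible (\<Union>b\<in>Basis. \<Union>i::int. {y::'a. y \<bullet> b = of_int i})"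
    by (intro negligible_Union finite_imageI finite_Basis) blast
  ultimately show ?thesis by simp
qed

lemma interior_grid: "interior (grid :: 'a::euclidean_space set) = {}"
  using negligible_grid open_not_negligible[of "interior (grid :: 'a set)"] negligible_subset interior_subset by blast

definition cell_center :: "'a::euclidean_space \<Rightarrow> 'a" where
  "cell_center y = (\<Sum>b\<in>Basis. (of_int \<lfloor>y \<bullet> b\<rfloor> + 1/2) *\<^sub>R b)"

text \<open>On the unit cell about 0, for 0 < \<open>\<eta>\<close> <= 1: the identity on the
  boundary, radial projection to the boundary where 2 \<open>infnorm z\<close> >=
  \<open>\<eta>\<close>, and dilation by 1/\<open>\<eta>\<close> on the small cube that
  remains.\<close>

definition radial :: "real \<Rightarrow> 'a::euclidean_space \<Rightarrow> 'a" where
  "radial \<eta> z = inverse (max \<eta> (2 * infnorm z)) *\<^sub>R z"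

text \<open>For \<open>\<eta> > 0\<close> this is a Lipschitz modification, near the centres of the cells, of the radial
  projection of each cell onto its boundary.\<close>
definition cell_push :: "real \<Rightarrow> 'a::euclidean_space \<Rightarrow> 'a" where
  "cell_push \<eta> y = cell_center y + radial \<eta> (y - cell_center y)"

lemma cell_center_component: "b \<in> Basis \<Longrightarrow> cell_center y \<bullet> b = of_int \<lfloor>y \<bullet> b\<rfloor> + 1/2"
  by (simp add: cell_center_def)

lemma infnorm_cell: "infnorm (y - cell_center y) \<le> 1/2"
  unfolding infnorm_le_iff
proof
  fix b :: 'a assume b: "b \<in> Basis"
  have "(y - cell_center y) \<bullet> b = y \<bullet> b - of_int \<lfloor>y \<bullet> b\<rfloor> - 1/2"
    using b by (simp add: inner_diff_left cell_center_component)
  moreover have "of_int \<lfloor>y \<bullet> b\<rfloor> \<le> y \<bullet> b" "y \<bullet> b < of_int \<lfloor>y \<bullet> b\<rfloor> + 1" by linarith+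
  ultimately show "\<bar>(y - cell_center y) \<bullet> b\<bar> \<le> 1/2" unfolding abs_le_iff by linarith
qed

lemma infnorm_cell_grid:
  assumes "y \<in> grid"
  shows "1/2 \<le> infnorm (y - cell_center y)"
proof -
  obtain b where b: "b \<in> Basis" "y \<bullet> b \<in> \<int>" using assms by (auto simp: grid_def)
  have "(y - cell_center y) \<bullet> b = y \<bullet> b - of_int \<lfloor>y \<bullet> b\<rfloor> - 1/2"
    using b by (simp add: inner_diff_left cell_center_component)
  also have "\<dots> = -1/2" using b(2) by (auto simp: Ints_def)
  finally have "\<bar>(y - cell_center y) \<bullet> b\<bar> = 1/2" by simp
  then show ?thesis using Basis_le_infnorm[OF b(1), of "y - cell_center y"] by linarith
qed

lemma radial_eq: "1/2 = infnorm z \<Longrightarrow> \<eta> \<le> 1 \<Longrightarrow> radial \<eta> z = z"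
proof -
  assume "1/2 = infnorm z" "\<eta> \<le> 1"
  then have "2 * infnorm z = 1" by simp
  then have "max \<eta> (2 * infnorm z) = 1" using \<open>\<eta> \<le> 1\<close> by (simp only: max_absorb2)
  then show ?thesis by (simp only: radial_def inverse_1 scaleR_one)
qed

lemma cell_push_grid_eq:
  assumes "y \<in> grid" "\<eta> \<le> 1"
  shows "cell_push \<eta> y = y"
proof -
  have "1/2 = infnorm (y - cell_center y)" using infnorm_cell[of y] infnorm_cell_grid[OF assms(1)] by linarith
  from radial_eq[OF this assms(2)] show ?thesis by (simp add: cell_push_def)
qed

lemma cell_push_in_grid:
  assumes "0 < \<eta>" "\<eta> \<le> 2 * infnorm (y - cell_center y)"
  shows "cell_push \<eta> y \<in> grid"
proof -
  define z where "z = y - cell_center y"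
  obtain b where b: "b \<in> Basis" "infnorm z = \<bar>z \<bullet> b\<bar>" by (rule infnorm_attained)
  have z0: "\<bar>z \<bullet> b\<bar> > 0" using assms b(2) by (simp add: z_def)
  have m: "max \<eta> (2 * infnorm z) = 2 * \<bar>z \<bullet> b\<bar>" using assms b(2) by (simp add: z_def max_def)
  have e: "cell_push \<eta> y \<bullet> b = of_int \<lfloor>y \<bullet> b\<rfloor> + 1/2 + inverse (2 * \<bar>z \<bullet> b\<bar>) * (z \<bullet> b)"
    using b(1) by (simp add: cell_push_def radial_def m z_def[symmetric] inner_add_left cell_center_component)
  have "inverse (2 * \<bar>z \<bullet> b\<bar>) * (z \<bullet> b) = 1/2 \<or> inverse (2 * \<bar>z \<bullet> b\<bar>) * (z \<bullet> b) = -1/2"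
    using z0 by (cases "z \<bullet> b > 0") (auto simp: field_simps)
  then have "cell_push \<eta> y \<bullet> b = of_int (\<lfloor>y \<bullet> b\<rfloor> + 1) \<or> cell_push \<eta> y \<bullet> b = of_int \<lfloor>y \<bullet> b\<rfloor>"
    unfolding e by auto
  then have "cell_push \<eta> y \<bullet> b \<in> \<int>" by (metis Ints_of_int)
  then show ?thesis using b(1) by (auto simp: grid_def)
qed

text \<open>The displacement k is Lipschitz on a closed cell and would vanish on its boundary. For
  points with different cells, the displacement of each is compared with the zero displacement at
  the point where the segment to the other leaves its cell.\<close>

lemma lipschitz_map_cell_push:
  assumes "0 < \<eta>" "\<eta> \<le> 1"
  shows "lipschitz_map UNIV (cell_push \<eta> :: 'a::euclidean_space \<Rightarrow> 'a)"
proof -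
  define C :: "'a set" where "C = {z. infnorm z \<le> 1/2}"
  have bC: "bounded C"
  proof (rule boundedI)
    fix z assume "z \<in> C"
    then have "infnorm z \<le> 1/2" by (simp add: C_def)
    moreover have "norm z \<le> sqrt (real DIM('a)) * infnorm z" by (rule norm_le_infnorm)
    ultimately show "norm z \<le> sqrt (real DIM('a)) * (1/2)" by (meson mult_left_mono order_trans real_sqrt_ge_0_iff of_nat_0_le_iff)
  qed
  have mx: "lipschitz_map C (\<lambda>z. max \<eta> (2 * infnorm z))"
  proof -
    obtain L where L: "L > 0" "L-lipschitz_on C (infnorm :: 'a \<Rightarrow> real)" by (rule lipschitz_mapE[OF lipschitz_map_infnorm])
    show ?thesis
    proof (rule lipschitz_map_bound)
      fix x y assume xy: "x \<in> C" "y \<in> C"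
      have "dist (max \<eta> (2 * infnorm x)) (max \<eta> (2 * infnorm y)) \<le> 2 * dist (infnorm x) (infnorm y)"
        by (simp add: dist_real_def max_def abs_if)
      also have "\<dots> \<le> 2 * (L * dist x y)" using lipschitz_onD[OF L(2) xy] by simp
      finally show "dist (max \<eta> (2 * infnorm x)) (max \<eta> (2 * infnorm y)) \<le> (2 * L) * dist x y" by simp
    qed
  qed
  have "lipschitz_map C (radial \<eta>)"
    unfolding radial_def by (rule lipschitz_map_rescale[OF bC mx assms(1)]) simp
  then obtain M where M: "M > 0" "M-lipschitz_on C (radial \<eta>)" by (rule lipschitz_mapE)
  define h where "h z = radial \<eta> z - z" for z :: 'a
  have h: "norm (h z - h w) \<le> (M + 1) * norm (z - w)" if "z \<in> C" "w \<in> C" for z w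
  proof -
    have "norm (h z - h w) \<le> norm (radial \<eta> z - radial \<eta> w) + norm (z - w)"
      using norm_triangle_ineq4[of "radial \<eta> z - radial \<eta> w" "z - w"] by (simp add: h_def algebra_simps)
    then show ?thesis using lipschitz_onD[OF M(2) that] by (simp add: dist_norm algebra_simps)
  qed
  define k where "k y = h (y - cell_center y)" for y
  have push: "cell_push \<eta> y = y + k y" for y by (simp add: cell_push_def k_def h_def)
  have small: "norm (k y) \<le> (M + 1) * norm (x - y)" if ne: "cell_center x \<noteq> cell_center y" for x y
  proof -
    define c where "c = cell_center y"
    have "\<exists>b\<in>Basis. cell_center x \<bullet> b \<noteq> c \<bullet> b" using ne by (auto simp: c_def euclidean_eq_iff[where 'a='a])
    then obtain b where b: "b \<in> Basis" "cell_center x \<bullet> b \<noteq> c \<bullet> b" by blast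
    then have fl: "\<lfloor>x \<bullet> b\<rfloor> \<noteq> \<lfloor>y \<bullet> b\<rfloor>" by (auto simp: c_def cell_center_component)
    have "(x - c) \<bullet> b = x \<bullet> b - of_int \<lfloor>y \<bullet> b\<rfloor> - 1/2" using b(1) by (simp add: c_def inner_diff_left cell_center_component)
    moreover have "x \<bullet> b < of_int \<lfloor>y \<bullet> b\<rfloor> \<or> x \<bullet> b \<ge> of_int \<lfloor>y \<bullet> b\<rfloor> + 1" using fl by linarith
    ultimately have "\<bar>(x - c) \<bullet> b\<bar> \<ge> 1/2" by linarith
    then have far: "1/2 \<le> infnorm (x - c)" using Basis_le_infnorm[OF b(1), of "x - c"] by linarith
    have near: "infnorm (y - c) \<le> 1/2" unfolding c_def by (rule infnorm_cell)
    have ct: "continuous_on {0..1} (\<lambda>t::real. infnorm (y + t *\<^sub>R (x - y) - c))" by (intro continuous_intros)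
    \<comment> \<open>y is in the closed cell about c and x is not in its interior, so the segment
      meets the boundary.\<close>
    have "\<exists>t\<ge>0. t \<le> 1 \<and> infnorm (y + t *\<^sub>R (x - y) - c) = 1/2"
      by (rule IVT'[OF _ _ _ ct]) (use near far in auto)
    then obtain t where t: "0 \<le> t" "t \<le> 1" "infnorm (y + t *\<^sub>R (x - y) - c) = 1/2" by blast
    define w where "w = y + t *\<^sub>R (x - y) - c"
    have iw: "infnorm w = 1/2" using t(3) by (simp only: w_def)
    have "h w = 0" unfolding h_def using radial_eq[OF iw[symmetric] assms(2)] by simp
    then have "norm (k y) = norm (h (y - c) - h w)" by (simp add: k_def c_def)
    also have "\<dots> \<le> (M + 1) * norm (y - c - w)" 
      by (rule h) (use near iw in \<open>auto simp: C_def\<close>)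
    also have "norm (y - c - w) = t * norm (x - y)" using t(1) by (simp add: w_def)
    also have "(M + 1) * (t * norm (x - y)) \<le> (M + 1) * norm (x - y)"
      using M(1) t by (intro mult_left_mono) (auto intro: mult_left_le_one_le)
    finally show ?thesis .
  qed
  have k: "norm (k x - k y) \<le> 2 * (M + 1) * norm (x - y)" for x y
  proof (cases "cell_center x = cell_center y")
    case True
    have "norm (k x - k y) \<le> (M + 1) * norm ((x - cell_center x) - (y - cell_center y))"
      unfolding k_def by (rule h) (use infnorm_cell in \<open>auto simp: C_def\<close>)
    also have "\<dots> = (M + 1) * norm (x - y)" by (simp add: True)
    also have "\<dots> \<le> 2 * (M + 1) * norm (x - y)" using M(1) by (intro mult_right_mono) auto
    finally show ?thesis .
  next
    case False
    have "norm (k x - k y) \<le> norm (k x) + norm (k y)" by (rule norm_triangle_ineq4)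
    also have "\<dots> \<le> (M + 1) * norm (y - x) + (M + 1) * norm (x - y)"
      by (intro add_mono small) (use False in auto)
    finally show ?thesis by (simp add: norm_minus_commute algebra_simps)
  qed
  have "lipschitz_map UNIV k" by (rule lipschitz_map_bound[of _ _ "2 * (M + 1)"]) (simp only: dist_norm k)
  then have "lipschitz_map UNIV (\<lambda>y. y + k y)"
    by (intro lipschitz_map_add) (auto simp: lipschitz_map_def intro: lipschitz_on_id)
  then show ?thesis by (rule lipschitz_map_cong) (simp add: push)
qed

section \<open>The cells of the large cube and maps that avoid their centres\<close>

definition cell_centers :: "nat \<Rightarrow> 'a::euclidean_space set" where
  "cell_centers p = {c. \<forall>b\<in>Basis. \<exists>i::int. - int p \<le> i \<and> i < int p \<and> c \<bullet> b = of_int i + 1/2}"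

lemma cell_centers_card:
  "finite (cell_centers p :: 'a::euclidean_space set)" "card (cell_centers p :: 'a set) \<le> (2 * p) ^ DIM('a)"
proof -
  let ?f = "\<lambda>i :: 'a \<Rightarrow> int. \<Sum>b\<in>Basis. (of_int (i b) + 1/2) *\<^sub>R b"
  let ?S = "Basis \<rightarrow>\<^sub>E {- int p..<int p} :: ('a \<Rightarrow> int) set"
  have sub: "cell_centers p \<subseteq> ?f ` ?S"
  proof
    fix c :: 'a assume "c \<in> cell_centers p"
    then have "\<forall>b\<in>Basis. \<exists>i::int. - int p \<le> i \<and> i < int p \<and> c \<bullet> b = of_int i + 1/2"
      unfolding cell_centers_def by blast
    from bchoice[OF this] obtain i where i: "\<And>b. b \<in> Basis \<Longrightarrow> - int p \<le> i b \<and> i b < int p \<and> c \<bullet> b = of_int (i b) + 1/2"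
      by blast
    have "c = ?f (restrict i Basis)"
      by (rule euclidean_eqI) (use i in simp)
    moreover have "restrict i Basis \<in> ?S" using i by auto
    ultimately show "c \<in> ?f ` ?S" by blast
  qed
  have fin: "finite ?S" by (intro finite_PiE) auto
  show "finite (cell_centers p :: 'a set)" using finite_subset[OF sub] fin by blast
  have "card (cell_centers p :: 'a set) \<le> card (?f ` ?S)" by (intro card_mono sub finite_imageI fin)
  also have "\<dots> \<le> card ?S" by (rule card_image_le[OF fin])
  also have "card ?S = (2 * p) ^ DIM('a)"
  proof -
    have c: "card {- int p..<int p} = 2 * p" unfolding card_atLeastLessThan_int by linarith
    show ?thesis unfolding card_PiE[OF finite_Basis] c by (rule prod_constant)
  qed
  finally show "card (cell_centers p :: 'a set) \<le> (2 * p) ^ DIM('a)" .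
qed

definition big_cube :: "nat \<Rightarrow> 'a::euclidean_space set" where
  "big_cube p = {y. infnorm y \<le> real p}"

lemma big_cube_cbox: "big_cube p = cbox (- real p *\<^sub>R One) (real p *\<^sub>R One)"
proof -
  have "\<bar>x \<bullet> b\<bar> \<le> real p \<longleftrightarrow> (- real p *\<^sub>R One) \<bullet> b \<le> x \<bullet> b \<and> x \<bullet> b \<le> (real p *\<^sub>R One) \<bullet> b" 
    if "b \<in> Basis" for x b :: 'a
    using that by (auto simp: abs_le_iff)
  then show ?thesis unfolding big_cube_def infnorm_le_iff cbox_def by blast
qed

text \<open>The floor assigns points on the upper faces to cells beyond the cube. Such points lie on
  the grid, so they have sup distance at least 1/2 from the centre assigned to them.\<close>

lemma cell_center_cases:
  assumes "y \<in> big_cube p"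
  shows "cell_center y \<in> cell_centers p \<or> 1/2 \<le> infnorm (y - cell_center y)"
proof (cases "\<exists>b\<in>Basis. y \<bullet> b = real p")
  case True
  then have "y \<in> grid" unfolding grid_def by (metis (mono_tags, lifting) Ints_of_nat mem_Collect_eq)
  then show ?thesis using infnorm_cell_grid by blast
next
  case False
  have "\<exists>i::int. - int p \<le> i \<and> i < int p \<and> cell_center y \<bullet> b = of_int i + 1/2" if b: "b \<in> Basis" for b
  proof (intro exI[of _ "\<lfloor>y \<bullet> b\<rfloor>"] conjI)
    have "\<bar>y \<bullet> b\<bar> \<le> real p" using assms b by (auto simp: big_cube_def infnorm_le_iff)
    moreover have "y \<bullet> b \<noteq> real p" using False b by blast
    ultimately show "- int p \<le> \<lfloor>y \<bullet> b\<rfloor>" "\<lfloor>y \<bullet> b\<rfloor> < int p" by linarith+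
  qed (rule cell_center_component[OF b])
  then show ?thesis by (auto simp: cell_centers_def)
qed

text \<open>Nearest point projection to the cube creates no new hits of the centres, which are
  interior points, and by compactness the image keeps a distance d from them. A Lipschitz
  approximation within d/2, projected again, still stays away from the centres, and the push then
  lands in the grid. Values on A survive because they lie in the cube and in the grid.\<close>

lemma lipschitz_map_into_grid:
  fixes f :: "'a::euclidean_space \<Rightarrow> 'b::euclidean_space"
  assumes X: "compact X" and A: "A \<subseteq> X" "lipschitz_map A f" "f ` A \<subseteq> grid \<inter> big_cube p"
    and f: "continuous_on X f" "f ` X \<subseteq> - cell_centers p"
  shows "\<exists>F. lipschitz_map X F \<and> F ` X \<subseteq> grid \<and> (\<forall>x\<in>A. F x = f x)"
proof -
  let ?Q = "big_cube p :: 'b set" and ?C = "cell_centers p :: 'b set"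
  have Q: "closed ?Q" "convex ?Q" unfolding big_cube_cbox by (rule closed_cbox, rule convex_box(1))
  have "infnorm (0::'b) \<le> real p" by (simp add: infnorm_0)
  then have Q3: "0 \<in> ?Q" by (simp add: big_cube_def)
  have Q0: "?Q \<noteq> {}" using Q3 by blast
  define cl where "cl = closest_point ?Q"
  have clQ: "cl y \<in> ?Q" for y unfolding cl_def by (rule closest_point_in_set[OF Q(1) Q0])
  have clid: "cl y = y" if "y \<in> ?Q" for y unfolding cl_def by (rule closest_point_self[OF that])
  have cldist: "dist (cl x) (cl y) \<le> dist x y" for x y
    unfolding cl_def by (rule closest_point_lipschitz[OF Q(2,1) Q0])
  have lcl: "lipschitz_map S cl" for S by (rule lipschitz_map_bound[of _ _ 1]) (use cldist in simp)
  have Cint: "c \<in> interior ?Q" if "c \<in> ?C" for c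
  proof -
    have "- real p < c \<bullet> b \<and> c \<bullet> b < real p" if b: "b \<in> Basis" for b
    proof -
      obtain i :: int where i: "- int p \<le> i" "i < int p" "c \<bullet> b = of_int i + 1/2"
        using \<open>c \<in> ?C\<close> b by (auto simp: cell_centers_def)
      have "- real p \<le> of_int i" "of_int i + 1 \<le> real p" using i(1,2) by linarith+
      then show ?thesis using i(3) by linarith
    qed
    then show ?thesis unfolding big_cube_cbox interior_cbox mem_box by simp
  qed
  have clC: "cl y \<notin> ?C" if y: "y \<notin> ?C" for y
  proof
    assume c: "cl y \<in> ?C"
    then have i: "cl y \<in> interior ?Q" by (rule Cint)
    then have ne: "interior ?Q \<noteq> {}" by blast
    \<comment> \<open>A point whose nearest point is interior to the cube was in the cube
      already.\<close>
    have "cl y \<in> rel_interior ?Q" using i rel_interior_nonempty_interior[OF ne] by simp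
    moreover have "y \<in> affine hull ?Q" using affine_hull_nonempty_interior[OF ne] by simp
    ultimately have "y \<in> rel_interior ?Q"
      unfolding cl_def using closest_point_in_rel_interior[OF Q(1) Q0] by blast
    then have "y \<in> ?Q" using rel_interior_subset by blast
    then show False using clid c y by simp
  qed
  have "continuous_on X (\<lambda>x. cl (f x))"
    by (rule continuous_on_compose2[OF lipschitz_map_continuous[OF lcl] f(1)]) (rule subset_UNIV)
  note c1 = this
  have A1: "lipschitz_map A (\<lambda>x. cl (f x))"
    by (rule lipschitz_map_compose[OF lcl A(2) subset_UNIV])
  have fA: "cl (f x) = f x" "f x \<in> grid" "f x \<in> ?Q" if "x \<in> A" for x using clid A(3) that by auto
  have "compact ((\<lambda>x. cl (f x)) ` X)" by (rule compact_continuous_image[OF c1 X])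
  moreover have "closed ?C" by (intro finite_imp_closed cell_centers_card)
  moreover have "(\<lambda>x. cl (f x)) ` X \<inter> ?C = {}" using clC f(2) by fastforce
  ultimately obtain d where d: "d > 0" "\<And>u c. u \<in> (\<lambda>x. cl (f x)) ` X \<Longrightarrow> c \<in> ?C \<Longrightarrow> d \<le> dist u c"
    using separate_compact_closed by meson
  obtain g where g: "lipschitz_map X g" "\<And>x. x \<in> A \<Longrightarrow> g x = cl (f x)" "\<And>x. x \<in> X \<Longrightarrow> norm (g x - cl (f x)) \<le> d/2"
    using lipschitz_approximation_rel[OF X c1 A(1) A1, of "d/2"] d(1) by (meson half_gt_zero)
  define D where "D = sqrt (real DIM('b))"
  have D0: "D > 0" by (simp add: D_def)
  \<comment> \<open>Distance d/2 from a centre gives a sup distance of at least d / (2 D), that is,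
    twice the sup distance is at least \<open>\<eta>\<close>.\<close>
  define \<eta> where "\<eta> = min 1 (d / D)"
  have \<eta>: "0 < \<eta>" "\<eta> \<le> 1" "\<eta> \<le> d / D" using d(1) D0 by (auto simp: \<eta>_def)
  define F where "F x = cell_push \<eta> (cl (g x))" for x
  show ?thesis
  proof (intro exI[of _ F] conjI ballI)
    show "lipschitz_map X F" unfolding F_def
      by (rule lipschitz_map_compose[OF lipschitz_map_cell_push[OF \<eta>(1,2)] lipschitz_map_compose[OF lcl g(1) subset_UNIV] subset_UNIV])
    show "F x = f x" if "x \<in> A" for x
      using fA[OF that] g(2)[OF that] clid cell_push_grid_eq[OF _ \<eta>(2)] by (simp add: F_def)
    show "F ` X \<subseteq> grid"
    proof (rule image_subsetI)
      fix x assume x: "x \<in> X"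
      define u where "u = cl (g x)"
      have "\<eta> \<le> 2 * infnorm (u - cell_center u)"
        using cell_center_cases[of u p]
      proof
        show "u \<in> ?Q" unfolding u_def by (rule clQ)
      next
        assume c: "cell_center u \<in> ?C"
        have "cl (f x) = cl (cl (f x))" using clid clQ by simp
        then have "dist u (cl (f x)) \<le> dist (g x) (cl (f x))" unfolding u_def using cldist by metis
        also have "\<dots> \<le> d/2" using g(3)[OF x] by (simp add: dist_norm)
        finally have "d / 2 \<le> dist u (cell_center u)"
          using d(2)[OF imageI[OF x] c] dist_triangle[of "cl (f x)" "cell_center u" u] by (simp add: dist_commute)
        also have "\<dots> \<le> D * infnorm (u - cell_center u)" unfolding dist_norm D_def by (rule norm_le_infnorm)
        finally have "d \<le> (2 * infnorm (u - cell_center u)) * D" by (simp add: ac_simps)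
        then have "d / D \<le> 2 * infnorm (u - cell_center u)" using D0 by (simp add: pos_divide_le_eq)
        then show ?thesis using \<eta>(3) by linarith
      next
        assume "1/2 \<le> infnorm (u - cell_center u)"
        then show ?thesis using \<eta>(2) by linarith
      qed
      then show "F x \<in> grid" unfolding F_def u_def[symmetric] by (rule cell_push_in_grid[OF \<eta>(1)])
    qed
  qed
qed

section \<open>The self-similar extension\<close>

text \<open>The pieces cut the segment between two points into finitely many closed parts, and a map
  of an interval that is Lipschitz on each part is so on the whole with the same constant. That the
  constant stays exactly L is what gives the iterates a common bound.\<close>

lemma lipschitz_on_piecewise:
  fixes f :: "'a::real_normed_vector \<Rightarrow> 'b::metric_space"
  assumes C: "convex C" and I: "finite I" and U: "\<And>i. i \<in> I \<Longrightarrow> closed (U i)" "\<And>i. i \<in> I \<Longrightarrow> L-lipschitz_on (U i) f"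
    and cover: "C \<subseteq> (\<Union>i\<in>I. U i)" and L: "L \<ge> 0"
  shows "L-lipschitz_on C f"
proof (rule lipschitz_onI[OF _ L])
  fix x y assume xy: "x \<in> C" "y \<in> C"
  define \<gamma> where "\<gamma> t = x + t *\<^sub>R (y - x)" for t :: real
  have \<gamma>: "\<gamma> t = (1 - t) *\<^sub>R x + t *\<^sub>R y" for t by (simp add: \<gamma>_def algebra_simps)
  define V where "V i = {0..1} \<inter> \<gamma> -` U i" for i
  have c\<gamma>: "continuous_on A \<gamma>" for A unfolding \<gamma>_def by (intro continuous_intros)
  have d: "dist (\<gamma> s) (\<gamma> t) = dist s t * dist x y" for s t
    by (simp add: \<gamma>_def dist_norm norm_minus_commute flip: scaleR_diff_left)
  have "(L * dist x y)-lipschitz_on {0..1} (\<lambda>t. f (\<gamma> t))"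
  proof (rule lipschitz_on_closed_Union[where I=I and U=V])
    fix i assume i: "i \<in> I"
    show "closed (V i)" unfolding V_def
      by (rule continuous_closed_preimage[OF c\<gamma> closed_atLeastAtMost U(1)[OF i]])
    show "(L * dist x y)-lipschitz_on (V i) (\<lambda>t. f (\<gamma> t))"
    proof (rule lipschitz_onI)
      fix s t assume "s \<in> V i" "t \<in> V i"
      then have "dist (f (\<gamma> s)) (f (\<gamma> t)) \<le> L * dist (\<gamma> s) (\<gamma> t)"
        by (intro lipschitz_onD[OF U(2)[OF i]]) (auto simp: V_def)
      then show "dist (f (\<gamma> s)) (f (\<gamma> t)) \<le> L * dist x y * dist s t" by (simp add: d ac_simps)
    qed (use L in auto)
  next
    show "{0..1} \<subseteq> (\<Union>i\<in>I. V i)"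
    proof
      fix t :: real assume t: "t \<in> {0..1}"
      then have "\<gamma> t \<in> C" unfolding \<gamma> using xy by (intro convexD[OF C]) auto
      then show "t \<in> (\<Union>i\<in>I. V i)" using cover t by (auto simp: V_def)
    qed
  qed (use I L in auto)
  from lipschitz_onD[OF this, of 0 1] show "dist (f x) (f y) \<le> L * dist x y"
    by (simp add: \<gamma>_def dist_real_def)
qed

lemma interior_image_bij_empty:
  fixes g :: "'a::topological_space \<Rightarrow> 'b::topological_space"
  assumes g: "continuous_on UNIV g" "bij g" and S: "interior S = {}"
  shows "interior (g ` S) = {}"
proof -
  have "open (g -` interior (g ` S))" by (rule open_vimage[OF open_interior g(1)])
  moreover have "g -` interior (g ` S) \<subseteq> S"
    using interior_subset[of "g ` S"] bij_is_inj[OF g(2)] by (auto dest: injD)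
  ultimately have "g -` interior (g ` S) \<subseteq> interior S" by (rule interior_maximal[rotated])
  then have "g -` interior (g ` S) = {}" using S by simp
  then show ?thesis using bij_is_surj[OF g(2)] by (metis surj_image_vimage_eq image_empty)
qed

lemma bij_affine:
  fixes c :: "'a::real_vector"
  assumes "s \<noteq> 0"
  shows "bij (\<lambda>y. c + s *\<^sub>R y)"
proof (rule bij_betw_byWitness[where f' = "\<lambda>y. inverse s *\<^sub>R (y - c)"])
qed (use assms in auto)

text \<open>Points near which the image of \<open>g\<close> is fat; off this set the rank of the derivative drops.\<close>
definition fat_points :: "('a::real_normed_vector \<Rightarrow> 'b::topological_space) \<Rightarrow> 'a set" where
  "fat_points g = {x \<in> ball 0 1. \<forall>e>0. interior (g ` ball x e) \<noteq> {}}"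

text \<open>Having a ball with thin image around a point is an open condition.\<close>

lemma fat_points_borel: "fat_points (g :: 'a::euclidean_space \<Rightarrow> 'b::topological_space) \<in> sets borel"
proof -
  define G where "G = {x. \<exists>e>0. interior (g ` ball x e) = {}}"
  have "open G"
    unfolding open_contains_ball
  proof
    fix x assume "x \<in> G"
    then obtain e where e: "e > 0" "interior (g ` ball x e) = {}" by (auto simp: G_def)
    have "y \<in> G" if y: "y \<in> ball x (e/2)" for y
    proof -
      have "ball y (e/2) \<subseteq> ball x e"
      proof
        fix z assume "z \<in> ball y (e/2)"
        then show "z \<in> ball x e" using y dist_triangle[of x z y] by simp
      qed
      then have "interior (g ` ball y (e/2)) \<subseteq> interior (g ` ball x e)" by (intro interior_mono image_mono)
      then have "interior (g ` ball y (e/2)) = {}" using e(2) by simp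
      then show ?thesis using e(1) unfolding G_def by (auto intro!: exI[of _ "e/2"])
    qed
    then show "\<exists>e>0. ball x e \<subseteq> G" using e(1) by (intro exI[of _ "e/2"]) auto
  qed
  moreover have "fat_points g = ball 0 1 - G" by (auto simp: fat_points_def G_def)
  ultimately show ?thesis by auto
qed

text \<open>F is the first generation: \<open>\<theta>\<close> on the outer sphere and a copy scaled
  by s around each hole. The bound s <= r makes an inserted copy no steeper than the original,
  \<open>vol\<close> is what forces the fat points to be null, and Y is the thin set that receives
  everything outside the holes.\<close>

locale self_similar =
  fixes I :: "'i set" and b :: "'i \<Rightarrow> 'a::euclidean_space" and c :: "'i \<Rightarrow> 'b::euclidean_space" 
    and r s :: real and F \<theta> :: "'a \<Rightarrow> 'b" and X Y
  assumes I: "finite I" and rs: "0 < s" "s \<le> r" "r < 1"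
    and inside: "\<And>i. i \<in> I \<Longrightarrow> cball (b i) r \<subseteq> ball 0 1"
    and disj: "\<And>i j. i \<in> I \<Longrightarrow> j \<in> I \<Longrightarrow> i \<noteq> j \<Longrightarrow> cball (b i) r \<inter> cball (b j) r = {}"
    and vol: "real (card I) * r ^ DIM('a) < 1"
    and X: "X = cball 0 1 - (\<Union>i\<in>I. ball (b i) r)"
    and F: "lipschitz_map X F" and FY: "F ` X \<subseteq> Y" and Y: "interior Y = {}"
    and outer: "\<And>x. x \<in> sphere 0 1 \<Longrightarrow> F x = \<theta> x"
    and inner: "\<And>i x. i \<in> I \<Longrightarrow> norm x = 1 \<Longrightarrow> F (b i + r *\<^sub>R x) = c i + s *\<^sub>R \<theta> x"
begin

lemma r0: "r > 0" using rs by simp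

definition step :: "('a \<Rightarrow> 'b) \<Rightarrow> 'a \<Rightarrow> 'b" where
  "step g x = (if \<exists>i\<in>I. x \<in> ball (b i) r 
     then let i = (SOME i. i \<in> I \<and> x \<in> ball (b i) r) in c i + s *\<^sub>R g (inverse r *\<^sub>R (x - b i)) else F x)"

lemma step_out: "x \<in> X \<Longrightarrow> step g x = F x"
  by (auto simp: step_def X)

lemma step_in:
  assumes i: "i \<in> I" and x: "x \<in> ball (b i) r"
  shows "step g x = c i + s *\<^sub>R g (inverse r *\<^sub>R (x - b i))"
proof -
  have "(SOME i. i \<in> I \<and> x \<in> ball (b i) r) = i"
  proof (rule some_equality)
    fix j assume "j \<in> I \<and> x \<in> ball (b j) r"
    then show "j = i" using disj[of j i] i x by (meson ball_subset_cball disjoint_iff subsetD)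
  qed (use i x in auto)
  then show ?thesis using i x unfolding step_def by (auto simp: Let_def)
qed

text \<open>On the sphere bounding a hole \<open>step\<close> takes the value of F, which by
  \<open>inner\<close> is the one prescribed in the hole. The formula thus holds on the closed ball,
  as the closed cover used for the Lipschitz bound requires.\<close>

lemma step_in_closed:
  assumes i: "i \<in> I" and x: "x \<in> cball (b i) r" and g: "\<And>x. x \<in> sphere 0 1 \<Longrightarrow> g x = \<theta> x"
  shows "step g x = c i + s *\<^sub>R g (inverse r *\<^sub>R (x - b i))"
proof (cases "x \<in> ball (b i) r")
  case True
  then show ?thesis by (rule step_in[OF i])
next
  case False
  then have xs: "dist (b i) x = r" using x by simp
  define u where "u = inverse r *\<^sub>R (x - b i)"
  have u: "x = b i + r *\<^sub>R u" "norm u = 1"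
    using r0 xs by (simp_all add: u_def dist_norm norm_minus_commute)
  have "x \<notin> ball (b j) r" if "j \<in> I" for j
  proof (cases "j = i")
    case False
    then show ?thesis using disj[OF that i] x ball_subset_cball by blast
  qed (use \<open>x \<notin> ball (b i) r\<close> in simp)
  then have "x \<in> X" using inside[OF i] x ball_subset_cball unfolding X by blast
  then have "step g x = F (b i + r *\<^sub>R u)" using step_out u(1) by simp
  also have "\<dots> = c i + s *\<^sub>R g u" using inner[OF i u(2)] g u(2) by simp
  finally show ?thesis by (simp add: u_def)
qed

definition admissible :: "real \<Rightarrow> ('a \<Rightarrow> 'b) \<Rightarrow> bool" where
  "admissible L g \<longleftrightarrow> L-lipschitz_on (cball 0 1) g \<and> (\<forall>x\<in>sphere 0 1. g x = \<theta> x)"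

lemma sphere_X: "sphere 0 1 \<subseteq> X"
proof
  fix x assume x: "x \<in> sphere (0::'a) 1"
  have "x \<notin> ball (b i) r" if "i \<in> I" for i
  proof
    assume "x \<in> ball (b i) r"
    then have "x \<in> ball 0 1" using inside[OF that] ball_subset_cball by blast
    then show False using x by simp
  qed
  then show "x \<in> X" using x by (auto simp: X)
qed

lemma rescale_ball: "x \<in> cball (b i) r \<longleftrightarrow> inverse r *\<^sub>R (x - b i) \<in> cball 0 1"
  "x \<in> ball (b i) r \<longleftrightarrow> inverse r *\<^sub>R (x - b i) \<in> ball 0 1"
proof -
  have "dist (b i) x = norm (x - b i)" by (simp add: dist_norm norm_minus_commute)
  moreover have "norm (inverse r *\<^sub>R (x - b i)) = norm (x - b i) / r" using r0 by (simp add: divide_inverse mult.commute)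
  ultimately show "x \<in> cball (b i) r \<longleftrightarrow> inverse r *\<^sub>R (x - b i) \<in> cball 0 1"
    "x \<in> ball (b i) r \<longleftrightarrow> inverse r *\<^sub>R (x - b i) \<in> ball 0 1"
    using r0 by (simp_all add: mem_cball_0 mem_ball_0 pos_divide_le_eq pos_divide_less_eq)
qed

text \<open>X and the closed holes cover the ball. On each of them the constant is at most L, in a
  hole because of the factor s / r <= 1, and pasting over a convex set keeps L.\<close>

lemma step_admissible:
  assumes L: "L-lipschitz_on X F" and g: "admissible L g"
  shows "admissible L (step g)"
proof -
  have gth: "g x = \<theta> x" if "x \<in> sphere 0 1" for x using g that by (auto simp: admissible_def)
  have gL: "L-lipschitz_on (cball 0 1) g" using g by (simp add: admissible_def)
  have L0: "L \<ge> 0" using lipschitz_on_nonneg[OF L] .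
  define U where "U o' = (case o' of None \<Rightarrow> X | Some i \<Rightarrow> cball (b i) r)" for o'
  have "L-lipschitz_on (cball 0 1) (step g)"
  proof (rule lipschitz_on_piecewise[of _ "insert None (Some ` I)" U])
    show "closed (U o')" if "o' \<in> insert None (Some ` I)" for o'
      using that by (auto simp: U_def X intro!: closed_Diff open_UN)
    show "L-lipschitz_on (U o') (step g)" if o': "o' \<in> insert None (Some ` I)" for o'
    proof (cases o')
      case None
      have "L-lipschitz_on X (step g)" by (rule lipschitz_on_transform[OF L]) (simp add: step_out)
      then show ?thesis by (simp add: U_def None)
    next
      case (Some i)
      then have i: "i \<in> I" using o' by auto
      have "L-lipschitz_on (cball (b i) r) (step g)"
      proof (rule lipschitz_onI[OF _ L0])
        fix x y assume x: "x \<in> cball (b i) r" and y: "y \<in> cball (b i) r"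
        define u where "u = inverse r *\<^sub>R (x - b i)"
        define v where "v = inverse r *\<^sub>R (y - b i)"
        have "dist (step g x) (step g y) = s * dist (g u) (g v)"
          using step_in_closed[OF i x gth] step_in_closed[OF i y gth] rs(1)
          by (simp add: u_def[symmetric] v_def[symmetric] dist_norm flip: scaleR_diff_right)
        also have "\<dots> \<le> s * (L * dist u v)"
          using rescale_ball(1) x y rs(1) by (intro mult_left_mono lipschitz_onD[OF gL]) (auto simp: u_def v_def)
        also have "dist u v = inverse r * dist x y"
        proof -
          have "u - v = inverse r *\<^sub>R (x - y)" by (simp add: u_def v_def flip: scaleR_diff_right)
          then show ?thesis using r0 by (simp add: dist_norm)
        qed
        also have "s * (L * (inverse r * dist x y)) = (s / r) * (L * dist x y)" by (simp add: divide_inverse ac_simps)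
        also have "\<dots> \<le> 1 * (L * dist x y)" using rs L0 r0 by (intro mult_right_mono) auto
        finally show "dist (step g x) (step g y) \<le> L * dist x y" by simp
      qed
      then show ?thesis by (simp add: U_def Some)
    qed
    show "cball 0 1 \<subseteq> (\<Union>o'\<in>insert None (Some ` I). U o')"
      unfolding U_def X using ball_subset_cball by fastforce
  qed (use I L0 in auto)
  moreover have "step g x = \<theta> x" if "x \<in> sphere 0 1" for x
    using step_out[of x] sphere_X outer that by auto
  ultimately show ?thesis by (simp add: admissible_def)
qed

text \<open>Consecutive iterates of \<open>step\<close> agree outside the holes, while inside their
  difference is that of the previous pair times s. They converge geometrically with the common
  constant L, starting from any Lipschitz extension of \<open>\<theta>\<close>.\<close>

lemma fixed_point:
  obtains g L where "admissible L g" "\<And>x. x \<in> cball 0 1 \<Longrightarrow> step g x = g x"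
proof -
  obtain L1 where L1: "L1 > 0" "L1-lipschitz_on X F" by (rule lipschitz_mapE[OF F])
  have "lipschitz_map (sphere 0 1) \<theta>"
    by (rule lipschitz_map_cong[OF lipschitz_map_subset[OF F sphere_X]]) (simp add: outer)
  then obtain g0 where g0: "lipschitz_map UNIV g0" "\<And>x. x \<in> sphere 0 1 \<Longrightarrow> g0 x = \<theta> x"
    using lipschitz_extension by blast
  obtain L2 where L2: "L2 > 0" "L2-lipschitz_on UNIV g0" by (rule lipschitz_mapE[OF g0(1)])
  \<comment> \<open>L must serve F and the starting map; \<open>step\<close> then preserves
    it.\<close>
  define L where "L = max L1 L2"
  have LF: "L-lipschitz_on X F" by (rule lipschitz_on_mono[OF L1(2)]) (auto simp: L_def)
  have "L-lipschitz_on (cball 0 1) g0" by (rule lipschitz_on_mono[OF L2(2)]) (auto simp: L_def)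
  then have ad0: "admissible L g0" using g0(2) by (simp add: admissible_def)
  define h where "h n = (step ^^ n) g0" for n
  have h0: "h 0 = g0" and hS: "h (Suc n) = step (h n)" for n by (simp_all add: h_def)
  have ad: "admissible L (h n)" for n
    by (induction n) (use ad0 step_admissible[OF LF] in \<open>auto simp: h0 hS\<close>)
  have "lipschitz_map (cball 0 1) (\<lambda>x. h 1 x - h 0 x)"
    using lipschitz_on_diff[of L "cball 0 1" "h 1" L "h 0"] ad unfolding admissible_def lipschitz_map_def by blast
  then obtain M where M: "M \<ge> 0" "\<And>x. x \<in> cball 0 1 \<Longrightarrow> norm (h 1 x - h 0 x) \<le> M"
    using lipschitz_map_bounded_image[OF _ bounded_cball] by blast
  have diff: "norm (h (Suc n) x - h n x) \<le> s ^ n * M" if "x \<in> cball 0 1" for n x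
    using that
  proof (induction n arbitrary: x)
    case 0
    then show ?case using M(2) by simp
  next
    case (Suc n)
    show ?case
    proof (cases "\<exists>i\<in>I. x \<in> ball (b i) r")
      case True
      then obtain i where i: "i \<in> I" "x \<in> ball (b i) r" by blast
      define u where "u = inverse r *\<^sub>R (x - b i)"
      have "u \<in> ball 0 1" using rescale_ball(2)[of x i] i(2) by (simp add: u_def)
      then have "u \<in> cball 0 1" using ball_subset_cball by blast
      then have "norm (h (Suc n) u - h n u) \<le> s ^ n * M" by (rule Suc.IH)
      moreover have "h (Suc (Suc n)) x - h (Suc n) x = s *\<^sub>R (h (Suc n) u - h n u)"
        using step_in[OF i, of "h (Suc n)"] step_in[OF i, of "h n"] by (simp add: hS[of "Suc n"] hS[of n, symmetric] u_def scaleR_diff_right)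
      ultimately show ?thesis using rs(1) by (simp add: mult.assoc)
    next
      case False
      then have "x \<in> X" using Suc.prems by (auto simp: X)
      then have "h (Suc (Suc n)) x = h (Suc n) x" using step_out by (simp add: hS)
      then show ?thesis using M(1) rs(1) by simp
    qed
  qed
  have conv: "\<exists>l. (\<lambda>n. h n x) \<longlonglongrightarrow> l" if x: "x \<in> cball 0 1" for x
  proof -
    have "summable (\<lambda>n. h (Suc n) x - h n x)"
    proof (rule summable_comparison_test)
      show "\<exists>K. \<forall>n\<ge>K. norm (h (Suc n) x - h n x) \<le> s ^ n * M" using diff[OF x] by blast
      have "norm s < 1" using rs by simp
      then show "summable (\<lambda>n. s ^ n * M)" by (intro summable_mult2 summable_geometric)
    qed
    then obtain l where "(\<lambda>n. \<Sum>k<n. h (Suc k) x - h k x) \<longlonglongrightarrow> l" unfolding summable_def sums_def by blast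
    then have "(\<lambda>n. h n x - h 0 x) \<longlonglongrightarrow> l" by (simp only: sum_lessThan_telescope[of "\<lambda>k. h k x"])
    then have "(\<lambda>n. (h n x - h 0 x) + h 0 x) \<longlonglongrightarrow> l + h 0 x" by (intro tendsto_intros)
    then show ?thesis by auto
  qed
  define g where "g x = lim (\<lambda>n. h n x)" for x
  have lim: "(\<lambda>n. h n x) \<longlonglongrightarrow> g x" if "x \<in> cball 0 1" for x
    using conv[OF that] convergent_LIMSEQ_iff[of "\<lambda>n. h n x"] unfolding g_def convergent_def by blast
  show thesis
  proof
    have "L-lipschitz_on (cball 0 1) g"
    proof (rule lipschitz_onI)
      fix x y :: 'a assume xy: "x \<in> cball 0 1" "y \<in> cball 0 1"
      have "(\<lambda>n. dist (h n x) (h n y)) \<longlonglongrightarrow> dist (g x) (g y)" by (intro tendsto_intros lim xy)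
      moreover have "dist (h n x) (h n y) \<le> L * dist x y" for n
        using ad[of n] xy unfolding admissible_def by (meson lipschitz_onD)
      ultimately show "dist (g x) (g y) \<le> L * dist x y" by (intro LIMSEQ_le_const2) auto
    qed (use L1 in \<open>auto simp: L_def\<close>)
    moreover have "g x = \<theta> x" if x: "x \<in> sphere 0 1" for x
    proof -
      have "(\<lambda>n. h n x) \<longlonglongrightarrow> g x" using lim x by (simp add: sphere_def)
      moreover have "h n x = \<theta> x" for n using ad[of n] x by (auto simp: admissible_def)
      ultimately show ?thesis by (simp add: LIMSEQ_const_iff)
    qed
    ultimately show "admissible L g" by (simp add: admissible_def)
    fix x :: 'a assume x: "x \<in> cball 0 1"
    have "(\<lambda>n. h (Suc n) x) \<longlonglongrightarrow> g x" using lim[OF x] by (rule LIMSEQ_Suc)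
    moreover have "(\<lambda>n. h (Suc n) x) \<longlonglongrightarrow> step g x"
    proof (cases "\<exists>i\<in>I. x \<in> ball (b i) r")
      case True
      then obtain i where i: "i \<in> I" "x \<in> ball (b i) r" by blast
      have "inverse r *\<^sub>R (x - b i) \<in> cball 0 1" 
        using rescale_ball(2)[of x i] i(2) ball_subset_cball by blast
      then have "(\<lambda>n. c i + s *\<^sub>R h n (inverse r *\<^sub>R (x - b i))) \<longlonglongrightarrow> c i + s *\<^sub>R g (inverse r *\<^sub>R (x - b i))"
        by (intro tendsto_intros lim)
      then show ?thesis by (simp add: hS step_in[OF i])
    next
      case False
      then have "x \<in> X" using x by (auto simp: X)
      then show ?thesis by (simp add: hS step_out)
    qed
    ultimately show "step g x = g x" by (rule LIMSEQ_unique[rotated])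
  qed
qed

text \<open>Outside the closed holes g maps a small ball into Y, so the point is not fat. Inside a
  hole g is an affine copy of itself, and affine bijections keep thin images thin. The bounding
  spheres are left over.\<close>

lemma fat_points_subset:
  assumes fp: "\<And>x. x \<in> cball 0 1 \<Longrightarrow> step g x = g x"
  shows "fat_points g \<subseteq> (\<Union>i\<in>I. (\<lambda>x. r *\<^sub>R x + b i) ` fat_points g) \<union> (\<Union>i\<in>I. sphere (b i) r)"
proof
  fix x assume x: "x \<in> fat_points g"
  then have xb: "x \<in> ball 0 1" by (simp add: fat_points_def)
  show "x \<in> (\<Union>i\<in>I. (\<lambda>x. r *\<^sub>R x + b i) ` fat_points g) \<union> (\<Union>i\<in>I. sphere (b i) r)"
  proof (cases "\<exists>i\<in>I. x \<in> cball (b i) r")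
    case False
    have "open (ball 0 1 - (\<Union>i\<in>I. cball (b i) r))" by (intro open_Diff closed_UN I) auto
    moreover have "x \<in> ball 0 1 - (\<Union>i\<in>I. cball (b i) r)" using False xb by blast
    ultimately obtain e where e: "e > 0" "ball x e \<subseteq> ball 0 1 - (\<Union>i\<in>I. cball (b i) r)" by (rule openE)
    have "g y \<in> Y" if "y \<in> ball x e" for y
    proof -
      have "y \<in> X" using e(2) that ball_subset_cball unfolding X by blast
      moreover have "y \<in> cball 0 1" using \<open>y \<in> X\<close> by (simp add: X)
      ultimately show ?thesis using fp[of y] step_out[of y g] FY by auto
    qed
    then have "interior (g ` ball x e) \<subseteq> interior Y" by (intro interior_mono) auto
    then have "interior (g ` ball x e) = {}" using Y by simp
    then show ?thesis using x e(1) by (auto simp: fat_points_def)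
  next
    case True
    then obtain i where i: "i \<in> I" "x \<in> cball (b i) r" by blast
    show ?thesis
    proof (cases "x \<in> ball (b i) r")
      case False
      then have "x \<in> sphere (b i) r" using i(2) by simp
      then show ?thesis using i(1) by blast
    next
      case True
      define u where "u = inverse r *\<^sub>R (x - b i)"
      have xu: "x = r *\<^sub>R u + b i" using r0 by (simp add: u_def)
      have ub: "u \<in> ball 0 1" using rescale_ball(2)[of x i] True by (simp add: u_def)
      have "u \<in> fat_points g"
      proof (rule ccontr)
        assume "u \<notin> fat_points g"
        then obtain e where e: "e > 0" "interior (g ` ball u e) = {}" using ub by (auto simp: fat_points_def)
        obtain d where d: "d > 0" "ball u d \<subseteq> ball 0 1" using ub openE[OF open_ball] by blast
        define \<epsilon> where "\<epsilon> = min e d"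
        have \<epsilon>: "\<epsilon> > 0" "ball u \<epsilon> \<subseteq> ball u e" "ball u \<epsilon> \<subseteq> ball 0 1" using e d by (auto simp: \<epsilon>_def)
        have "g ` ball x (r * \<epsilon>) \<subseteq> (\<lambda>y. c i + s *\<^sub>R y) ` (g ` ball u \<epsilon>)"
        proof (rule image_subsetI)
          fix y assume y: "y \<in> ball x (r * \<epsilon>)"
          define v where "v = inverse r *\<^sub>R (y - b i)"
          have "v - u = inverse r *\<^sub>R (y - x)" by (simp add: v_def u_def flip: scaleR_diff_right)
          then have "norm (v - u) = norm (y - x) / r" using r0 by (simp add: divide_inverse mult.commute)
          then have "norm (v - u) < \<epsilon>" using y r0 by (simp add: dist_norm norm_minus_commute pos_divide_less_eq mult.commute)
          then have v: "v \<in> ball u \<epsilon>" by (simp add: dist_norm norm_minus_commute)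
          then have "v \<in> ball 0 1" using \<epsilon>(3) by blast
          then have yb: "y \<in> ball (b i) r" using rescale_ball(2)[of y i] by (simp add: v_def)
          then have "y \<in> cball 0 1" using inside[OF i(1)] ball_subset_cball by blast
          then have "g y = c i + s *\<^sub>R g v" using fp[of y] step_in[OF i(1) yb, of g] by (simp add: v_def)
          then show "g y \<in> (\<lambda>y. c i + s *\<^sub>R y) ` (g ` ball u \<epsilon>)" using v by blast
        qed
        moreover have "interior ((\<lambda>y. c i + s *\<^sub>R y) ` (g ` ball u \<epsilon>)) = {}"
        proof (rule interior_image_bij_empty)
          show "continuous_on UNIV (\<lambda>y. c i + s *\<^sub>R y)" by (intro continuous_intros)
          show "bij (\<lambda>y. c i + s *\<^sub>R y)" using rs by (intro bij_affine) simp
          have "interior (g ` ball u \<epsilon>) \<subseteq> interior (g ` ball u e)" by (intro interior_mono image_mono \<epsilon>(2))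
          then show "interior (g ` ball u \<epsilon>) = {}" using e(2) by simp
        qed
        ultimately have "interior (g ` ball x (r * \<epsilon>)) = {}" by (metis interior_mono subset_empty)
        moreover have "r * \<epsilon> > 0" using r0 \<epsilon>(1) by simp
        ultimately show False using x by (auto simp: fat_points_def)
      qed
      then show ?thesis using xu i(1) by blast
    qed
  qed
qed

text \<open>By self-similarity the finite measure m of the fat points is at most m times the number
  of holes times r^d, where d is the dimension; the factor is below 1, so m = 0.\<close>

lemma negligible_fat_points:
  assumes fp: "\<And>x. x \<in> cball 0 1 \<Longrightarrow> step g x = g x"
  shows "negligible (fat_points g)"
proof -
  let ?E = "fat_points g"
  have Eb: "?E \<in> sets lebesgue" using fat_points_borel[of g] by simp
  have img: "(\<lambda>x. r *\<^sub>R x + b i) ` ?E \<in> sets lebesgue" for i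
  proof -
    have "(\<lambda>x. r *\<^sub>R x + b i) ` ?E = (\<lambda>x. inverse r *\<^sub>R (x - b i)) -` ?E"
      using r0 by (auto simp: image_iff intro!: bexI[of _ "inverse r *\<^sub>R (_ - b i)"])
    moreover have "(\<lambda>x. inverse r *\<^sub>R (x - b i)) -` ?E \<inter> space borel \<in> sets borel"
      by (rule measurable_sets[OF _ fat_points_borel]) measurable
    ultimately have "(\<lambda>x. r *\<^sub>R x + b i) ` ?E \<in> sets borel" by simp
    then show ?thesis by simp
  qed
  have sph: "emeasure lebesgue (\<Union>i\<in>I. sphere (b i) r) = 0"
  proof -
    have "negligible (\<Union>i\<in>I. sphere (b i) r)" by (intro negligible_Union finite_imageI I) (auto simp: negligible_sphere)
    then show ?thesis by (simp add: negligible_iff_null_sets null_sets_def)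
  qed
  have imgU: "(\<Union>i\<in>I. (\<lambda>x. r *\<^sub>R x + b i) ` ?E) \<in> sets lebesgue"
    by (intro sets.finite_UN I img)
  have sphU: "(\<Union>i\<in>I. sphere (b i) r) \<in> sets lebesgue"
    by (intro sets.finite_UN I negligible_imp_sets negligible_sphere)
  have "emeasure lebesgue ?E \<le> emeasure lebesgue ((\<Union>i\<in>I. (\<lambda>x. r *\<^sub>R x + b i) ` ?E) \<union> (\<Union>i\<in>I. sphere (b i) r))"
    by (rule emeasure_mono[OF fat_points_subset[OF fp] sets.Un[OF imgU sphU]])
  also have "\<dots> \<le> emeasure lebesgue (\<Union>i\<in>I. (\<lambda>x. r *\<^sub>R x + b i) ` ?E) + emeasure lebesgue (\<Union>i\<in>I. sphere (b i) r)"
    by (rule emeasure_subadditive[OF imgU sphU])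
  also have "\<dots> = emeasure lebesgue (\<Union>i\<in>I. (\<lambda>x. r *\<^sub>R x + b i) ` ?E)" by (simp add: sph)
  also have "\<dots> \<le> (\<Sum>i\<in>I. emeasure lebesgue ((\<lambda>x. r *\<^sub>R x + b i) ` ?E))"
    by (rule emeasure_subadditive_finite[OF I]) (use img in auto)
  also have "\<dots> = (\<Sum>i\<in>I. ennreal (r ^ DIM('a)) * emeasure lebesgue ?E)"
    using r0 emeasure_lebesgue_affine[of r _ ?E] by (simp add: ennreal_power)
  also have "\<dots> = ennreal (real (card I) * r ^ DIM('a)) * emeasure lebesgue ?E"
    using r0 by (simp add: ennreal_mult ennreal_of_nat_eq_real_of_nat mult.assoc)
  finally have le: "emeasure lebesgue ?E \<le> ennreal (real (card I) * r ^ DIM('a)) * emeasure lebesgue ?E" .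
  have "emeasure lebesgue ?E \<le> emeasure lebesgue (ball (0::'a) 1)"
    by (rule emeasure_mono) (auto simp: fat_points_def)
  also have "\<dots> < \<infinity>" using emeasure_lborel_ball_finite[of "0::'a" 1] by (simp add: emeasure_completion)
  finally have fin: "emeasure lebesgue ?E < \<infinity>" .
  define m where "m = measure lebesgue ?E"
  have em: "emeasure lebesgue ?E = ennreal m" using fin by (simp add: m_def emeasure_eq_ennreal_measure)
  have m0: "m \<ge> 0" by (simp add: m_def)
  have k0: "0 \<le> real (card I) * r ^ DIM('a)" using r0 by simp
  have "ennreal m \<le> ennreal ((real (card I) * r ^ DIM('a)) * m)"
    using le unfolding em by (simp add: ennreal_mult k0 m0)
  then have "m \<le> (real (card I) * r ^ DIM('a)) * m" using k0 m0 by (subst (asm) ennreal_le_iff) auto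
  then have "m = 0" using vol m0 by (cases "m = 0") (auto simp: mult_le_cancel_right1)
  then have "emeasure lebesgue ?E = 0" by (simp add: em)
  then show ?thesis using Eb by (simp add: negligible_iff_null_sets null_setsI)
qed

end

section \<open>The first generation\<close>

text \<open>Disjoint compact sets have positive distance, so for points of different sets the
  bounded difference of values is at most a constant times their distance.\<close>

lemma lipschitz_map_Un:
  fixes f :: "'a::euclidean_space \<Rightarrow> 'b::real_normed_vector"
  assumes A: "compact A" "lipschitz_map A f" and B: "compact B" "lipschitz_map B f" and AB: "A \<inter> B = {}"
  shows "lipschitz_map (A \<union> B) f"
proof -
  obtain L where L: "L > 0" "L-lipschitz_on A f" by (rule lipschitz_mapE[OF A(2)])
  obtain M where M: "M > 0" "M-lipschitz_on B f" by (rule lipschitz_mapE[OF B(2)])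
  obtain d where d: "d > 0" "\<And>x y. x \<in> A \<Longrightarrow> y \<in> B \<Longrightarrow> d \<le> dist x y"
    using separate_compact_closed[OF A(1) compact_imp_closed[OF B(1)] AB] by blast
  obtain a where a: "a \<ge> 0" "\<And>x. x \<in> A \<Longrightarrow> norm (f x) \<le> a"
    using lipschitz_map_bounded_image[OF A(2) compact_imp_bounded[OF A(1)]] by blast
  obtain b where b: "b \<ge> 0" "\<And>x. x \<in> B \<Longrightarrow> norm (f x) \<le> b"
    using lipschitz_map_bounded_image[OF B(2) compact_imp_bounded[OF B(1)]] by blast
  have cross: "dist (f x) (f y) \<le> (a + b) / d * dist x y" if "x \<in> A" "y \<in> B" for x y
  proof -
    have "dist (f x) (f y) \<le> a + b"
      using a(2)[OF that(1)] b(2)[OF that(2)] norm_triangle_ineq4[of "f x" "f y"] by (simp add: dist_norm)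
    also have "\<dots> = (a + b) / d * d" using d(1) by simp
    also have "\<dots> \<le> (a + b) / d * dist x y" using d a(1) b(1) that by (intro mult_left_mono) auto
    finally show ?thesis .
  qed
  have le: "L * dist x y \<le> (L + M + (a + b) / d) * dist x y" "M * dist x y \<le> (L + M + (a + b) / d) * dist x y"
      "(a + b) / d * dist x y \<le> (L + M + (a + b) / d) * dist x y" for x y :: 'a
  proof -
    have "(a + b) / d \<ge> 0" using a(1) b(1) d(1) by simp
    then show "L * dist x y \<le> (L + M + (a + b) / d) * dist x y" "M * dist x y \<le> (L + M + (a + b) / d) * dist x y"
      "(a + b) / d * dist x y \<le> (L + M + (a + b) / d) * dist x y"
      using L(1) M(1) by (intro mult_right_mono; simp)+
  qed
  show ?thesis
  proof (rule lipschitz_map_bound)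
    fix x y assume "x \<in> A \<union> B" "y \<in> A \<union> B"
    then consider "x \<in> A" "y \<in> A" | "x \<in> B" "y \<in> B" | "x \<in> A" "y \<in> B" | "x \<in> B" "y \<in> A" by blast
    then show "dist (f x) (f y) \<le> (L + M + (a + b) / d) * dist x y"
    proof cases
      case 1 then show ?thesis using lipschitz_onD[OF L(2)] le(1) order_trans by blast
    next
      case 2 then show ?thesis using lipschitz_onD[OF M(2)] le(2) order_trans by blast
    next
      case 3 then show ?thesis using cross le(3) order_trans by blast
    next
      case 4 then show ?thesis using cross[of y x] le(3)[of x y] by (simp add: dist_commute)
    qed
  qed
qed

lemma lipschitz_map_disjoint_Union:
  fixes f :: "'a::euclidean_space \<Rightarrow> 'b::real_normed_vector"
  assumes "finite J" "\<And>j. j \<in> J \<Longrightarrow> compact (A j)" "\<And>j. j \<in> J \<Longrightarrow> lipschitz_map (A j) f"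
    and "\<And>i j. i \<in> J \<Longrightarrow> j \<in> J \<Longrightarrow> i \<noteq> j \<Longrightarrow> A i \<inter> A j = {}"
  shows "lipschitz_map (\<Union>j\<in>J. A j) f"
  using assms
proof (induction J)
  case empty
  have "0-lipschitz_on {} f" by simp
  then show ?case unfolding lipschitz_map_def by auto
next
  case (insert j J)
  have "lipschitz_map (A j \<union> (\<Union>j\<in>J. A j)) f"
  proof (rule lipschitz_map_Un)
    show "compact (\<Union>j\<in>J. A j)" using insert by (intro compact_UN) auto
    show "A j \<inter> (\<Union>j\<in>J. A j) = {}" using insert.prems(3)[of j] insert.hyps(2) by blast
    show "lipschitz_map (\<Union>j\<in>J. A j) f" by (rule insert.IH) (use insert.prems in auto)
  qed (use insert.prems in auto)
  then show ?case by simp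
qed

lemma homotopic_on_finite_disjoint_closed:
  fixes A :: "'i \<Rightarrow> 'a::euclidean_space set" and f g :: "'a \<Rightarrow> 'b::topological_space"
  assumes J: "finite J" and A: "\<And>j. j \<in> J \<Longrightarrow> closed (A j)" 
    and disj: "\<And>i j. i \<in> J \<Longrightarrow> j \<in> J \<Longrightarrow> i \<noteq> j \<Longrightarrow> A i \<inter> A j = {}"
    and hom: "\<And>j. j \<in> J \<Longrightarrow> homotopic_with_canon (\<lambda>_. True) (A j) T f g"
  shows "homotopic_with_canon (\<lambda>_. True) (\<Union>j\<in>J. A j) T f g"
proof (rule homotopic_on_clopen_Union)
  fix S assume "S \<in> A ` J"
  then obtain j where j: "j \<in> J" "S = A j" by blast
  show "homotopic_with_canon (\<lambda>_. True) S T f g" using hom j by simp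
  show "closedin (top_of_set (\<Union> (A ` J))) S"
    using A[OF j(1)] j by (intro closed_subset) auto
  have "closed (\<Union>i\<in>J - {j}. A i)" using A J by (intro closed_UN) auto
  then have "closedin (top_of_set (\<Union> (A ` J))) (\<Union>i\<in>J - {j}. A i)" by (intro closed_subset) auto
  moreover have "(\<Union> (A ` J)) - (\<Union>i\<in>J - {j}. A i) = S" using disj[OF j(1)] j by fastforce
  ultimately show "openin (top_of_set (\<Union> (A ` J))) S"
    by (metis openin_diff openin_subtopology_self topspace_euclidean_subtopology)
qed

text \<open>The centres are points of a cubic lattice of spacing 3 \<open>\<rho>\<close>, with
  indices below q in each coordinate. The l1 norm bounds their distance from 0 by 3
  \<open>\<rho>\<close> q d, where d is the dimension, which explains the bound on
  \<open>\<rho>\<close>.\<close>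

lemma ball_packing:
  fixes q N :: nat
  assumes q: "q \<ge> 1" and N: "N \<le> q ^ DIM('a::euclidean_space)" and \<rho>: "\<rho> > 0" "\<rho> * (3 * real q * real DIM('a) + 1) < 1"
  shows "\<exists>b :: nat \<Rightarrow> 'a. (\<forall>i<N. cball (b i) \<rho> \<subseteq> ball 0 1) \<and> 
     (\<forall>i<N. \<forall>j<N. i \<noteq> j \<longrightarrow> cball (b i) \<rho> \<inter> cball (b j) \<rho> = {})"
proof -
  let ?S = "Basis \<rightarrow>\<^sub>E {..<q} :: ('a \<Rightarrow> nat) set"
  have fin: "finite ?S" by (intro finite_PiE) auto
  have "card ?S = q ^ DIM('a)" unfolding card_PiE[OF finite_Basis] card_lessThan by (rule prod_constant)
  then obtain v where v: "v ` {..<N} \<subseteq> ?S" "inj_on v {..<N}"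
    using card_le_inj[of "{..<N}" ?S] fin N by auto
  define b where "b i = (\<Sum>e\<in>Basis. (3 * \<rho> * real (v i e)) *\<^sub>R e)" for i
  have be: "b i \<bullet> e = 3 * \<rho> * real (v i e)" if "e \<in> Basis" for i e using that by (simp add: b_def)
  have vq: "v i e < q" if "i < N" "e \<in> Basis" for i e using v(1) that by (auto simp: PiE_iff)
  have norm: "norm (b i) \<le> \<rho> * (3 * real q * real DIM('a))" if i: "i < N" for i
  proof -
    have "norm (b i) \<le> (\<Sum>e\<in>Basis. \<bar>b i \<bullet> e\<bar>)" by (rule norm_le_l1)
    also have "\<dots> \<le> (\<Sum>e\<in>(Basis::'a set). 3 * \<rho> * real q)"
    proof (rule sum_mono)
      fix e :: 'a assume e: "e \<in> Basis"
      have "3 * \<rho> * real (v i e) \<le> 3 * \<rho> * real q" using vq[OF i e] \<rho> by (intro mult_left_mono) auto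
      then show "\<bar>b i \<bullet> e\<bar> \<le> 3 * \<rho> * real q" using \<rho> by (simp add: be[OF e])
    qed
    finally show ?thesis by (simp add: ac_simps)
  qed
  have sep: "3 * \<rho> \<le> dist (b i) (b j)" if ij: "i < N" "j < N" "i \<noteq> j" for i j
  proof -
    have "v i \<noteq> v j" using v(2) ij by (auto dest: inj_onD)
    moreover have "v i \<in> ?S" "v j \<in> ?S" using v(1) ij by auto
    ultimately obtain e where e: "e \<in> Basis" "v i e \<noteq> v j e" using PiE_ext[of "v i" Basis _ "v j"] by blast
    have "\<bar>real (v i e) - real (v j e)\<bar> \<ge> 1" using e(2) by linarith
    then have "3 * \<rho> * 1 \<le> 3 * \<rho> * \<bar>real (v i e) - real (v j e)\<bar>" using \<rho> by (intro mult_left_mono) auto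
    also have "\<dots> = \<bar>(b i - b j) \<bullet> e\<bar>" using \<rho> by (simp add: inner_diff_left be[OF e(1)] abs_mult flip: right_diff_distrib)
    also have "\<dots> \<le> dist (b i) (b j)" unfolding dist_norm by (rule Basis_le_norm[OF e(1)])
    finally show ?thesis by simp
  qed
  show ?thesis
  proof (intro exI[of _ b] conjI allI impI)
    fix i assume i: "i < N"
    show "cball (b i) \<rho> \<subseteq> ball 0 1"
    proof
      fix x assume "x \<in> cball (b i) \<rho>"
      then have "norm x \<le> norm (b i) + \<rho>" using norm_triangle_sub[of x "b i"] by (simp add: dist_norm norm_minus_commute)
      then have "norm x < 1" using norm[OF i] \<rho>(2) by (simp add: distrib_left)
      then show "x \<in> ball 0 1" by simp
    qed
    fix j assume j: "j < N" "i \<noteq> j"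
    show "cball (b i) \<rho> \<inter> cball (b j) \<rho> = {}"
    proof (rule equals0I)
      fix x assume x: "x \<in> cball (b i) \<rho> \<inter> cball (b j) \<rho>"
      then have "dist (b i) (b j) \<le> 2 * \<rho>" using dist_triangle[of "b i" "b j" x] by (simp add: dist_commute)
      then show False using sep[OF i j] \<rho>(1) by linarith
    qed
  qed
qed

lemma infnorm_cell_centers_lt:
  assumes "c \<in> cell_centers p" "p \<ge> 1"
  shows "infnorm c \<le> real p - 1/2"
  unfolding infnorm_le_iff
proof
  fix e :: 'a assume "e \<in> Basis"
  then obtain i :: int where i: "- int p \<le> i" "i < int p" "c \<bullet> e = of_int i + 1/2"
    using assms(1) by (auto simp: cell_centers_def)
  have "- real p \<le> of_int i" "of_int i + 1 \<le> real p" using i(1,2) by linarith+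
  then show "\<bar>c \<bullet> e\<bar> \<le> real p - 1/2" unfolding abs_le_iff i(3) by linarith
qed

lemma infnorm_cell_centers_diff:
  assumes "c \<in> cell_centers p" "d \<in> cell_centers p" "c \<noteq> d"
  shows "1 \<le> infnorm (c - d)"
proof -
  have "\<exists>e\<in>Basis. c \<bullet> e \<noteq> d \<bullet> e" using assms(3) euclidean_eqI by blast
  then obtain e where e: "e \<in> Basis" "c \<bullet> e \<noteq> d \<bullet> e" by blast
  obtain i :: int where i: "c \<bullet> e = of_int i + 1/2" using assms(1) e(1) by (auto simp: cell_centers_def)
  obtain j :: int where j: "d \<bullet> e = of_int j + 1/2" using assms(2) e(1) by (auto simp: cell_centers_def)
  have "i \<noteq> j" using e(2) i j by auto
  then have "\<bar>of_int i - of_int j\<bar> \<ge> (1::real)" by linarith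
  moreover have "(c - d) \<bullet> e = of_int i - of_int j" using i j by (simp add: inner_diff_left)
  ultimately show ?thesis using Basis_le_infnorm[OF e(1), of "c - d"] by simp
qed

text \<open>\<open>\<theta>\<close> is beta pushed radially to the boundary of the cube of half-side
  p, and \<open>c i\<close> + \<open>\<theta>\<close>/(2p) runs on the boundary of the unit cell
  about \<open>c i\<close>. The map of punctured spaces has the right classes on the boundary
  spheres of X. Borsuk's theorem, for the open complement of the cell centres, deforms it to a map
  with exactly the prescribed boundary values; these are Lipschitz and lie in the grid, so the
  passage to a Lipschitz map into the grid keeps them.\<close>

lemma collared_map:
  fixes \<beta> :: "real \<times> 'k::euclidean_space \<Rightarrow> real \<times> 'n::euclidean_space" and p N :: nat
  assumes \<beta>: "lipschitz_map (sphere 0 1) \<beta>" "\<beta> ` sphere 0 1 \<subseteq> sphere 0 1" and star: "cond_star \<beta>"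
    and p: "p \<ge> 1" and c: "bij_betw c {..<N} (cell_centers p)"
    and b: "\<And>i. i < N \<Longrightarrow> cball (b i) r \<subseteq> ball 0 1"
      "\<And>i j. i < N \<Longrightarrow> j < N \<Longrightarrow> i \<noteq> j \<Longrightarrow> cball (b i) r \<inter> cball (b j) r = {}" and r: "r > 0"
    and \<theta>: "\<theta> = (\<lambda>x. (real p * inverse (infnorm (\<beta> x))) *\<^sub>R \<beta> x)"
    and X: "X = cball 0 1 - (\<Union>i\<in>{..<N}. ball (b i) r)"
  shows "\<exists>F. lipschitz_map X F \<and> F ` X \<subseteq> grid \<and> (\<forall>x\<in>sphere 0 1. F x = \<theta> x) \<and>
     (\<forall>i<N. \<forall>x. norm x = 1 \<longrightarrow> F (b i + r *\<^sub>R x) = c i + (1 / (2 * real p)) *\<^sub>R \<theta> x)"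
proof -
  let ?I = "{..<N}" and ?C = "cell_centers p :: (real \<times> 'n) set"
  have cI: "c ` ?I = ?C" "inj_on c ?I" using c by (auto simp: bij_betw_def)
  have cC: "c i \<in> ?C" if "i < N" for i using cI(1) that by blast
  have nb: "norm (\<beta> x) = 1" if "norm x = 1" for x using \<beta>(2) that by (auto simp: image_subset_iff)
  have b0: "infnorm (\<beta> x) > 0" "\<beta> x \<noteq> 0" if "norm x = 1" for x
  proof -
    show "\<beta> x \<noteq> 0" using nb[OF that] by auto
    then show "infnorm (\<beta> x) > 0" by (simp add: infnorm_pos_lt)
  qed
  have N1: "N \<ge> 1"
  proof -
    have "(\<Sum>e\<in>Basis. (1/2::real) *\<^sub>R e) \<in> ?C"
      unfolding cell_centers_def mem_Collect_eq
    proof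
      fix e :: "real \<times> 'n" assume "e \<in> Basis"
      then show "\<exists>i\<ge>- int p. i < int p \<and> (\<Sum>e\<in>Basis. (1/2::real) *\<^sub>R e) \<bullet> e = of_int i + 1/2"
        using p by (intro exI[of _ 0]) simp
    qed
    then have "?I \<noteq> {}" using cI(1) by blast
    then show ?thesis by auto
  qed
  have c\<beta>: "continuous_on (sphere 0 1) \<beta>" by (rule lipschitz_map_continuous[OF \<beta>(1)])
  have inf1: "infnorm (\<theta> x) = real p" "\<theta> x = (real p * inverse (infnorm (\<beta> x))) *\<^sub>R \<beta> x" if "norm x = 1" for x
    using b0(1)[OF that] by (simp_all add: \<theta> infnorm_mul)
  have l\<theta>: "lipschitz_map (sphere 0 1) \<theta>"
  proof -
    define D where "D = sqrt (real DIM(real \<times> 'n))"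
    have D: "D > 0" by (simp add: D_def)
    have "lipschitz_map (sphere 0 1) (\<lambda>y::real \<times> 'n. inverse (infnorm y) *\<^sub>R y)"
    proof (rule lipschitz_map_rescale[OF bounded_sphere lipschitz_map_infnorm])
      show "inverse D > 0" using D by simp
      fix y :: "real \<times> 'n" assume "y \<in> sphere 0 1"
      then have "1 \<le> D * infnorm y" using norm_le_infnorm[of y] by (simp add: D_def)
      then show "inverse D \<le> infnorm y" using D by (simp add: field_simps)
    qed
    from lipschitz_map_compose[OF this \<beta>] have "lipschitz_map (sphere 0 1) (\<lambda>x. inverse (infnorm (\<beta> x)) *\<^sub>R \<beta> x)" .
    from lipschitz_map_compose[OF lipschitz_map_bounded_linear[OF bounded_linear_scaleR_right] this subset_UNIV, of "real p"]
    show ?thesis by (rule lipschitz_map_cong) (simp add: \<theta>)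
  qed
  have c\<theta>: "continuous_on (sphere 0 1) \<theta>" by (rule lipschitz_map_continuous[OF l\<theta>])
  have binj: "inj_on b ?I"
  proof (rule inj_onI, rule ccontr)
    fix i j assume ij: "i \<in> ?I" "j \<in> ?I" "b i = b j" "i \<noteq> j"
    have "b i \<in> cball (b i) r \<inter> cball (b j) r" using ij(3) r by simp
    then show False using b(2)[of i j] ij by auto
  qed
  obtain F where F: "continuous_on (- b ` ?I) F" "F ` (- b ` ?I) \<subseteq> - c ` ?I"
     "\<And>j. j < N \<Longrightarrow> \<exists>e>0. \<forall>\<epsilon> \<delta>. 0 < \<epsilon> \<and> \<epsilon> < e \<and> 0 < \<delta> \<and> \<delta> < e \<longrightarrow>
        sphere_homotopic (- c ` ?I) (\<lambda>x. F (b j + \<epsilon> *\<^sub>R x)) (\<lambda>x. c j + \<delta> *\<^sub>R \<beta> x)"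
     "\<exists>R0. \<forall>R S. R0 < R \<and> R0 < S \<longrightarrow> sphere_homotopic (- c ` ?I) (\<lambda>x. F (R *\<^sub>R x)) (\<lambda>x. S *\<^sub>R \<beta> x)"
    using punctured_space_map[OF c\<beta> \<beta>(2) star N1 binj cI(2)] by blast
  note F = F[unfolded cI(1)]
  have leftF: "sphere_homotopic (- ?C) (\<lambda>x. F (f x)) (\<lambda>x. F (g x))" if "sphere_homotopic (- b ` ?I) f g" 
    for f g :: "real \<times> 'k \<Rightarrow> _"
    by (rule sphere_homotopic_left[OF that F(1,2)])
  have outer: "sphere_homotopic (- ?C) F \<theta>"
  proof -
    obtain R0 where R0: "\<And>R S. R0 < R \<Longrightarrow> R0 < S \<Longrightarrow> sphere_homotopic (- ?C) (\<lambda>x. F (R *\<^sub>R x)) (\<lambda>x. S *\<^sub>R \<beta> x)"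
      using F(4) by blast
    define D where "D = sqrt (real DIM(real \<times> 'n))"
    have D: "D > 0" by (simp add: D_def)
    \<comment> \<open>Beyond \<open>R0\<close>, and so large that R beta lies outside the open cube:
      the sup norm of beta is at least 1 / D.\<close>
    define R where "R = max (R0 + 1) (max 1 (real p * D))"
    have R: "R > R0" "R \<ge> 1" "R \<ge> real p * D" by (auto simp: R_def)
    have bs: "norm (b i) < 1" if "i < N" for i
    proof -
      have "b i \<in> cball (b i) r" using r by simp
      then have "b i \<in> ball 0 1" using b(1)[OF that] by blast
      then show ?thesis by simp
    qed
    have "sphere_homotopic (- b ` ?I) (\<lambda>x. x) (\<lambda>x. R *\<^sub>R x)"
    proof (rule sphere_homotopic_linear)
      fix x :: "real \<times> 'k" and s :: real assume x: "norm x = 1" and s: "0 \<le> s" "s \<le> 1"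
      have eq: "(1 - s) *\<^sub>R x + s *\<^sub>R (R *\<^sub>R x) = (1 - s + s * R) *\<^sub>R x" by (simp add: scaleR_left_distrib)
      have "s * 1 \<le> s * R" using s R(2) by (intro mult_left_mono) auto
      then have "norm ((1 - s + s * R) *\<^sub>R x) \<ge> 1" using x s by simp
      then show "(1 - s) *\<^sub>R x + s *\<^sub>R (R *\<^sub>R x) \<in> - b ` ?I" unfolding eq using bs by force
    qed (intro continuous_intros)+
    then have 1: "sphere_homotopic (- ?C) (\<lambda>x. F x) (\<lambda>x. F (R *\<^sub>R x))" by (rule leftF)
    have 2: "sphere_homotopic (- ?C) (\<lambda>x. F (R *\<^sub>R x)) (\<lambda>x. R *\<^sub>R \<beta> x)" by (rule R0) (use R in auto)
    have 3: "sphere_homotopic (- ?C) (\<lambda>x. R *\<^sub>R \<beta> x) \<theta>"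
    proof (rule sphere_homotopic_linear[OF _ c\<theta>])
      show "continuous_on (sphere 0 1) (\<lambda>x. R *\<^sub>R \<beta> x)" by (intro continuous_intros c\<beta>)
      fix x :: "real \<times> 'k" and s :: real assume x: "norm x = 1" and s: "0 \<le> s" "s \<le> 1"
      define i where "i = infnorm (\<beta> x)"
      have i: "i > 0" using b0[OF x] by (simp add: i_def)
      have "1 \<le> D * i" using norm_le_infnorm[of "\<beta> x"] nb[OF x] by (simp add: D_def i_def)
      then have "real p * 1 \<le> real p * (D * i)" by (intro mult_left_mono) auto
      also have "\<dots> = (real p * D) * i" by simp
      also have "\<dots> \<le> R * i" using R(3) i by (intro mult_right_mono) auto
      finally have Ri: "real p \<le> R * i" by simp
      define k where "k = (1 - s) * R + s * (real p * inverse i)"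
      have eq: "(1 - s) *\<^sub>R R *\<^sub>R \<beta> x + s *\<^sub>R \<theta> x = k *\<^sub>R \<beta> x"
        by (simp add: inf1(2)[OF x] k_def i_def scaleR_left_distrib)
      have "k * i = (1 - s) * (R * i) + s * (real p * (inverse i * i))" by (simp only: k_def distrib_right mult.assoc)
      also have "\<dots> = (1 - s) * (R * i) + s * real p" using i by simp
      also have "\<dots> \<ge> (1 - s) * real p + s * real p" using Ri s by (intro add_right_mono mult_left_mono) auto
      finally have "k * i \<ge> real p" by (simp add: algebra_simps)
      moreover have "k \<ge> 0" using s R(2) i by (simp add: k_def)
      ultimately have "infnorm (k *\<^sub>R \<beta> x) \<ge> real p" by (simp add: infnorm_mul i_def)
      then have "k *\<^sub>R \<beta> x \<notin> ?C" using infnorm_cell_centers_lt[of "k *\<^sub>R \<beta> x" p] p by linarith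
      then show "(1 - s) *\<^sub>R R *\<^sub>R \<beta> x + s *\<^sub>R \<theta> x \<in> - ?C" unfolding eq by simp
    qed
    show ?thesis using homotopic_with_trans[OF 1 homotopic_with_trans[OF 2 3]] by simp
  qed
  have inner: "sphere_homotopic (- ?C) (\<lambda>x. F (b j + r *\<^sub>R x)) (\<lambda>x. c j + (1 / (2 * real p)) *\<^sub>R \<theta> x)" if j: "j < N" for j
  proof -
    obtain e where e: "e > 0" "\<And>\<epsilon> \<delta>. 0 < \<epsilon> \<Longrightarrow> \<epsilon> < e \<Longrightarrow> 0 < \<delta> \<Longrightarrow> \<delta> < e \<Longrightarrow>
        sphere_homotopic (- ?C) (\<lambda>x. F (b j + \<epsilon> *\<^sub>R x)) (\<lambda>x. c j + \<delta> *\<^sub>R \<beta> x)"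
      using F(3)[OF j] by blast
    \<comment> \<open>Used as a radius on both sides: at most r in the domain, and at most 1/2 in
      the target, so that the sphere about the centre stays in its cell on the way to the cell
      boundary.\<close>
    define \<epsilon> where "\<epsilon> = min (e / 2) (min r (1/2))"
    have \<epsilon>: "0 < \<epsilon>" "\<epsilon> < e" "\<epsilon> \<le> r" "\<epsilon> \<le> 1/2" using e(1) r by (auto simp: \<epsilon>_def)
    have "sphere_homotopic (- b ` ?I) (\<lambda>x. b j + r *\<^sub>R x) (\<lambda>x. b j + \<epsilon> *\<^sub>R x)"
    proof (rule sphere_homotopic_linear)
      fix x :: "real \<times> 'k" and s :: real assume x: "norm x = 1" and s: "0 \<le> s" "s \<le> 1"
      define k where "k = (1 - s) * r + s * \<epsilon>"
      have eq: "(1 - s) *\<^sub>R (b j + r *\<^sub>R x) + s *\<^sub>R (b j + \<epsilon> *\<^sub>R x) = b j + k *\<^sub>R x"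
        by (simp add: k_def algebra_simps)
      have "(1 - s) * \<epsilon> + s * \<epsilon> \<le> k" unfolding k_def using s \<epsilon> by (intro add_right_mono mult_left_mono) auto
      then have k0: "k > 0" using \<epsilon>(1) by (simp add: algebra_simps)
      have "k \<le> (1 - s) * r + s * r" unfolding k_def using s \<epsilon> by (intro add_left_mono mult_left_mono) auto
      then have kr: "k \<le> r" by (simp add: algebra_simps)
      have in_ball: "b j + k *\<^sub>R x \<in> cball (b j) r" using x k0 kr by (simp add: dist_norm)
      have "b j + k *\<^sub>R x \<noteq> b i" if "i < N" for i
      proof (cases "i = j")
        case True
        then show ?thesis using k0 x by auto
      next
        case False
        have "b i \<in> cball (b i) r" using r by simp
        then show ?thesis using b(2)[OF that j False] in_ball by (metis IntI empty_iff)
      qed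
      then show "(1 - s) *\<^sub>R (b j + r *\<^sub>R x) + s *\<^sub>R (b j + \<epsilon> *\<^sub>R x) \<in> - b ` ?I" unfolding eq by auto
    qed (intro continuous_intros)+
    then have 1: "sphere_homotopic (- ?C) (\<lambda>x. F (b j + r *\<^sub>R x)) (\<lambda>x. F (b j + \<epsilon> *\<^sub>R x))" by (rule leftF)
    have 2: "sphere_homotopic (- ?C) (\<lambda>x. F (b j + \<epsilon> *\<^sub>R x)) (\<lambda>x. c j + \<epsilon> *\<^sub>R \<beta> x)"
      by (rule e(2)) (use \<epsilon> in auto)
    have 3: "sphere_homotopic (- ?C) (\<lambda>x. c j + \<epsilon> *\<^sub>R \<beta> x) (\<lambda>x. c j + (1 / (2 * real p)) *\<^sub>R \<theta> x)"
    proof (rule sphere_homotopic_linear)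
      show "continuous_on (sphere 0 1) (\<lambda>x. c j + \<epsilon> *\<^sub>R \<beta> x)" by (intro continuous_intros c\<beta>)
      show "continuous_on (sphere 0 1) (\<lambda>x. c j + (1 / (2 * real p)) *\<^sub>R \<theta> x)" by (intro continuous_intros c\<theta>)
      fix x :: "real \<times> 'k" and s :: real assume x: "norm x = 1" and s: "0 \<le> s" "s \<le> 1"
      define i where "i = infnorm (\<beta> x)"
      have i: "i > 0" using b0[OF x] by (simp add: i_def)
      have i1: "i \<le> 1" using infnorm_le_norm[of "\<beta> x"] nb[OF x] by (simp add: i_def)
      define k where "k = (1 - s) * \<epsilon> + s * (inverse i / 2)"
      have eq: "(1 - s) *\<^sub>R (c j + \<epsilon> *\<^sub>R \<beta> x) + s *\<^sub>R (c j + (1 / (2 * real p)) *\<^sub>R \<theta> x) = c j + k *\<^sub>R \<beta> x"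
      proof -
        have "(1 / (2 * real p)) *\<^sub>R \<theta> x = (inverse i / 2) *\<^sub>R \<beta> x" using p by (simp add: inf1(2)[OF x] i_def)
        then show ?thesis by (simp add: k_def algebra_simps)
      qed
      have k0: "k > 0"
      proof (cases "s = 1")
        case False
        then have "(1 - s) * \<epsilon> > 0" using s \<epsilon> by simp
        moreover have "s * (inverse i / 2) \<ge> 0" using s i by simp
        ultimately show ?thesis by (simp add: k_def)
      qed (use i in \<open>simp add: k_def\<close>)
      have "\<epsilon> * i \<le> 1/2 * 1" using \<epsilon> i i1 by (intro mult_mono) auto
      then have "(1 - s) * (\<epsilon> * i) + s * (1/2) \<le> (1 - s) * (1/2) + s * (1/2)" using s by (intro add_right_mono mult_left_mono) auto
      moreover have "k * i = (1 - s) * (\<epsilon> * i) + s * (1/2)" using i by (simp add: k_def distrib_right)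
      moreover have "(1 - s) * (1/2) + s * (1/2) = (1/2::real)" unfolding distrib_right[symmetric] by simp
      ultimately have ki: "k * i \<le> 1/2" by linarith
      have "c j + k *\<^sub>R \<beta> x \<noteq> d" if d: "d \<in> ?C" for d
      proof
        assume eqd: "c j + k *\<^sub>R \<beta> x = d"
        show False
        proof (cases "d = c j")
          case True
          then show False using eqd k0 b0(2)[OF x] by simp
        next
          case False
          have "d - c j = k *\<^sub>R \<beta> x" using eqd by (simp add: algebra_simps)
          then have "infnorm (d - c j) = k * i" using k0 by (simp add: infnorm_mul i_def)
          then show False using infnorm_cell_centers_diff[OF d cC[OF j] False] ki by linarith
        qed
      qed
      then show "(1 - s) *\<^sub>R (c j + \<epsilon> *\<^sub>R \<beta> x) + s *\<^sub>R (c j + (1 / (2 * real p)) *\<^sub>R \<theta> x) \<in> - ?C" unfolding eq by blast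
    qed
    show ?thesis by (rule homotopic_with_trans[OF 1 homotopic_with_trans[OF 2 3]])
  qed
  \<comment> \<open>\<open>None\<close> stands for the outer sphere, \<open>Some i\<close> for the
    sphere around the i-th hole.\<close>
  define A where "A o' = (case o' of None \<Rightarrow> sphere 0 1 | Some i \<Rightarrow> sphere (b i) r)" for o'
  define J where "J = insert None (Some ` ?I)"
  define \<phi> where "\<phi> i x = c i + (1 / (2 * real p)) *\<^sub>R \<theta> (inverse r *\<^sub>R (x - b i))" for i x
  define f where "f x = (if norm x = 1 then \<theta> x else \<phi> (SOME i. i < N \<and> x \<in> sphere (b i) r) x)" for x
  have scb: "sphere (b i) r \<subseteq> ball 0 1" "sphere (b i) r \<subseteq> cball (b i) r" if "i < N" for i
    using b(1)[OF that] sphere_cball by blast+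
  have fo: "f x = \<theta> x" if "x \<in> sphere 0 1" for x using that by (simp add: f_def)
  have fi: "f x = \<phi> i x" if i: "i < N" and x: "x \<in> sphere (b i) r" for i x
  proof -
    have "x \<in> ball 0 1" using scb(1)[OF i] x by blast
    then have n1: "norm x \<noteq> 1" by simp
    have "(SOME j. j < N \<and> x \<in> sphere (b j) r) = i"
    proof (rule some_equality)
      fix j assume j: "j < N \<and> x \<in> sphere (b j) r"
      show "j = i"
      proof (rule ccontr)
        assume "j \<noteq> i"
        then have "cball (b j) r \<inter> cball (b i) r = {}" using b(2) i j by blast
        then show False using scb(2)[of j] scb(2)[OF i] j x by blast
      qed
    qed (use i x in auto)
    then show ?thesis using n1 by (simp add: f_def)
  qed
  have J: "finite J" by (simp add: J_def)
  have AX: "(\<Union>o'\<in>J. A o') \<subseteq> X"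
  proof (rule UN_least)
    fix o' assume "o' \<in> J"
    then consider "o' = None" | i where "i < N" "o' = Some i" by (auto simp: J_def)
    then show "A o' \<subseteq> X"
    proof cases
      case 1
      have "x \<notin> ball (b i) r" if "norm x = 1" "i < N" for x i
      proof
        assume "x \<in> ball (b i) r"
        then have "x \<in> ball 0 1" using b(1)[OF that(2)] ball_subset_cball by blast
        then show False using that(1) by simp
      qed
      then show ?thesis unfolding 1 A_def X by auto
    next
      case 2
      show ?thesis
      proof
        fix x assume "x \<in> A o'"
        then have x: "x \<in> sphere (b i) r" by (simp add: A_def 2)
        have "x \<notin> ball (b j) r" if "j < N" for j
        proof (cases "j = i")
          case False
          then show ?thesis using b(2)[OF that 2(1) False] scb(2)[OF 2(1)] x ball_subset_cball by blast
        qed (use x in simp)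
        moreover have "x \<in> cball 0 1" using scb(1)[OF 2(1)] x ball_subset_cball by blast
        ultimately show "x \<in> X" by (auto simp: X)
      qed
    qed
  qed
  have Adisj: "A u \<inter> A v = {}" if uv: "u \<in> J" "v \<in> J" "u \<noteq> v" for u v
  proof -
    have os: "sphere 0 1 \<inter> sphere (b i) r = {}" if "i < N" for i using scb(1)[OF that] by fastforce
    have ss: "sphere (b i) r \<inter> sphere (b j) r = {}" if "i < N" "j < N" "i \<noteq> j" for i j 
      using b(2)[OF that] scb(2)[OF that(1)] scb(2)[OF that(2)] by blast
    have mem: "i < N" if "Some i \<in> J" for i using that by (auto simp: J_def)
    show ?thesis
    proof (cases u)
      case None
      then obtain j where j: "v = Some j" using uv(3) by (cases v) auto
      then show ?thesis using os[OF mem[of j]] uv(2) unfolding A_def None j option.case by blast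
    next
      case (Some i)
      note u = this
      show ?thesis
      proof (cases v)
        case None
        show ?thesis using os[OF mem[of i]] uv(1) unfolding A_def None u option.case by blast
      next
        case (Some j)
        show ?thesis using ss[OF mem[of i] mem[of j]] uv unfolding A_def Some u option.case by blast
      qed
    qed
  qed
  have rescale: "inverse r *\<^sub>R (x - b i) \<in> sphere 0 1" if "x \<in> sphere (b i) r" for x i
    using that r by (simp add: dist_norm norm_minus_commute)
  have homA: "homotopic_with_canon (\<lambda>_. True) (A o') (- ?C) F f" if o': "o' \<in> J" for o'
  proof (cases o')
    case None
    have "sphere_homotopic (- ?C) F f" by (rule sphere_homotopic_cong[OF outer]) (simp_all add: fo)
    then show ?thesis by (simp add: None A_def)
  next
    case (Some i)
    then have i: "i < N" using o' by (auto simp: J_def)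
    have "homotopic_with_canon (\<lambda>_. True) (sphere (b i) r) (- ?C) 
        ((\<lambda>x. F (b i + r *\<^sub>R x)) \<circ> (\<lambda>x. inverse r *\<^sub>R (x - b i)))
        ((\<lambda>x. c i + (1 / (2 * real p)) *\<^sub>R \<theta> x) \<circ> (\<lambda>x. inverse r *\<^sub>R (x - b i)))"
      by (rule homotopic_with_compose_continuous_right[where X="sphere 0 1"])
         (use inner[OF i] rescale in \<open>auto intro!: continuous_intros\<close>)
    then have "homotopic_with_canon (\<lambda>_. True) (sphere (b i) r) (- ?C) F f"
      by (rule homotopic_with_eq) (use r fi[OF i] in \<open>auto simp: \<phi>_def\<close>)
    then show ?thesis by (simp add: Some A_def)
  qed
  have hom: "homotopic_with_canon (\<lambda>_. True) (\<Union>o'\<in>J. A o') (- ?C) F f"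
    by (rule homotopic_on_finite_disjoint_closed[OF J _ Adisj homA]) (auto simp: A_def split: option.split)
  have Xc: "compact X" unfolding X by (intro compact_diff open_UN) auto
  have bX: "X \<subseteq> - b ` ?I"
  proof
    fix x assume x: "x \<in> X"
    have "x \<noteq> b i" if "i < N" for i
    proof -
      have "b i \<in> (\<Union>i\<in>{..<N}. ball (b i) r)" using that r by (intro UN_I[of i]) auto
      then show ?thesis using x unfolding X by blast
    qed
    then show "x \<in> - b ` ?I" by blast
  qed
  have cAX: "closedin (top_of_set X) (\<Union>o'\<in>J. A o')"
    by (rule closed_subset[OF AX]) (use J in \<open>auto intro!: closed_UN simp: A_def split: option.split\<close>)
  have "open (- ?C)" by (intro open_Compl finite_imp_closed cell_centers_card)
  then have anr: "ANR (- ?C)" by (rule open_imp_ANR)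
  have FX: "F \<in> X \<rightarrow> - ?C" using F(2) bX by blast
  have "\<exists>G. continuous_on X G \<and> G ` X \<subseteq> - ?C \<and> (\<forall>x\<in>(\<Union>o'\<in>J. A o'). G x = f x)"
    by (rule Borsuk_homotopy_extension_homotopic[OF cAX disjI2[OF anr] continuous_on_subset[OF F(1) bX] FX hom]) blast
  then obtain G where G: "continuous_on X G" "G ` X \<subseteq> - ?C" "\<And>x. x \<in> (\<Union>o'\<in>J. A o') \<Longrightarrow> G x = f x" by blast
  have l\<phi>: "lipschitz_map (sphere (b i) r) (\<phi> i)" for i
  proof -
    have "lipschitz_map (sphere (b i) r) (\<lambda>x. inverse r *\<^sub>R (x - b i))"
      by (rule lipschitz_map_bound[of _ _ "inverse r"]) (use r in \<open>simp add: dist_norm flip: scaleR_diff_right\<close>)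
    from lipschitz_map_compose[OF l\<theta> this] have "lipschitz_map (sphere (b i) r) (\<lambda>x. \<theta> (inverse r *\<^sub>R (x - b i)))"
      using rescale by blast
    from lipschitz_map_compose[OF lipschitz_map_bounded_linear[OF bounded_linear_scaleR_right] this subset_UNIV, of "1 / (2 * real p)"]
    show ?thesis unfolding \<phi>_def by (intro lipschitz_map_add lipschitz_map_const)
  qed
  have lf: "lipschitz_map (\<Union>o'\<in>J. A o') f"
  proof (rule lipschitz_map_disjoint_Union[OF J _ _ Adisj])
    show "compact (A o')" for o' by (auto simp: A_def split: option.split)
    show "lipschitz_map (A o') f" if o': "o' \<in> J" for o'
    proof (cases o')
      case None
      show ?thesis unfolding None A_def option.case by (rule lipschitz_map_cong[OF l\<theta> fo])
    next
      case (Some i)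
      then have "i < N" using o' by (auto simp: J_def)
      then show ?thesis unfolding Some A_def option.case by (intro lipschitz_map_cong[OF l\<phi> fi])
    qed
  qed
  have fgrid: "f x \<in> grid \<inter> big_cube p" if x: "x \<in> (\<Union>o'\<in>J. A o')" for x
  proof -
    obtain o' where o': "o' \<in> J" "x \<in> A o'" using x by blast
    show ?thesis
    proof (cases o')
      case None
      then have n: "norm x = 1" and fx: "f x = \<theta> x" using o' fo by (auto simp: A_def)
      obtain e where e: "e \<in> Basis" "infnorm (\<theta> x) = \<bar>\<theta> x \<bullet> e\<bar>" by (rule infnorm_attained)
      have "\<theta> x \<bullet> e = of_int (int p) \<or> \<theta> x \<bullet> e = of_int (- int p)" using e(2) inf1(1)[OF n] by auto
      then have "\<theta> x \<bullet> e \<in> \<int>" by (metis Ints_of_int)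
      then show ?thesis using e(1) inf1(1)[OF n] by (auto simp: fx grid_def big_cube_def)
    next
      case (Some i)
      then have i: "i < N" and xs: "x \<in> sphere (b i) r" using o' by (auto simp: J_def A_def)
      define u where "u = inverse r *\<^sub>R (x - b i)"
      have n: "norm u = 1" using rescale[OF xs] by (simp add: u_def)
      define w where "w = (1 / (2 * real p)) *\<^sub>R \<theta> u"
      have fx: "f x = c i + w" using fi[OF i xs] by (simp add: \<phi>_def u_def w_def)
      have iw: "infnorm w = 1/2" using inf1(1)[OF n] p by (simp add: w_def infnorm_mul)
      obtain e where e: "e \<in> Basis" "infnorm w = \<bar>w \<bullet> e\<bar>" by (rule infnorm_attained)
      obtain m :: int where m: "c i \<bullet> e = of_int m + 1/2" using cC[OF i] e(1) by (auto simp: cell_centers_def)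
      have "w \<bullet> e = 1/2 \<or> w \<bullet> e = -1/2" using e(2) iw by auto
      then have "f x \<bullet> e = of_int (m + 1) \<or> f x \<bullet> e = of_int m" by (auto simp: fx inner_add_left m)
      then have "f x \<bullet> e \<in> \<int>" by (metis Ints_of_int)
      moreover have "infnorm (f x) \<le> real p"
        using infnorm_triangle[of "c i" w] infnorm_cell_centers_lt[OF cC[OF i] p] iw unfolding fx by linarith
      ultimately show ?thesis using e(1) by (auto simp: grid_def big_cube_def)
    qed
  qed
  have lG: "lipschitz_map (\<Union>o'\<in>J. A o') G" by (rule lipschitz_map_cong[OF lf G(3)])
  have "G ` (\<Union>o'\<in>J. A o') \<subseteq> grid \<inter> big_cube p" using G(3) fgrid by (simp add: image_subset_iff)
  from lipschitz_map_into_grid[OF Xc AX lG this G(1,2)] obtain H where 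
    H: "lipschitz_map X H" "H ` X \<subseteq> grid" "\<And>x. x \<in> (\<Union>o'\<in>J. A o') \<Longrightarrow> H x = G x" by blast
  show ?thesis
  proof (intro exI[of _ H] conjI ballI allI impI H(1,2))
    fix x :: "real \<times> 'k" assume x: "x \<in> sphere 0 1"
    then have "x \<in> A None" by (simp add: A_def)
    moreover have "None \<in> J" by (simp add: J_def)
    ultimately show "H x = \<theta> x" using H(3)[of x] G(3)[of x] fo[OF x] by (metis UN_I)
  next
    fix i and x :: "real \<times> 'k" assume i: "i < N" and x: "norm x = 1"
    have y: "b i + r *\<^sub>R x \<in> sphere (b i) r" using x r by (simp add: dist_norm)
    then have "b i + r *\<^sub>R x \<in> A (Some i)" by (simp add: A_def)
    moreover have "Some i \<in> J" using i by (simp add: J_def)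
    ultimately have "H (b i + r *\<^sub>R x) = f (b i + r *\<^sub>R x)" using H(3) G(3) by (metis UN_I)
    also have "\<dots> = \<phi> i (b i + r *\<^sub>R x)" by (rule fi[OF i y])
    also have "\<dots> = c i + (1 / (2 * real p)) *\<^sub>R \<theta> x" using r by (simp add: \<phi>_def)
    finally show "H (b i + r *\<^sub>R x) = c i + (1 / (2 * real p)) *\<^sub>R \<theta> x" .
  qed
qed

section \<open>The rank condition\<close>

text \<open>Keeps rays and gives y the norm \<open>infnorm y\<close>, so cubes become balls.
  Preceded by division by p, it undoes the passage from beta to \<open>\<theta>\<close>.\<close>

definition to_round :: "'a::euclidean_space \<Rightarrow> 'a" where
  "to_round y = (infnorm y / norm y) *\<^sub>R y"

definition to_cube :: "'a::euclidean_space \<Rightarrow> 'a" where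
  "to_cube y = (norm y / infnorm y) *\<^sub>R y"

lemma to_round_to_cube: "to_round (to_cube y) = y"
proof (cases "y = 0")
  case False
  then have i: "infnorm y > 0" "norm y > 0" by (simp_all add: infnorm_pos_lt)
  have k: "norm y / infnorm y > 0" using i by simp
  have "infnorm (to_cube y) = norm y" "norm (to_cube y) = norm y / infnorm y * norm y"
    using k i unfolding to_cube_def infnorm_mul norm_scaleR by simp_all
  then have "to_round (to_cube y) = (norm y / (norm y / infnorm y * norm y) * (norm y / infnorm y)) *\<^sub>R y"
    unfolding to_round_def by (simp only: to_cube_def scaleR_scaleR)
  also have "norm y / (norm y / infnorm y * norm y) * (norm y / infnorm y) = 1" using i by simp
  finally show ?thesis by simp
qed (simp add: to_round_def to_cube_def)

lemma to_cube_to_round: "to_cube (to_round y) = y"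
proof (cases "y = 0")
  case False
  then have i: "infnorm y > 0" "norm y > 0" by (simp_all add: infnorm_pos_lt)
  have k: "infnorm y / norm y > 0" using i by simp
  have "norm (to_round y) = infnorm y" "infnorm (to_round y) = infnorm y / norm y * infnorm y"
    using k i unfolding to_round_def infnorm_mul norm_scaleR by simp_all
  then have "to_cube (to_round y) = (infnorm y / (infnorm y / norm y * infnorm y) * (infnorm y / norm y)) *\<^sub>R y"
    unfolding to_cube_def by (simp only: to_round_def scaleR_scaleR)
  also have "infnorm y / (infnorm y / norm y * infnorm y) * (infnorm y / norm y) = 1" using i by simp
  finally show ?thesis by simp
qed (simp add: to_round_def to_cube_def)

text \<open>The image of x is its unit vector u times \<open>infnorm x\<close>. In the difference
  for x and y, the term with u - v is controlled because the norm of y times |u - v| is at most 2 |x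
  - y|, and the sup norm is at most the norm.\<close>

lemma lipschitz_map_to_round: "lipschitz_map UNIV (to_round :: 'a::euclidean_space \<Rightarrow> 'a)"
proof (rule lipschitz_map_bound)
  have norm_le: "norm (to_round y) \<le> norm y" for y :: 'a
    using infnorm_le_norm[of y] by (cases "y = 0") (auto simp: to_round_def infnorm_pos_le)
  show "dist (to_round x) (to_round y) \<le> 3 * dist x y" for x y :: 'a
  proof (cases "x = 0 \<or> y = 0")
    case True
    have "to_round (0::'a) = 0" by (simp add: to_round_def)
    then have "dist (to_round x) (to_round y) \<le> dist x y" using True norm_le by (auto simp: dist_norm)
    then show ?thesis using zero_le_dist[of x y] by linarith
  next
    case False
    define u where "u = (1 / norm x) *\<^sub>R x"
    define v where "v = (1 / norm y) *\<^sub>R y"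
    have u: "norm u = 1" "x = norm x *\<^sub>R u" and v: "norm v = 1" "y = norm y *\<^sub>R v" using False by (auto simp: u_def v_def)
    have "norm y *\<^sub>R (u - v) = (u - u) + norm y *\<^sub>R u - y" using v(2) by (simp add: scaleR_diff_right)
    also have "\<dots> = (x - y) + (norm y - norm x) *\<^sub>R u" using u(2) by (simp add: scaleR_diff_left)
    finally have "norm (norm y *\<^sub>R (u - v)) \<le> norm (x - y) + norm ((norm y - norm x) *\<^sub>R u)"
      using norm_triangle_ineq by metis
    then have A: "norm y * norm (u - v) \<le> norm (x - y) + \<bar>norm y - norm x\<bar>" using u(1) by simp
    have "\<bar>norm y - norm x\<bar> \<le> norm (x - y)" using norm_triangle_ineq3[of y x] by (simp add: norm_minus_commute)
    with A have A: "norm y * norm (u - v) \<le> 2 * norm (x - y)" by linarith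
    have "to_round x - to_round y = (infnorm x - infnorm y) *\<^sub>R u + infnorm y *\<^sub>R (u - v)"
      by (simp add: to_round_def u_def v_def algebra_simps)
    then have "norm (to_round x - to_round y) \<le> norm ((infnorm x - infnorm y) *\<^sub>R u) + norm (infnorm y *\<^sub>R (u - v))"
      using norm_triangle_ineq by metis
    also have "\<dots> = \<bar>infnorm x - infnorm y\<bar> + infnorm y * norm (u - v)"
      using u(1) by (simp add: infnorm_pos_le)
    also have "\<dots> \<le> norm (x - y) + norm y * norm (u - v)"
    proof (rule add_mono)
      show "\<bar>infnorm x - infnorm y\<bar> \<le> norm (x - y)" using absdiff_infnorm infnorm_le_norm order_trans by blast
      show "infnorm y * norm (u - v) \<le> norm y * norm (u - v)" by (intro mult_right_mono infnorm_le_norm) simp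
    qed
    also have "\<dots> \<le> 3 * norm (x - y)" using A by linarith
    finally show ?thesis by (simp add: dist_norm)
  qed
qed

lemma bij_to_round_scaled:
  assumes "k \<noteq> 0"
  shows "bij (\<lambda>y :: 'a::euclidean_space. to_round (k *\<^sub>R y))"
proof (rule bij_betw_byWitness[where f' = "\<lambda>y. inverse k *\<^sub>R to_cube y"])
  show "\<forall>y\<in>UNIV. inverse k *\<^sub>R to_cube (to_round (k *\<^sub>R y)) = (y::'a)"
    using assms unfolding to_cube_to_round by simp
  show "\<forall>y\<in>UNIV. to_round (k *\<^sub>R inverse k *\<^sub>R to_cube y) = (y::'a)"
    using assms by (simp add: to_round_to_cube)
qed auto

text \<open>A surjective derivative would make the image fat.\<close>
lemma dim_derivative_range_less:
  fixes g :: "'a::euclidean_space \<Rightarrow> 'b::euclidean_space"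
  assumes g: "continuous_on UNIV g" "(g has_derivative D) (at x)" and e: "e > 0" "interior (g ` ball x e) = {}"
  shows "dim (range D) < DIM('b)"
proof (rule ccontr)
  assume "\<not> ?thesis"
  then have d: "dim (range D) = DIM('b)" using dim_subset_UNIV[of "range D"] by linarith
  have lin: "linear D" using g(2) by (rule has_derivative_linear)
  have "subspace (range D)" using lin by (rule linear_subspace_image) simp
  then have "range D = UNIV" using d dim_eq_full[of "range D"] by (metis span_eq_iff)
  then obtain D' where D': "linear D'" "D \<circ> D' = id" using linear_surjective_right_inverse[OF lin] by blast
  \<comment> \<open>An open mapping theorem that asks for continuity and for a derivative with a
    bounded right inverse at the point x alone.\<close>
  have "g x \<in> interior (g ` ball x e)"
  proof (rule sussmann_open_mapping[OF open_UNIV g(1) UNIV_I g(2) _ D'(2) subset_UNIV])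
    show "bounded_linear D'" using D'(1) by (rule linear_conv_bounded_linear[THEN iffD1])
    show "x \<in> interior (ball x e)" using e(1) by (simp add: interior_open)
  qed
  then show False using e(2) by simp
qed

text \<open>The choice of q gives (2p)^(n+1) = (4 D)^(n+1) q^(n+1) = q^(n+2) <= q^D, a lattice
  position for each cell. As 2p = 4 q D exceeds 3 q D + 1, the lattice fits into the ball. The
  volume condition amounts to (2p)^(n+1) < (2p)^D.\<close>

lemma packing_parameters:
  fixes D n :: nat
  assumes "D \<ge> n + 2"
  defines "q \<equiv> (4 * D) ^ (n + 1)"
  defines "p \<equiv> 2 * q * D"
  shows "q \<ge> 1" "p \<ge> 1" "(2 * p) ^ (n + 1) \<le> q ^ D" "1 / (2 * real p) * (3 * real q * real D + 1) < 1"
    "real ((2 * p) ^ (n + 1)) * (1 / (2 * real p)) ^ D < 1" "1 / (2 * real p) < 1"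
proof -
  have D: "D \<ge> 2" using assms(1) by simp
  show q1: "q \<ge> 1" using D by (simp add: q_def)
  show p1: "p \<ge> 1" using q1 D by (simp add: p_def)
  have "(2 * p) ^ (n + 1) = (4 * D) ^ (n + 1) * q ^ (n + 1)"
    unfolding power_mult_distrib[symmetric] p_def by (simp add: ac_simps)
  also have "\<dots> = q ^ (n + 2)" by (simp add: q_def)
  also have "\<dots> \<le> q ^ D" using assms(1) q1 by (intro power_increasing) auto
  finally show "(2 * p) ^ (n + 1) \<le> q ^ D" .
  have "q * D \<ge> 2" using q1 D mult_le_mono[of 1 q 2 D] by simp
  moreover have "p = 2 * (q * D)" by (simp add: p_def)
  ultimately have "3 * (q * D) + 1 < 2 * p" by linarith
  then have "real (3 * (q * D) + 1) < real (2 * p)" by (rule of_nat_less_iff[THEN iffD2])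
  then show "1 / (2 * real p) * (3 * real q * real D + 1) < 1" using p1 by (simp add: divide_simps)
  have P: "(2 * real p) > 1" using p1 by simp
  then show "1 / (2 * real p) < 1" by simp
  have "(2 * real p) ^ (n + 1) < (2 * real p) ^ D" by (rule power_strict_increasing[OF _ P]) (use assms(1) in simp)
  then show "real ((2 * p) ^ (n + 1)) * (1 / (2 * real p)) ^ D < 1"
    using P by (simp add: power_one_over divide_simps)
qed

section \<open>The extension and the rank of its derivative\<close>

text \<open>The fixed point g extends \<open>\<theta>\<close>; composing it with the Lipschitz
  bijection \<open>\<Psi>\<close> turns the cube back into the round ball and yields an extension of
  beta. A continuous bijection keeps thin images thin, and differentiability is obtained for the
  composite itself, which is Lipschitz.\<close>

theorem theorem4:
  fixes \<beta> :: "real \<times> 'k::euclidean_space \<Rightarrow> real \<times> 'n::euclidean_space"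
  assumes "DIM('n) \<ge> 2"
    and "DIM('k) \<ge> DIM('n) + 1"
    and "\<beta> ` sphere 0 1 \<subseteq> sphere 0 1"
    and "\<exists>L. L-lipschitz_on (sphere 0 1) \<beta>"
    and "cond_star \<beta>"
  shows "\<exists>\<gamma> :: real \<times> 'k \<Rightarrow> real \<times> 'n.
           (\<exists>L. L-lipschitz_on (cball 0 1) \<gamma>)
         \<and> (\<forall>x\<in>sphere 0 1. \<gamma> x = \<beta> x)
         \<and> (AE x in lebesgue. x \<in> ball 0 1 \<longrightarrow>
              (\<exists>D. (\<gamma> has_derivative D) (at x) \<and> dim (range D) \<le> DIM('n)))"
proof -
  define D where "D = DIM(real \<times> 'k)"
  define n where "n = DIM('n)"
  define q where "q = (4 * D) ^ (n + 1)"
  define p where "p = 2 * q * D"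
  \<comment> \<open>Half the side of a cell over half the side of the cube. It is both the radius of
    the holes and the scale of the copies in the target, so r and s coincide.\<close>
  define r where "r = 1 / (2 * real p)"
  have "D \<ge> n + 2" using assms(2) by (simp add: D_def n_def)
  note par = packing_parameters[OF this, folded q_def, folded p_def, folded r_def]
  have r0: "r > 0" using par(2) by (simp add: r_def)
  define N where "N = card (cell_centers p :: (real \<times> 'n) set)"
  have NP: "N \<le> (2 * p) ^ (n + 1)" using cell_centers_card(2)[where 'a="real \<times> 'n"] by (simp add: N_def n_def)
  then have Nq: "N \<le> q ^ DIM(real \<times> 'k)" using par(3) by (simp add: D_def)
  have small: "r * (3 * real q * real DIM(real \<times> 'k) + 1) < 1" using par(4) unfolding D_def .
  obtain b :: "nat \<Rightarrow> real \<times> 'k" where b': "\<forall>i<N. cball (b i) r \<subseteq> ball 0 1"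
      "\<forall>i<N. \<forall>j<N. i \<noteq> j \<longrightarrow> cball (b i) r \<inter> cball (b j) r = {}"
    using ball_packing[OF par(1) Nq r0 small] by (elim exE conjE)
  have b: "\<And>i. i < N \<Longrightarrow> cball (b i) r \<subseteq> ball 0 1"
      "\<And>i j. i < N \<Longrightarrow> j < N \<Longrightarrow> i \<noteq> j \<Longrightarrow> cball (b i) r \<inter> cball (b j) r = {}"
    using b' by blast+
  obtain c :: "nat \<Rightarrow> real \<times> 'n" where c: "bij_betw c {..<N} (cell_centers p)"
    using ex_bij_betw_nat_finite[OF cell_centers_card(1), of p] unfolding N_def atLeast0LessThan by (elim exE)
  define \<theta> where "\<theta> = (\<lambda>x. (real p * inverse (infnorm (\<beta> x))) *\<^sub>R \<beta> x)"
  define X where "X = cball 0 1 - (\<Union>i\<in>{..<N}. ball (b i) r)"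
  have l\<beta>: "lipschitz_map (sphere 0 1) \<beta>" using assms(4) by (simp add: lipschitz_map_def)
  have "\<exists>F. lipschitz_map X F \<and> F ` X \<subseteq> grid \<and> (\<forall>x\<in>sphere 0 1. F x = \<theta> x) \<and>
      (\<forall>i<N. \<forall>x. norm x = 1 \<longrightarrow> F (b i + r *\<^sub>R x) = c i + r *\<^sub>R \<theta> x)"
    by (rule collared_map[OF l\<beta> assms(3,5) par(2) c b r0 \<theta>_def X_def, folded r_def]; assumption)
  then obtain F where F': "lipschitz_map X F" "F ` X \<subseteq> grid" "\<forall>x\<in>sphere 0 1. F x = \<theta> x"
      "\<forall>i<N. \<forall>x. norm x = 1 \<longrightarrow> F (b i + r *\<^sub>R x) = c i + r *\<^sub>R \<theta> x"
    by (elim exE conjE)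
  have F: "lipschitz_map X F" "F ` X \<subseteq> grid" "\<And>x. x \<in> sphere 0 1 \<Longrightarrow> F x = \<theta> x"
      "\<And>i x. i < N \<Longrightarrow> norm x = 1 \<Longrightarrow> F (b i + r *\<^sub>R x) = c i + r *\<^sub>R \<theta> x"
    using F' by blast+
  interpret self_similar "{..<N}" b c r r F \<theta> X grid
  proof
    have "real N * r ^ D \<le> real ((2 * p) ^ (n + 1)) * r ^ D"
      using NP r0 by (intro mult_right_mono) (simp_all only: of_nat_le_iff zero_le_power less_imp_le)
    then show "real (card {..<N}) * r ^ DIM(real \<times> 'k) < 1" using par(5) by (simp add: D_def)
    show "finite {..<N}" "0 < r" "r \<le> r" "r < 1" by (simp_all add: r0 par(6))
    show "cball (b i) r \<subseteq> ball 0 1" if "i \<in> {..<N}" for i using b(1) that by blast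
    show "cball (b i) r \<inter> cball (b j) r = {}" if "i \<in> {..<N}" "j \<in> {..<N}" "i \<noteq> j" for i j
      using b(2) that by blast
    show "X = cball 0 1 - (\<Union>i\<in>{..<N}. ball (b i) r)" by (rule X_def)
    show "F (b i + r *\<^sub>R x) = c i + r *\<^sub>R \<theta> x" if "i \<in> {..<N}" "norm x = 1" for i x
      using F(4) that by blast
  qed (fact F(1) F(2) F(3) interior_grid)+
  obtain g L where g: "admissible L g" "\<And>x. x \<in> cball 0 1 \<Longrightarrow> step g x = g x" using fixed_point by blast
  define \<Psi> where "\<Psi> y = to_round (inverse (real p) *\<^sub>R y)" for y :: "real \<times> 'n"
  have \<Psi>: "lipschitz_map UNIV \<Psi>" unfolding \<Psi>_def
    by (rule lipschitz_map_compose[OF lipschitz_map_to_round lipschitz_map_bounded_linear[OF bounded_linear_scaleR_right] subset_UNIV])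
  have b\<Psi>: "bij \<Psi>" unfolding \<Psi>_def using par(2) by (intro bij_to_round_scaled) simp
  define \<gamma> where "\<gamma> x = \<Psi> (g x)" for x
  have "lipschitz_map (cball 0 1) g" using g(1) by (auto simp: admissible_def lipschitz_map_def)
  then have l\<gamma>: "lipschitz_map (cball 0 1) \<gamma>" unfolding \<gamma>_def by (rule lipschitz_map_compose[OF \<Psi> _ subset_UNIV])
  \<comment> \<open>Rademacher's theorem is available on the whole space; on the open ball the
    extension and \<open>\<gamma>\<close> agree, so they have the same derivatives there.\<close>
  obtain \<gamma>' where \<gamma>': "lipschitz_map UNIV \<gamma>'" "\<And>x. x \<in> cball 0 1 \<Longrightarrow> \<gamma>' x = \<gamma> x"
    using lipschitz_extension[OF l\<gamma>] by blast
  have "negligible {x. \<not> \<gamma>' differentiable (at x)}"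
    using \<gamma>'(1) Rademacher unfolding lipschitz_map_def by blast
  then have neg: "negligible ({x. \<not> \<gamma>' differentiable (at x)} \<union> fat_points g)"
    using negligible_fat_points[OF g(2)] by (rule negligible_Un)
  have good: "\<exists>D. (\<gamma> has_derivative D) (at x) \<and> dim (range D) \<le> DIM('n)"
    if x: "x \<in> ball 0 1" "\<gamma>' differentiable (at x)" "x \<notin> fat_points g" for x
  proof -
    obtain D where D: "(\<gamma>' has_derivative D) (at x)" using x(2) by (auto simp: differentiable_def)
    obtain e where e: "e > 0" "interior (g ` ball x e) = {}" using x(1,3) by (auto simp: fat_points_def)
    obtain d where d: "d > 0" "ball x d \<subseteq> ball 0 1" using openE[OF open_ball x(1)] by blast
    define \<epsilon> where "\<epsilon> = min d e"
    have \<epsilon>: "\<epsilon> > 0" "ball x \<epsilon> \<subseteq> ball x e" "ball x \<epsilon> \<subseteq> ball 0 1" using d e(1) by (auto simp: \<epsilon>_def)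
    have eq: "\<gamma>' y = \<gamma> y" if "y \<in> ball 0 1" for y using \<gamma>'(2) ball_subset_cball that by blast
    have "interior (g ` ball x \<epsilon>) \<subseteq> interior (g ` ball x e)" by (intro interior_mono image_mono \<epsilon>(2))
    then have "interior (\<Psi> ` (g ` ball x \<epsilon>)) = {}"
      using e(2) by (intro interior_image_bij_empty[OF lipschitz_map_continuous[OF \<Psi>] b\<Psi>]) auto
    moreover have "\<gamma>' ` ball x \<epsilon> = \<Psi> ` (g ` ball x \<epsilon>)"
      unfolding image_image using eq \<epsilon>(3) by (intro image_cong) (auto simp: \<gamma>_def)
    ultimately have "interior (\<gamma>' ` ball x \<epsilon>) = {}" by simp
    from dim_derivative_range_less[OF lipschitz_map_continuous[OF \<gamma>'(1)] D \<epsilon>(1) this]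
    have "dim (range D) \<le> DIM('n)" by simp
    moreover have "(\<gamma> has_derivative D) (at x)"
      by (rule has_derivative_transform_within_open[OF D open_ball x(1)]) (rule eq)
    ultimately show ?thesis by blast
  qed
  show ?thesis
  proof (intro exI[of _ \<gamma>] conjI ballI)
    show "\<exists>L. L-lipschitz_on (cball 0 1) \<gamma>" using l\<gamma> by (simp add: lipschitz_map_def)
    show "\<gamma> x = \<beta> x" if x: "x \<in> sphere 0 1" for x
    proof -
      have n1: "norm (\<beta> x) = 1" using assms(3) x by (auto simp: image_subset_iff)
      then have i0: "infnorm (\<beta> x) > 0" by (auto simp: infnorm_pos_lt)
      define k where "k = inverse (infnorm (\<beta> x))"
      have k: "k > 0" "k * infnorm (\<beta> x) = 1" using i0 by (auto simp: k_def)
      have gx: "g x = \<theta> x" using g(1) x by (simp add: admissible_def)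
      have pk: "inverse (real p) * (real p * k) = k" using par(2) by simp
      have "\<gamma> x = to_round (inverse (real p) *\<^sub>R ((real p * k) *\<^sub>R \<beta> x))"
        unfolding \<gamma>_def \<Psi>_def gx \<theta>_def k_def ..
      also have "\<dots> = to_round (k *\<^sub>R \<beta> x)" by (simp only: scaleR_scaleR pk)
      also have "\<dots> = (1 / k * k) *\<^sub>R \<beta> x" using k n1 by (simp add: to_round_def infnorm_mul)
      finally show ?thesis using k(1) by simp
    qed
    show "AE x in lebesgue. x \<in> ball 0 1 \<longrightarrow> (\<exists>D. (\<gamma> has_derivative D) (at x) \<and> dim (range D) \<le> DIM('n))"
    proof (rule AE_I'[OF neg[unfolded negligible_iff_null_sets]])
      show "{x \<in> space lebesgue. \<not> (x \<in> ball 0 1 \<longrightarrow> (\<exists>D. (\<gamma> has_derivative D) (at x) \<and> dim (range D) \<le> DIM('n)))}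
        \<subseteq> {x. \<not> \<gamma>' differentiable (at x)} \<union> fat_points g"
        using good by blast
    qed
  qed
qed

end
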